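(* Let $n\ge2$, let $\Omega\subset\mathbb{R}^n$ be a bounded domain, and let $F$, $G$ and the constants $g_0,G_0,m_0,M_0,m_1,m_2$ be as in the context. Let $\lambda\in\mathbb{R}$ and let $g$ be a ($C^3$, time-independent) boundary function on $\partial\Omega$ with $|D_{T_i}g|,\ |D_{T_iT_j}g|\le M$ for some constant $M$ and all $1\le i,j\le n-1$. At each boundary point order the principal curvatures of $\partial\Omega$ so that, for some $\alpha$ with $1\le\alpha\le n-1$ (depending on the point), $k_1\ge\cdots\ge k_\alpha\ge0>k_{\alpha+1}\ge\cdots\ge k_{n-1}$, and assume $\max_i|k_i|<\infty$. With $$\gamma_1:=g_0\Big(\frac{2}{2+M^2}m_0-\sqrt2\,M m_1-m_2\Big),\qquad \gamma_2:=G_0\big(M_0+\sqrt2\,M m_1+m_2\big),$$ assume $\gamma_1>0$ and $\gamma_1\sum_{i=1}^{\alpha}k_i+\gamma_2\sum_{i=\alpha+1}^{n-1}k_i>0$ on $\partial\Omega$. Let $w$ be a solution of the elliptic problem $$ \begin{cases} \lambda = G(Dw,-1)\, D^2_{p_ip_j}F(Dw,-1)\,w_{x_ix_j} & \text{in } \Omega,\\ w=g & \text{on } \partial\Omega, \end{cases} $$ and let $u(x,t)$ be a classical solution, for all $t\ge0$, of $$ \begin{cases} u_t = G(Du,-1)\, D^2_{p_ip_j}F(Du,-1)\,u_{x_ix_j} & \text{in } \Omega\times[0,\infty),\\ u=g(\cdot)+\lambda t & \text{on } \partial\Omega\times[0,\infty),\\ u(\cdot,0)=u_0(\cdot) & \text{in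 } \Omega. \end{cases} $$ Then there exists a constant $C$ such that $u(x,t)$ converges to $w(x)+\lambda t+C$ as $t\to\infty$, uniformly in $x\in\Omega$; that is, $\sup_{x\in\Omega}|u(x,t)-w(x)-\lambda t-C|\to0$ as $t\to\infty$.
   Context: $Du$ is the spatial gradient; repeated indices $i,j$ in the equations are summed over $1\le i,j\le n$, and $D^2_{p_ip_j}F$ denotes second derivatives of $F$ with respect to its first $n$ variables. Boundary geometry: $N$ is the unit inward normal to $\partial\Omega$. At each $x\in\partial\Omega$, $T_1,\dots,T_{n-1}$ is an orthonormal basis of the tangent space of $\partial\Omega$ consisting of principal directions, with principal curvatures $k_i$, signed so that $D_{T_i}T_i=k_iN$ (so $k_i\ge 0$ for convex domains), and with $D_{T_j}T_i=0$ for $i\ne j$ at the point, $D_{T_i}N=-k_iT_i$. $D_{T_i}g$ and $D_{T_iT_j}g=D_{T_i}D_{T_j}g$ are the first and second tangential derivatives of $g$ along $\partial\Omega$ in this frame. Anisotropy and mobility: $F$ and $G$ are positive functions on the unit sphere $\mathbb{S}^n\subset\mathbb{R}^{n+1}$ extended to $\mathbb{R}^{n+1}$ by homogeneity of degree one ($F(\lambda p)=\lambda F(p)$, $G(\lambda p)=\lambda G(p)$ for $\lambda>0$), smooth away from the origin; $F$ is convex on $\mathbb{R}^{n+1}$. With $\xi=\xi(p)=p/|p|$, $F(\xi)$ is regarded as the degree-zero homogeneous function $p\mapsto F(p/|p|)$, and $D_{p_i}F(\xi)$, $D^2_{p_ip_j}F(\xi)$ are its derivatives in $p$. There are positive constants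 $g_0,G_0,m_0,M_0,m_1,m_2$ such that for all $p\neq 0$ and $1\le i,j\le n$: $g_0\le G(\xi)\le G_0$; $m_0\le F(\xi)\le M_0$; $|D_{p_i}F(\xi)|<m_1/|p|$; $\|[D^2_{p_ip_j}F(\xi)]_{1\le i,j\le n}\|<m_2/|p|^2$, where $\|M\|=\sqrt{\mathrm{tr}(M^TM)}$ is the Frobenius norm. *)

theory Defs
  imports "HOL-Analysis.Analysis"
begin

definition dir_deriv :: "'a::real_normed_vector \<Rightarrow> ('a \<Rightarrow> real) \<Rightarrow> 'a \<Rightarrow> real" where
  "dir_deriv v f x = frechet_derivative f (at x) v"

text \<open>\<open>Ck_on k f S\<close>: the function \<open>f\<close> is of class \<open>C\<^sup>k\<close> on the set \<open>S\<close>, which is meant to be open.\<close>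

primrec Ck_on :: "nat \<Rightarrow> ('a::euclidean_space \<Rightarrow> real) \<Rightarrow> 'a set \<Rightarrow> bool" where
  "Ck_on 0 f S \<longleftrightarrow> continuous_on S f"
| "Ck_on (Suc k) f S \<longleftrightarrow>
     (\<forall>x\<in>S. f differentiable (at x)) \<and> (\<forall>b\<in>Basis. Ck_on k (dir_deriv b f) S)"

abbreviation pd :: "'n \<Rightarrow> (real^'n \<Rightarrow> real) \<Rightarrow> real^'n \<Rightarrow> real" where
  "pd i \<equiv> dir_deriv (axis i 1)"

definition grad :: "(real^'n \<Rightarrow> real) \<Rightarrow> real^'n \<Rightarrow> real^'n" where
  "grad f x = (\<chi> i. pd i f x)"

text \<open>\<open>inward_normal \<Omega> x v\<close>: near \<open>x\<close> the set \<open>\<Omega>\<close> is the positivity set of a \<open>C\<^sup>2\<close> function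
  \<open>\<rho>\<close> whose gradient does not vanish at \<open>x\<close>, and \<open>v\<close> is the normalized gradient of \<open>\<rho>\<close> at \<open>x\<close>.
  If every boundary point admits such a \<open>v\<close>, then \<open>\<Omega>\<close> has \<open>C\<^sup>2\<close> boundary, and \<open>v\<close> is unique.\<close>

definition inward_normal :: "(real^'n) set \<Rightarrow> real^'n \<Rightarrow> real^'n \<Rightarrow> bool" where
  "inward_normal \<Omega> x v \<longleftrightarrow>
     (\<exists>\<rho> r. 0 < r \<and> Ck_on 2 \<rho> (ball x r) \<and> \<Omega> \<inter> ball x r = {y \<in> ball x r. 0 < \<rho> y} \<and>
        \<rho> x = 0 \<and> grad \<rho> x \<noteq> 0 \<and> v = (1 / norm (grad \<rho> x)) *\<^sub>R grad \<rho> x)"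

text \<open>Derivative at \<open>x\<close>, in direction \<open>v\<close>, of a function given on the hypersurface
  \<open>\<partial>\<Omega>\<close>.  The derivative within \<open>\<partial>\<Omega>\<close> is not unique as a linear map on the ambient space, but for
  differentiable \<open>f\<close> its value on a \<^emph>\<open>tangent\<close> vector \<open>v\<close> is.\<close>

definition bdry_deriv ::
  "(real^'n) set \<Rightarrow> real^'n \<Rightarrow> (real^'n \<Rightarrow> 'b::real_normed_vector) \<Rightarrow> real^'n \<Rightarrow> 'b" where
  "bdry_deriv \<Omega> v f x = frechet_derivative f (at x within frontier \<Omega>) v"

text \<open>\<open>principal_frame \<Omega> N \<kappa> T x\<close>: the fields \<open>T 1, \<dots>, T (n - 1)\<close> form an orthonormal frame of
  the tangent spaces of \<open>\<partial>\<Omega>\<close> in a neighbourhood of \<open>x\<close>; at the point \<open>x\<close> itself they are principal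
  directions with principal curvatures \<open>\<kappa> 1, \<dots>, \<kappa> (n - 1)\<close>, and
  \<open>D\<^bsub>T\<^sub>i\<^esub> T\<^sub>i = \<kappa>\<^sub>i N\<close>, \<open>D\<^bsub>T\<^sub>i\<^esub> T\<^sub>j = 0\<close> for \<open>i \<noteq> j\<close>, \<open>D\<^bsub>T\<^sub>i\<^esub> N = - \<kappa>\<^sub>i T\<^sub>i\<close>.  The frame is adapted to the
  single point \<open>x\<close>, since these relations cannot in general hold on a whole neighbourhood.\<close>

definition principal_frame ::
  "(real^'n) set \<Rightarrow> (real^'n \<Rightarrow> real^'n) \<Rightarrow> (nat \<Rightarrow> real) \<Rightarrow> (nat \<Rightarrow> real^'n \<Rightarrow> real^'n) \<Rightarrow> real^'n \<Rightarrow> bool"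
  where
  "principal_frame \<Omega> N \<kappa> T x \<longleftrightarrow>
     (\<exists>r>0. \<forall>y \<in> frontier \<Omega> \<inter> ball x r. \<forall>i\<in>{1..<CARD('n)}. N y \<bullet> T i y = 0 \<and>
        (\<forall>j\<in>{1..<CARD('n)}. T i y \<bullet> T j y = (if i = j then 1 else 0))) \<and>
     N differentiable (at x within frontier \<Omega>) \<and>
     (\<forall>i\<in>{1..<CARD('n)}. T i differentiable (at x within frontier \<Omega>) \<and>
        bdry_deriv \<Omega> (T i x) N x = - \<kappa> i *\<^sub>R T i x \<and>
        (\<forall>j\<in>{1..<CARD('n)}. bdry_deriv \<Omega> (T i x) (T j) x = (if i = j then \<kappa> i *\<^sub>R N x else 0)))"

definition Ck_bdry :: "nat \<Rightarrow> (real^'n) set \<Rightarrow> (real^'n \<Rightarrow> real) \<Rightarrow> bool" where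
  "Ck_bdry k \<Omega> g \<longleftrightarrow>
     (\<forall>x\<in>frontier \<Omega>. \<exists>r>0. \<exists>h. Ck_on k h (ball x r) \<and> (\<forall>y\<in>frontier \<Omega> \<inter> ball x r. h y = g y))"

text \<open>The ambient space of dimension \<open>n + 1\<close> is \<open>(real^'n) \<times> real\<close>, so that \<open>(Du, -1)\<close> is literally
  the pair \<open>(grad u x, -1)\<close>; indices \<open>i\<close>, \<open>j\<close> range over the first \<open>n\<close> coordinates only.\<close>

definition anisotropic :: "((real^'n) \<times> real \<Rightarrow> real) \<Rightarrow> bool" where
  "anisotropic F \<longleftrightarrow>
     (\<forall>p\<in>sphere 0 1. 0 < F p) \<and> (\<forall>c>0. \<forall>p. F (c *\<^sub>R p) = c * F p) \<and> (\<forall>k. Ck_on k F (- {0}))"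

abbreviation dp :: "'n \<Rightarrow> ((real^'n) \<times> real \<Rightarrow> real) \<Rightarrow> (real^'n) \<times> real \<Rightarrow> real" where
  "dp i \<equiv> dir_deriv (axis i 1, 0)"

definition hess_p :: "((real^'n) \<times> real \<Rightarrow> real) \<Rightarrow> (real^'n) \<times> real \<Rightarrow> real^'n^'n" where
  "hess_p F p = (\<chi> i j. dp i (dp j F) p)"

definition radial_ext :: "((real^'n) \<times> real \<Rightarrow> real) \<Rightarrow> (real^'n) \<times> real \<Rightarrow> real" where
  "radial_ext F p = F ((1 / norm p) *\<^sub>R p)"

definition frobenius :: "real^'n^'n \<Rightarrow> real" where
  "frobenius A = sqrt (trace (transpose A ** A))"

definition aniso_op ::
  "((real^'n) \<times> real \<Rightarrow> real) \<Rightarrow> ((real^'n) \<times> real \<Rightarrow> real) \<Rightarrow> (real^'n \<Rightarrow> real) \<Rightarrow> real^'n \<Rightarrow> real" where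
  "aniso_op F G w x =
     G (grad w x, -1) *
     (\<Sum>i\<in>UNIV. \<Sum>j\<in>UNIV. hess_p F (grad w x, -1) $ i $ j * pd i (pd j w) x)"

definition elliptic_solution ::
  "((real^'n) \<times> real \<Rightarrow> real) \<Rightarrow> ((real^'n) \<times> real \<Rightarrow> real) \<Rightarrow> (real^'n) set \<Rightarrow> (real^'n \<Rightarrow> real) \<Rightarrow>
   real \<Rightarrow> (real^'n \<Rightarrow> real) \<Rightarrow> bool" where
  "elliptic_solution F G \<Omega> g lam w \<longleftrightarrow>
     Ck_on 2 w \<Omega> \<and> continuous_on (closure \<Omega>) w \<and>
     (\<forall>x\<in>\<Omega>. lam = aniso_op F G w x) \<and>
     (\<forall>x\<in>frontier \<Omega>. w x = g x)"

text \<open>The time derivative is taken within \<open>[0,\<infinity>)\<close>, hence one-sided at time \<open>0\<close>.\<close>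

definition dt :: "(real^'n \<Rightarrow> real \<Rightarrow> real) \<Rightarrow> real^'n \<Rightarrow> real \<Rightarrow> real" where
  "dt u x t = vector_derivative (u x) (at t within {0..})"

text \<open>Class \<open>C\<^sup>2\<^sup>,\<^sup>1(\<Omega> \<times> [0,\<infinity>))\<close> (two derivatives in space, one in time, all of them jointly
  continuous), together with continuity up to the lateral boundary.\<close>

definition classical_class :: "(real^'n) set \<Rightarrow> (real^'n \<Rightarrow> real \<Rightarrow> real) \<Rightarrow> bool" where
  "classical_class \<Omega> u \<longleftrightarrow>
     continuous_on (closure \<Omega> \<times> {0..}) (\<lambda>(x, t). u x t) \<and>
     (\<forall>t\<ge>0. Ck_on 2 (\<lambda>x. u x t) \<Omega>) \<and>
     (\<forall>x\<in>\<Omega>. \<forall>t\<ge>0. u x differentiable (at t within {0..})) \<and>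
     (\<forall>i. continuous_on (\<Omega> \<times> {0..}) (\<lambda>(x, t). pd i (\<lambda>y. u y t) x)) \<and>
     (\<forall>i j. continuous_on (\<Omega> \<times> {0..}) (\<lambda>(x, t). pd i (pd j (\<lambda>y. u y t)) x)) \<and>
     continuous_on (\<Omega> \<times> {0..}) (\<lambda>(x, t). dt u x t)"

definition parabolic_solution ::
  "((real^'n) \<times> real \<Rightarrow> real) \<Rightarrow> ((real^'n) \<times> real \<Rightarrow> real) \<Rightarrow> (real^'n) set \<Rightarrow> (real^'n \<Rightarrow> real) \<Rightarrow>
   real \<Rightarrow> (real^'n \<Rightarrow> real) \<Rightarrow> (real^'n \<Rightarrow> real \<Rightarrow> real) \<Rightarrow> bool" where
  "parabolic_solution F G \<Omega> g lam u0 u \<longleftrightarrow>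
     classical_class \<Omega> u \<and>
     (\<forall>x\<in>\<Omega>. \<forall>t\<ge>0. dt u x t = aniso_op F G (\<lambda>y. u y t) x) \<and>
     (\<forall>x\<in>frontier \<Omega>. \<forall>t\<ge>0. u x t = g x + lam * t) \<and>
     (\<forall>x\<in>\<Omega>. u x 0 = u0 x)"

end

theory Submission
  imports Defs
begin

text \<open>
  The limit constant is \<open>C = 0\<close>: the difference \<open>v = u - w - lam t\<close> vanishes on the boundary at all times, and it
  tends to zero uniformly.  Let \<open>a(q) = G(q, -1) D\<^sup>2F(q, -1)\<close>, so that \<open>u\<^sub>t = a(Du) : D\<^sup>2u\<close> and
  \<open>a(Dw) : D\<^sup>2w = lam\<close>.  As \<open>F\<close> is merely convex, \<open>a\<close> may be degenerate, and the gradients and second derivatives of \<open>u\<close>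
  and \<open>w\<close> need not be bounded near the boundary.  The strong maximum principle may thus fail,
  and the proof rests on two comparison arguments, in both of which the maximum of a suitable
  function over space is shown to decrease at a fixed rate while it is above a threshold
  (\<open>time_decay_of_max\<close>).

  Near the boundary, \<open>u - lam t\<close> is compared with \<open>W = w x0 + e + B |x - x0|\<^sup>2 + s \<rho>\<close>, where \<open>\<rho>\<close> is a defining
  function of the domain and \<open>s\<close> is huge.  The coefficient is homogeneous of degree zero in the vector \<open>(q, -1)\<close>, so for
  steep functions it approaches its value at the horizontal vector \<open>(D\<rho>, 0)\<close>.  That matrix annihilates \<open>D\<rho>\<close>, and its
  values on tangent vectors lie between \<open>g0 (m0 - m2)\<close> and \<open>G0 (M0 + m2)\<close>; hence its pairing with \<open>D\<^sup>2\<rho>\<close>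
  is minus a weighted sum of principal curvatures, negative by the curvature condition
  (\<open>boundary_barrier\<close>).  So \<open>W\<close> is a strict supersolution, and \<open>v \<le> e\<close> in a neighbourhood of the
  boundary that is independent of time (\<open>collar_control\<close>).

  In the interior, variables are doubled: one maximises
  \<open>u(x, t) - lam t - w(y) - |x - y|\<^sup>2 / (2 \<epsilon>) + \<tau> |x|\<^sup>2 / 2\<close>.  With \<open>q = Dw(y)\<close> and \<open>Y = D\<^sup>2w(y)\<close>, at the maximum
  \<open>Du(x) = q - \<tau> x\<close> and \<open>D\<^sup>2u(x) \<le> Y - \<epsilon> Y\<^sup>2 + \<epsilon>\<^sup>2 Y\<^sup>3 - \<tau>\<close> (\<open>hessian_doubling\<close>).  The gain \<open>- \<epsilon> a : Y\<^sup>2\<close> pays for the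
  change of the coefficients when \<open>a(q) Y \<noteq> 0\<close>.  When \<open>a(q) Y = 0\<close>, the first order change of the coefficients in
  the range of \<open>Y\<close> is zero, because nonnegative forms have vanishing derivative where they vanish; then
  \<open>- \<tau> tr a < 0\<close> remains (\<open>perturbed_trace_eventually\<close>).  Either way the maximum decreases at a fixed rate until it is
  controlled by the values of \<open>v\<close> near the boundary (\<open>upper_bound_eventually\<close>).

  The lower bound is the upper bound for \<open>-u\<close>, \<open>-w\<close>, \<open>-lam\<close> and \<open>q \<mapsto> a(-q)\<close>.
\<close>

section \<open>Twice differentiable functions\<close>

text \<open>A gradient field and a Hessian field carried along explicitly: \<open>f1\<close> is the gradient of \<open>f\<close> on \<open>S\<close>,
  and \<open>f2 x h\<close> is the Hessian of \<open>f\<close> at \<open>x\<close> applied to \<open>h\<close>.  This avoids partial derivatives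
  in all arguments about maxima; continuity of the Hessian is required separately where it matters.\<close>

definition twice_diff ::
  "('a::real_inner \<Rightarrow> real) \<Rightarrow> ('a \<Rightarrow> 'a) \<Rightarrow> ('a \<Rightarrow> 'a \<Rightarrow> 'a) \<Rightarrow> 'a set \<Rightarrow> bool" where
  "twice_diff f f1 f2 S \<longleftrightarrow>
     (\<forall>x\<in>S. (f has_derivative (\<lambda>h. f1 x \<bullet> h)) (at x) \<and> (f1 has_derivative f2 x) (at x))"

lemma twice_diff_subset: "twice_diff f f1 f2 S \<Longrightarrow> R \<subseteq> S \<Longrightarrow> twice_diff f f1 f2 R"
  by (auto simp: twice_diff_def)

lemma twice_diffD:
  assumes "twice_diff f f1 f2 S" "x \<in> S"
  shows "(f has_derivative (\<lambda>h. f1 x \<bullet> h)) (at x)" "(f1 has_derivative f2 x) (at x)"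
  using assms by (auto simp: twice_diff_def)

lemma twice_diff_continuous_on:
  assumes "twice_diff f f1 f2 S"
  shows "continuous_on S f" "continuous_on S f1"
  using assms by (auto simp: twice_diff_def intro!: continuous_at_imp_continuous_on has_derivative_continuous)

lemma twice_diff_minus:
  assumes "twice_diff f f1 f2 S"
  shows "twice_diff (\<lambda>x. - f x) (\<lambda>x. - f1 x) (\<lambda>x h. - f2 x h) S"
  using assms unfolding twice_diff_def
  by (auto intro!: derivative_eq_intros simp: inner_minus_left)

lemma frechet_derivative_expand:
  fixes f :: "'a::euclidean_space \<Rightarrow> real"
  assumes "f differentiable (at x)"
  shows "frechet_derivative f (at x) h = (\<Sum>b\<in>Basis. (h \<bullet> b) * dir_deriv b f x)"
proof -
  have lin: "linear (frechet_derivative f (at x))"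
    using assms frechet_derivative_works has_derivative_linear by blast
  have "frechet_derivative f (at x) (\<Sum>b\<in>Basis. (h \<bullet> b) *\<^sub>R b)
     = (\<Sum>b\<in>Basis. (h \<bullet> b) *\<^sub>R frechet_derivative f (at x) b)"
    using lin by (simp add: linear_sum linear_scale)
  then show ?thesis by (simp add: euclidean_representation dir_deriv_def)
qed

lemma differentiable_imp_has_gradient:
  fixes f :: "'a::euclidean_space \<Rightarrow> real"
  assumes "f differentiable (at x)"
  shows "(f has_derivative (\<lambda>h. (\<Sum>b\<in>Basis. dir_deriv b f x *\<^sub>R b) \<bullet> h)) (at x)"
proof -
  have "(f has_derivative frechet_derivative f (at x)) (at x)"
    using assms frechet_derivative_works by blast
  moreover have "frechet_derivative f (at x) = (\<lambda>h. (\<Sum>b\<in>Basis. dir_deriv b f x *\<^sub>R b) \<bullet> h)"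
    by (rule ext) (simp add: frechet_derivative_expand[OF assms] inner_sum_right inner_commute[of _ "_ :: 'a"] mult.commute
      inner_commute[of "sum _ _"])
  ultimately show ?thesis by simp
qed

lemma dir_deriv_eq:
  assumes "(f has_derivative (\<lambda>h. g \<bullet> h)) (at x)"
  shows "dir_deriv v f x = g \<bullet> v"
  using frechet_derivative_at[OF assms] by (metis dir_deriv_def)

lemma twice_diff_dir_deriv:
  assumes "twice_diff f f1 f2 S" "x \<in> S"
  shows "dir_deriv v f x = f1 x \<bullet> v"
  using assms by (simp add: dir_deriv_eq twice_diff_def)

text \<open>The outer derivative only sees the inner one near \<open>x\<close>, and there the inner one is a component of
  the gradient field; this needs \<open>S\<close> to be open.\<close>

lemma twice_diff_dir_deriv2:
  assumes "twice_diff f f1 f2 S" "open S" "x \<in> S"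
  shows "dir_deriv v (dir_deriv b f) x = f2 x v \<bullet> b"
proof -
  have "((\<lambda>y. f1 y \<bullet> b) has_derivative (\<lambda>h. f2 x h \<bullet> b)) (at x)"
    using twice_diffD(2)[OF assms(1,3)] by (auto intro!: derivative_eq_intros)
  then have "(dir_deriv b f has_derivative (\<lambda>h. f2 x h \<bullet> b)) (at x)"
    by (rule has_derivative_transform_within_open[OF _ assms(2,3)])
       (simp add: twice_diff_dir_deriv[OF assms(1)])
  from frechet_derivative_at[OF this] show ?thesis by (metis dir_deriv_def)
qed

lemma Ck_on_2_twice_diff:
  fixes f :: "'a::euclidean_space \<Rightarrow> real"
  assumes "Ck_on 2 f S"
  obtains f1 f2 where "twice_diff f f1 f2 S" "\<And>v. continuous_on S (\<lambda>x. f2 x v)"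
proof -
  have d0: "f differentiable (at x)" if "x \<in> S" for x
    using assms that by (simp add: numeral_2_eq_2)
  have d1: "dir_deriv b f differentiable (at x)" if "x \<in> S" "b \<in> Basis" for x b
    using assms that by (simp add: numeral_2_eq_2)
  have c2: "continuous_on S (dir_deriv c (dir_deriv b f))" if "c \<in> Basis" "b \<in> Basis" for c b
    using assms that by (simp add: numeral_2_eq_2)
  define f1 where "f1 x = (\<Sum>b\<in>Basis. dir_deriv b f x *\<^sub>R b)" for x
  define f2 where "f2 x h = (\<Sum>b\<in>Basis. frechet_derivative (dir_deriv b f) (at x) h *\<^sub>R b)" for x h
  have "twice_diff f f1 f2 S"
    unfolding twice_diff_def
  proof (intro ballI conjI)
    fix x assume x: "x \<in> S"
    show "(f has_derivative (\<lambda>h. f1 x \<bullet> h)) (at x)"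
      unfolding f1_def using differentiable_imp_has_gradient[OF d0[OF x]] .
    have "(dir_deriv b f has_derivative frechet_derivative (dir_deriv b f) (at x)) (at x)" if "b \<in> Basis" for b
      using d1[OF x that] frechet_derivative_works by blast
    then show "(f1 has_derivative f2 x) (at x)"
      unfolding f1_def f2_def by (auto intro!: derivative_eq_intros)
  qed
  moreover have "continuous_on S (\<lambda>x. f2 x v)" for v
  proof -
    have "continuous_on S (\<lambda>x. \<Sum>b\<in>Basis. (\<Sum>c\<in>Basis. (v \<bullet> c) * dir_deriv c (dir_deriv b f) x) *\<^sub>R b)"
      by (intro continuous_intros c2)
    moreover have "f2 x v = (\<Sum>b\<in>Basis. (\<Sum>c\<in>Basis. (v \<bullet> c) * dir_deriv c (dir_deriv b f) x) *\<^sub>R b)"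
      if "x \<in> S" for x
      unfolding f2_def by (intro sum.cong refl arg_cong2[where f=scaleR] frechet_derivative_expand d1 that)
    ultimately show ?thesis by (simp cong: continuous_on_cong)
  qed
  ultimately show ?thesis using that by blast
qed

text \<open>The second difference is the increment over \<open>[0, s]\<close> of \<open>\<theta> \<mapsto> f (x + s h + \<theta> k) - f (x + \<theta> k)\<close>.
  By the mean value theorem it equals \<open>s\<close> times a difference of two gradients, which is
  \<open>s\<^sup>2 f2 x h \<bullet> k\<close> up to an error \<open>o(s\<^sup>2)\<close> because \<open>f1\<close> is differentiable at \<open>x\<close>.\<close>

lemma second_difference_limit:
  assumes td: "twice_diff f f1 f2 S" and "open S" "x \<in> S"
  shows "((\<lambda>s. (f (x + s *\<^sub>R h + s *\<^sub>R k) - f (x + s *\<^sub>R h) - f (x + s *\<^sub>R k) + f x) / s\<^sup>2)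
           \<longlongrightarrow> f2 x h \<bullet> k) (at_right 0)"
proof (rule tendstoI)
  fix e :: real assume e: "e > 0"
  define C where "C = 2 * (norm h + norm k + 1) * (norm k + 1)"
  have Cp: "C > 0" unfolding C_def by (intro mult_pos_pos) (simp_all add: add_nonneg_pos)
  have lin: "linear (f2 x)" using twice_diffD(2)[OF td \<open>x \<in> S\<close>] has_derivative_linear by blast
  obtain r where r: "r > 0" "ball x r \<subseteq> S"
    using \<open>open S\<close> \<open>x \<in> S\<close> open_contains_ball by blast
  obtain d where d: "d > 0" and dd: "\<And>y. norm (y - x) < d \<Longrightarrow>
      norm (f1 y - f1 x - f2 x (y - x)) \<le> e / (2*C) * norm (y - x)"
    using twice_diffD(2)[OF td \<open>x \<in> S\<close>] e Cp unfolding has_derivative_at_alt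
    by (metis divide_pos_pos mult_pos_pos zero_less_numeral)
  define m where "m = min r d / (norm h + norm k + 1)"
  have nz: "norm h + norm k + 1 > 0" by (simp add: add_nonneg_pos)
  have m: "m > 0" unfolding m_def using r d nz by simp
  have "dist ((f (x + s *\<^sub>R h + s *\<^sub>R k) - f (x + s *\<^sub>R h) - f (x + s *\<^sub>R k) + f x) / s\<^sup>2) (f2 x h \<bullet> k) < e"
    if s: "0 < s" "s < m" for s
  proof -
    have sm: "s * (norm h + norm k + 1) < min r d"
      using s(2) nz unfolding m_def by (simp add: field_simps)
    have small: "norm (\<alpha> *\<^sub>R h + \<beta> *\<^sub>R k) \<le> s * (norm h + norm k + 1)"
      if "0 \<le> \<alpha>" "\<alpha> \<le> s" "0 \<le> \<beta>" "\<beta> \<le> s" for \<alpha> \<beta>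
    proof -
      have "norm (\<alpha> *\<^sub>R h + \<beta> *\<^sub>R k) \<le> \<alpha> * norm h + \<beta> * norm k"
        using norm_triangle_ineq[of "\<alpha> *\<^sub>R h" "\<beta> *\<^sub>R k"] that by simp
      also have "\<dots> \<le> s * norm h + s * norm k"
        using that by (intro add_mono mult_right_mono) auto
      finally show ?thesis using s by (simp add: algebra_simps)
    qed
    define g where "g \<theta> = f (x + s *\<^sub>R h + \<theta> *\<^sub>R k) - f (x + \<theta> *\<^sub>R k)" for \<theta>
    define g' where "g' \<theta> = (f1 (x + s *\<^sub>R h + \<theta> *\<^sub>R k) - f1 (x + \<theta> *\<^sub>R k)) \<bullet> k" for \<theta>
    have inS: "x + \<alpha> *\<^sub>R h + \<beta> *\<^sub>R k \<in> S" if "0 \<le> \<alpha>" "\<alpha> \<le> s" "0 \<le> \<beta>" "\<beta> \<le> s" for \<alpha> \<beta>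
    proof -
      have "dist x (x + \<alpha> *\<^sub>R h + \<beta> *\<^sub>R k) < r"
        using small[OF that] sm by (simp add: dist_norm norm_minus_commute algebra_simps)
      then show ?thesis using r by auto
    qed
    have der: "(g has_real_derivative g' \<theta>) (at \<theta>)" if "0 \<le> \<theta>" "\<theta> \<le> s" for \<theta>
    proof -
      have 1: "x + s *\<^sub>R h + \<theta> *\<^sub>R k \<in> S" "x + \<theta> *\<^sub>R k \<in> S"
        using inS[of s \<theta>] inS[of 0 \<theta>] that s by auto
      have A: "((\<lambda>\<theta>. f (x + s *\<^sub>R h + \<theta> *\<^sub>R k)) has_derivative (\<lambda>t. f1 (x + s *\<^sub>R h + \<theta> *\<^sub>R k) \<bullet> (t *\<^sub>R k))) (at \<theta>)"
        by (rule has_derivative_compose[where g=f and f="\<lambda>\<theta>. x + s *\<^sub>R h + \<theta> *\<^sub>R k", OF _ twice_diffD(1)[OF td 1(1)]])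
           (auto intro!: derivative_eq_intros)
      have B: "((\<lambda>\<theta>. f (x + \<theta> *\<^sub>R k)) has_derivative (\<lambda>t. f1 (x + \<theta> *\<^sub>R k) \<bullet> (t *\<^sub>R k))) (at \<theta>)"
        by (rule has_derivative_compose[where g=f and f="\<lambda>\<theta>. x + \<theta> *\<^sub>R k", OF _ twice_diffD(1)[OF td 1(2)]])
           (auto intro!: derivative_eq_intros)
      show ?thesis unfolding has_field_derivative_def g_def
        by (rule has_derivative_eq_rhs[OF has_derivative_diff[OF A B]])
           (auto simp: g'_def algebra_simps inner_diff_left)
    qed
    obtain \<theta> where th: "0 < \<theta>" "\<theta> < s" "g s - g 0 = (s - 0) * g' \<theta>"
      using MVT2[of 0 s g g'] s der by auto
    define y1 where "y1 = x + s *\<^sub>R h + \<theta> *\<^sub>R k"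
    define y2 where "y2 = x + \<theta> *\<^sub>R k"
    have n1: "norm (y1 - x) \<le> s * (norm h + norm k + 1)"
      using small[of s \<theta>] th s by (simp add: y1_def)
    have n2: "norm (y2 - x) \<le> s * (norm h + norm k + 1)"
      using small[of 0 \<theta>] th s by (simp add: y2_def)
    have e1: "norm (f1 y1 - f1 x - f2 x (y1 - x)) \<le> e/(2*C) * (s * (norm h + norm k + 1))"
      using dd[of y1] n1 sm e Cp by (smt (verit) divide_pos_pos min_less_iff_conj mult_left_mono mult_pos_pos)
    have e2: "norm (f1 y2 - f1 x - f2 x (y2 - x)) \<le> e/(2*C) * (s * (norm h + norm k + 1))"
      using dd[of y2] n2 sm e Cp by (smt (verit) divide_pos_pos min_less_iff_conj mult_left_mono mult_pos_pos)
    have f2eq: "f2 x (y1 - x) - f2 x (y2 - x) = s *\<^sub>R f2 x h"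
      by (simp add: y1_def y2_def flip: linear_diff[OF lin] linear_scale[OF lin])
    have eqv: "f1 y1 - f1 y2 - s *\<^sub>R f2 x h
       = (f1 y1 - f1 x - f2 x (y1 - x)) - (f1 y2 - f1 x - f2 x (y2 - x))"
      using f2eq by (simp add: algebra_simps)
    have nn: "norm (f1 y1 - f1 y2 - s *\<^sub>R f2 x h) \<le> 2 * (e/(2*C) * (s * (norm h + norm k + 1)))"
      unfolding eqv
      using norm_triangle_ineq4[of "f1 y1 - f1 x - f2 x (y1 - x)" "f1 y2 - f1 x - f2 x (y2 - x)"] e1 e2
      by linarith
    have "\<bar>g' \<theta> - s * (f2 x h \<bullet> k)\<bar> = \<bar>(f1 y1 - f1 y2 - s *\<^sub>R f2 x h) \<bullet> k\<bar>"
      by (simp add: g'_def y1_def y2_def inner_diff_left)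
    also have "\<dots> \<le> norm (f1 y1 - f1 y2 - s *\<^sub>R f2 x h) * norm k"
      by (rule Cauchy_Schwarz_ineq2)
    also have "\<dots> \<le> 2 * (e/(2*C) * (s * (norm h + norm k + 1))) * norm k"
      by (rule mult_right_mono[OF nn norm_ge_zero])
    also have "\<dots> \<le> 2 * (e/(2*C) * (s * (norm h + norm k + 1))) * (norm k + 1)"
      using e Cp s nz by (intro mult_left_mono) auto
    also have "\<dots> = s * e / 2 "
      using Cp unfolding C_def by (simp add: field_simps)
    finally have "\<bar>g' \<theta> - s * (f2 x h \<bullet> k)\<bar> < s * e" using e s by (smt (verit) field_sum_of_halves mult_pos_pos)
    moreover have "(f (x + s *\<^sub>R h + s *\<^sub>R k) - f (x + s *\<^sub>R h) - f (x + s *\<^sub>R k) + f x) / s\<^sup>2 - f2 x h \<bullet> k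
       = (g' \<theta> - s * (f2 x h \<bullet> k)) / s"
      using th(3) s by (simp add: g_def field_simps power2_eq_square)
    ultimately show ?thesis using s by (simp add: dist_real_def abs_divide pos_divide_less_eq mult.commute)
  qed
  then show "\<forall>\<^sub>F s in at_right 0. dist ((f (x + s *\<^sub>R h + s *\<^sub>R k) - f (x + s *\<^sub>R h) - f (x + s *\<^sub>R k) + f x) / s\<^sup>2) (f2 x h \<bullet> k) < e"
    unfolding eventually_at_right_field using m by auto
qed

text \<open>The second difference is symmetric in its two increments, so its limit is as well.\<close>

lemma twice_diff_symmetric:
  assumes "twice_diff f f1 f2 S" "open S" "x \<in> S"
  shows "f2 x h \<bullet> k = f2 x k \<bullet> h"
proof -
  have eq: "f (x + s *\<^sub>R h + s *\<^sub>R k) - f (x + s *\<^sub>R h) - f (x + s *\<^sub>R k) + f x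
    = f (x + s *\<^sub>R k + s *\<^sub>R h) - f (x + s *\<^sub>R k) - f (x + s *\<^sub>R h) + f x" for s
    by (simp add: algebra_simps)
  show ?thesis
    using second_difference_limit[OF assms, of h k] second_difference_limit[OF assms, of k h]
    unfolding eq by (rule tendsto_unique[OF trivial_limit_at_right_real])
qed

lemma deriv2_nonpos_at_local_max:
  fixes f f' :: "real \<Rightarrow> real"
  assumes d: "0 < d" and f: "\<And>s. \<bar>s\<bar> < d \<Longrightarrow> (f has_real_derivative f' s) (at s)"
    and f': "(f' has_real_derivative c) (at 0)" and mx: "\<And>s. \<bar>s\<bar> < d \<Longrightarrow> f s \<le> f 0"
  shows "f' 0 = 0" "c \<le> 0"
proof -
  show z: "f' 0 = 0"
    by (rule DERIV_local_max[OF f[of 0] d]) (use d mx in auto)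
  show "c \<le> 0"
  proof (rule ccontr)
    assume "\<not> c \<le> 0"
    then obtain e where e: "e > 0" "\<And>h. 0 < h \<Longrightarrow> h < e \<Longrightarrow> f' 0 < f' (0 + h)"
      using DERIV_pos_inc_right[OF f'] by auto
    define s where "s = min d e / 2"
    have s: "0 < s" "s < d" "s < e" using d e by (auto simp: s_def)
    obtain t where t: "0 < t" "t < s" "f s - f 0 = (s - 0) * f' t"
      using MVT2[of 0 s f f'] s f by force
    have "0 < f' t" using e(2)[of t] s t z by simp
    then have "0 < s * f' t" using s by simp
    then show False using t(3) mx[of s] s by simp
  qed
qed

lemma twice_diff_max:
  assumes td: "twice_diff f f1 f2 S" and "open S" "x \<in> S" and mx: "\<And>y. y \<in> S \<Longrightarrow> f y \<le> f x"
  shows "f1 x = 0" "f2 x h \<bullet> h \<le> 0"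
proof -
  have *: "f1 x \<bullet> h = 0 \<and> f2 x h \<bullet> h \<le> 0" for h
  proof -
    obtain r where r: "r > 0" "ball x r \<subseteq> S"
      using \<open>open S\<close> \<open>x \<in> S\<close> open_contains_ball by blast
    define d where "d = r / (norm h + 1)"
    have d: "d > 0" using r by (simp add: d_def add_nonneg_pos)
    have inS: "x + s *\<^sub>R h \<in> S" if "\<bar>s\<bar> < d" for s
    proof -
      have "\<bar>s\<bar> * norm h \<le> \<bar>s\<bar> * (norm h + 1)" by (simp add: mult_left_mono)
      also have "\<dots> < r" using that by (simp add: d_def add_nonneg_pos pos_less_divide_eq)
      finally show ?thesis using r(2) by (auto simp: dist_norm)
    qed
    have A: "((\<lambda>s. f (x + s *\<^sub>R h)) has_real_derivative f1 (x + s *\<^sub>R h) \<bullet> h) (at s)" if "\<bar>s\<bar> < d" for s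
      unfolding has_field_derivative_def
      by (rule has_derivative_eq_rhs[OF has_derivative_compose[where g=f and f="\<lambda>s. x + s *\<^sub>R h" and f'="\<lambda>t. t *\<^sub>R h", OF _ twice_diffD(1)[OF td inS[OF that]]]])
         (auto intro!: derivative_eq_intros)
    have B: "((\<lambda>s. f1 (x + s *\<^sub>R h) \<bullet> h) has_real_derivative f2 x h \<bullet> h) (at 0)"
    proof -
      have lin: "linear (f2 x)" using twice_diffD(2)[OF td \<open>x \<in> S\<close>] has_derivative_linear by blast
      have "((\<lambda>s. f1 (x + s *\<^sub>R h)) has_derivative (\<lambda>t. f2 x (t *\<^sub>R h))) (at 0)"
        by (rule has_derivative_compose[where g=f1 and f="\<lambda>s. x + s *\<^sub>R h" and f'="\<lambda>t. t *\<^sub>R h"])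
           (use twice_diffD(2)[OF td \<open>x \<in> S\<close>] in \<open>auto intro!: derivative_eq_intros\<close>)
      from has_derivative_inner_left[OF this, of h] show ?thesis
        unfolding has_field_derivative_def
        by (rule has_derivative_eq_rhs) (auto simp: linear_scale[OF lin])
    qed
    show ?thesis
      using deriv2_nonpos_at_local_max[OF d A B] mx inS by auto
  qed
  then show "f2 x h \<bullet> h \<le> 0" by blast
  show "f1 x = 0" using * by (metis inner_eq_zero_iff)
qed

section \<open>Positive semidefinite matrices\<close>

definition psd :: "real^'n^'n \<Rightarrow> bool" where
  "psd a \<longleftrightarrow> transpose a = a \<and> (\<forall>v. 0 \<le> v \<bullet> (a *v v))"

lemma inner_matrix_rows: "a \<bullet> M = (\<Sum>i\<in>UNIV. a $ i \<bullet> M $ i)" for a M :: "real^'n^'n"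
  by (simp add: inner_vec_def)

lemma matrix_inner_sum: "a \<bullet> M = (\<Sum>i\<in>UNIV. \<Sum>j\<in>UNIV. a $ i $ j * M $ i $ j)" for a M :: "real^'n^'n"
  by (simp add: inner_vec_def)

lemma matrix_vector_row: "(a *v x) $ i = a $ i \<bullet> x" for a :: "real^'n^'n"
  by (simp add: matrix_vector_mult_def inner_vec_def)

lemma symmetric_matrix_inner:
  fixes a :: "real^'n^'n"
  assumes "transpose a = a"
  shows "x \<bullet> (a *v y) = y \<bullet> (a *v x)"
  by (metis assms dot_lmul_matrix inner_commute transpose_matrix_vector)

lemma symmetric_matrix_nth:
  assumes "transpose a = a" shows "a $ i $ j = a $ j $ i"
  by (metis assms transpose_def vec_lambda_beta)

lemma inner_transpose: "transpose a \<bullet> transpose M = a \<bullet> M" for a M :: "real^'n^'n"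
  by (simp add: inner_vec_def transpose_def) (rule sum.swap)

lemma outer_inner: "(\<chi> i j. c $ i * d $ j) \<bullet> M = c \<bullet> (M *v d)" for M :: "real^'n^'n"
  by (simp add: inner_vec_def matrix_vector_mult_def sum_distrib_left mult_ac)

text \<open>A vector where a nonnegative form vanishes minimises the form, so the derivative of the form
  vanishes there as well: moving from \<open>v\<close> a small step against \<open>w = a v\<close> would make the form negative.\<close>

lemma psd_zero_form:
  assumes "psd a" "v \<bullet> (a *v v) = 0"
  shows "a *v v = 0"
proof (rule ccontr)
  assume nz: "a *v v \<noteq> 0"
  define w where "w = a *v v"
  have sym: "transpose a = a" and pos: "0 \<le> x \<bullet> (a *v x)" for x
    using assms(1) by (auto simp: psd_def)
  have wp: "w \<bullet> w > 0" using nz by (simp add: w_def)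
  \<comment> \<open>The added 1 keeps the step finite when the form also vanishes at \<open>w\<close>.\<close>
  define s where "s = (w \<bullet> w) / (w \<bullet> (a *v w) + 1)"
  have q: "w \<bullet> (a *v w) \<ge> 0" by (rule pos)
  have sp: "s > 0" unfolding s_def using wp q by simp
  have vw: "v \<bullet> (a *v w) = w \<bullet> w"
    using symmetric_matrix_inner[OF sym, of v w] by (simp add: w_def)
  have "0 \<le> (v - s *\<^sub>R w) \<bullet> (a *v (v - s *\<^sub>R w))" by (rule pos)
  also have "\<dots> = v \<bullet> (a *v v) - s * (w \<bullet> (a *v v)) - s * (v \<bullet> (a *v w)) + s^2 * (w \<bullet> (a *v w))"
    by (simp add: matrix_vector_mult_diff_distrib matrix_vector_mult_scaleR inner_diff_left inner_diff_right
        algebra_simps power2_eq_square)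
  also have "\<dots> = s * (s * (w \<bullet> (a *v w)) - 2 * (w \<bullet> w))"
    using assms(2) vw by (simp add: w_def algebra_simps power2_eq_square)
  finally have "s * (w \<bullet> (a *v w)) \<ge> 2 * (w \<bullet> w)"
    using sp by (simp add: zero_le_mult_iff)
  moreover have "s * (w \<bullet> (a *v w)) \<le> w \<bullet> w"
    unfolding s_def using wp q by (simp add: divide_simps mult_left_mono)
  ultimately show False using wp by simp
qed

lemma psd_diag_zero_row:
  assumes "psd a" "a $ i $ i = 0"
  shows "a $ i $ j = 0"
proof -
  have "axis i 1 \<bullet> (a *v axis i 1) = 0"
    using assms(2) by (simp add: inner_axis' matrix_vector_row inner_axis)
  from psd_zero_form[OF assms(1) this] have "(a *v axis i 1) $ j = 0" by simp
  then have "a $ j $ i = 0" by (simp add: matrix_vector_row inner_axis)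
  then show ?thesis using assms(1) symmetric_matrix_nth psd_def by metis
qed

text \<open>Peeling off one index at a time, as in the Cholesky decomposition: if \<open>a\<^sub>i\<^sub>i > 0\<close>, then subtracting
  the rank one matrix \<open>c c\<^sup>T / a\<^sub>i\<^sub>i\<close>, where \<open>c\<close> is the \<open>i\<close>-th row, leaves a positive semidefinite matrix whose
  \<open>i\<close>-th row vanishes, and the removed part pairs with \<open>M\<close> to \<open>c \<bullet> M c / a\<^sub>i\<^sub>i \<le> 0\<close>.  The induction is
  over the set of rows that are still nonzero.\<close>

lemma psd_nsd_inner_aux:
  fixes a M :: "real^'n^'n"
  assumes "finite S" and nsd: "\<And>v. v \<bullet> (M *v v) \<le> 0"
  shows "psd a \<Longrightarrow> (\<And>i j. i \<notin> S \<Longrightarrow> a $ i $ j = 0) \<Longrightarrow> a \<bullet> M \<le> 0"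
  using \<open>finite S\<close>
proof (induction S arbitrary: a)
  case empty
  then show ?case by (simp add: inner_vec_def)
next
  case (insert i S)
  have sym: "transpose a = a" and pos: "0 \<le> x \<bullet> (a *v x)" for x
    using insert.prems(1) by (auto simp: psd_def)
  show ?case
  proof (cases "a $ i $ i = 0")
    case True
    show ?thesis
      by (rule insert.IH[OF insert.prems(1)])
         (metis True insertE insert.prems psd_diag_zero_row)
  next
    case False
    define c where "c = a $ i"
    define d where "d = a $ i $ i"
    have ei: "axis i 1 \<bullet> (a *v x) = c \<bullet> x" for x
      by (simp add: inner_axis' matrix_vector_row c_def)
    have cd: "c \<bullet> axis i 1 = d" by (simp add: c_def d_def inner_axis)
    have dp: "d > 0"
      using pos[of "axis i 1"] False by (simp add: ei cd) (simp add: d_def)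
    define P :: "real^'n^'n" where "P = (\<chi> k l. c $ k * c $ l)"
    define b where "b = a - (1 / d) *\<^sub>R P"
    have Pv: "P *v v = (c \<bullet> v) *\<^sub>R c" for v
      by (simp add: vec_eq_iff P_def matrix_vector_mult_def inner_vec_def sum_distrib_left sum_distrib_right mult_ac)
    have "psd b"
      unfolding psd_def
    proof (intro conjI allI)
      show "transpose b = b"
        by (simp add: vec_eq_iff transpose_def b_def P_def mult.commute symmetric_matrix_nth[OF sym])
      fix v
      \<comment> \<open>The form of \<open>b\<close> at \<open>v\<close> is the minimum of the form of \<open>a\<close> on the line \<open>v + t e\<^sub>i\<close>, attained at \<open>w\<close>.\<close>
      define w where "w = v - ((c \<bullet> v) / d) *\<^sub>R axis i 1"
      have "0 \<le> w \<bullet> (a *v w)" by (rule pos)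
      also have "\<dots> = v \<bullet> (a *v v) - 2 * ((c \<bullet> v) / d) * (c \<bullet> v) + ((c \<bullet> v) / d)^2 * d"
        unfolding w_def
        by (simp add: matrix_vector_mult_diff_distrib matrix_vector_mult_scaleR inner_diff_left inner_diff_right
            algebra_simps power2_eq_square ei cd symmetric_matrix_inner[OF sym, of v "axis i 1"])
      also have "\<dots> = v \<bullet> (b *v v)"
        using dp by (simp add: b_def matrix_vector_mult_diff_rdistrib scaleR_matrix_vector_assoc[symmetric] Pv inner_diff_right
            power2_eq_square field_simps inner_commute)
      finally show "0 \<le> v \<bullet> (b *v v)" .
    qed
    moreover have "b $ k $ l = 0" if "k \<notin> S" for k l
    proof (cases "k = i")
      case True
      then show ?thesis using dp by (simp add: b_def P_def c_def d_def)
    next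
      case F: False
      then have "a $ k $ l = 0" "a $ k $ i = 0" using insert.prems(2) that by auto
      then show ?thesis using symmetric_matrix_nth[OF sym, of i k] by (simp add: b_def P_def c_def)
    qed
    ultimately have "b \<bullet> M \<le> 0" by (rule insert.IH)
    moreover have "P \<bullet> M \<le> 0" unfolding P_def outer_inner by (rule nsd)
    moreover have "a = b + (1 / d) *\<^sub>R P" by (simp add: b_def)
    ultimately show ?thesis using dp by (simp add: inner_add_left divide_nonpos_pos add_nonpos_nonpos)
  qed
qed

lemma psd_nsd_inner:
  fixes a M :: "real^'n^'n"
  assumes "psd a" and "\<And>v. v \<bullet> (M *v v) \<le> 0"
  shows "a \<bullet> M \<le> 0"
  using psd_nsd_inner_aux[of UNIV M a] assms by simp

lemma psd_inner_mono:
  fixes a M L :: "real^'n^'n"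
  assumes "psd a" and "\<And>v. v \<bullet> (M *v v) \<le> v \<bullet> (L *v v)"
  shows "a \<bullet> M \<le> a \<bullet> L"
  using psd_nsd_inner[OF assms(1), of "M - L"] assms(2)
  by (simp add: matrix_vector_mult_diff_rdistrib inner_diff_right)

lemma symmetric_square_inner:
  fixes a Y :: "real^'n^'n"
  assumes "transpose Y = Y"
  shows "a \<bullet> (Y ** Y) = (\<Sum>j\<in>UNIV. Y $ j \<bullet> (a *v (Y $ j)))"
proof -
  have "Y ** Y = (\<Sum>j\<in>UNIV. (\<chi> k l. Y $ j $ k * Y $ j $ l))"
    using symmetric_matrix_nth[OF assms] by (simp add: vec_eq_iff matrix_matrix_mult_def)
  then have "a \<bullet> (Y ** Y) = (\<Sum>j\<in>UNIV. (\<chi> k l. Y $ j $ k * Y $ j $ l) \<bullet> a)"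
    by (simp add: inner_sum_right inner_commute)
  then show ?thesis by (simp add: outer_inner)
qed

text \<open>The application has \<open>D\<close> as a derivative of a family of positive semidefinite matrices passing through \<open>a\<close>,
  so that the form of \<open>D\<close> vanishes on the kernel \<open>V\<close> of \<open>a\<close>.  Since \<open>a \<bullet> Y\<^sup>2\<close> is the sum of the values
  of the form of \<open>a\<close> at the rows of \<open>Y\<close>, its vanishing confines the range of \<open>Y\<close> to \<open>V\<close>.  Expanding in an
  orthonormal basis of \<open>V\<close>, only the entries of \<open>D\<close> on \<open>V \<times> V\<close> meet \<open>Y\<close>, and they are zero by polarisation.\<close>

lemma psd_kernel_inner:
  fixes a Y D :: "real^'n^'n"
  assumes a: "psd a" and Y: "transpose Y = Y" and D: "transpose D = D"
    and null: "\<And>v. v \<bullet> (a *v v) = 0 \<Longrightarrow> v \<bullet> (D *v v) = 0"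
    and zero: "a \<bullet> (Y ** Y) \<le> 0"
  shows "D \<bullet> Y = 0"
proof -
  define V where "V = {v. a *v v = 0}"
  have sub: "subspace V"
    unfolding V_def subspace_def by (simp add: matrix_vector_right_distrib matrix_vector_mult_scaleR)
  have pos: "0 \<le> v \<bullet> (a *v v)" for v using a by (simp add: psd_def)
  have "(\<Sum>j\<in>UNIV. Y $ j \<bullet> (a *v (Y $ j))) = 0"
    using zero symmetric_square_inner[OF Y, of a] sum_nonneg[of UNIV "\<lambda>j. Y $ j \<bullet> (a *v (Y $ j))"] pos
    by simp
  then have "Y $ j \<bullet> (a *v (Y $ j)) = 0" for j
    by (subst (asm) sum_nonneg_eq_0_iff) (use pos in auto)
  then have YV: "Y $ j \<in> V" for j unfolding V_def using psd_zero_form[OF a] by simp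
  have Yv: "Y *v x \<in> V" for x
  proof -
    have "Y *v x = (\<Sum>j\<in>UNIV. (x $ j) *\<^sub>R (Y $ j))"
      using symmetric_matrix_nth[OF Y] by (simp add: vec_eq_iff matrix_vector_mult_def mult.commute)
    then show ?thesis using sub YV by (simp add: subspace_sum subspace_scale)
  qed
  have pol: "p \<bullet> (D *v q) = 0" if "p \<in> V" "q \<in> V" for p q
  proof -
    have z: "v \<bullet> (D *v v) = 0" if "v \<in> V" for v using that null by (simp add: V_def)
    have "(p + q) \<bullet> (D *v (p + q)) = 0" using z sub that by (simp add: subspace_add)
    then show ?thesis
      using z[OF that(1)] z[OF that(2)] symmetric_matrix_inner[OF D, of p q]
      by (simp add: matrix_vector_right_distrib inner_add_left inner_add_right)
  qed
  obtain B where B: "B \<subseteq> V" "pairwise orthogonal B" "\<And>x. x \<in> B \<Longrightarrow> norm x = 1" "independent B" "span B = V"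
    using orthonormal_basis_subspace[OF sub] by metis
  have fin: "finite B" using B(4) independent_imp_finite by blast
  have ex: "(\<Sum>b\<in>B. (x \<bullet> b) *\<^sub>R b) = x" if "x \<in> V" for x
    by (rule orthonormal_basis_expand[OF B(2)]) (use B fin that in auto)
  have "D \<bullet> Y = (\<Sum>j\<in>UNIV. D $ j \<bullet> (\<Sum>b\<in>B. (Y $ j \<bullet> b) *\<^sub>R b))"
    by (simp add: inner_matrix_rows ex[OF YV])
  also have "\<dots> = (\<Sum>b\<in>B. \<Sum>j\<in>UNIV. (Y $ j \<bullet> b) * (D $ j \<bullet> b))"
    by (subst sum.swap) (simp add: inner_sum_right)
  also have "\<dots> = (\<Sum>b\<in>B. (Y *v b) \<bullet> (D *v b))"
    by (simp add: inner_vec_def[of "Y *v _"] matrix_vector_row)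
  also have "\<dots> = 0" using pol Yv B(1) by (intro sum.neutral) auto
  finally show ?thesis .
qed

lemma matrix_inner_orthonormal:
  fixes a M :: "real^'n^'n"
  assumes "\<And>x. (\<Sum>e\<in>E. (x \<bullet> e) *\<^sub>R e) = x"
  shows "a \<bullet> M = (\<Sum>e\<in>E. (a *v e) \<bullet> (M *v e))"
proof -
  have "a \<bullet> M = (\<Sum>j\<in>UNIV. a $ j \<bullet> (\<Sum>e\<in>E. (M $ j \<bullet> e) *\<^sub>R e))"
    by (simp add: inner_matrix_rows assms)
  also have "\<dots> = (\<Sum>e\<in>E. \<Sum>j\<in>UNIV. (M $ j \<bullet> e) * (a $ j \<bullet> e))"
    by (subst sum.swap) (simp add: inner_sum_right)
  also have "\<dots> = (\<Sum>e\<in>E. (a *v e) \<bullet> (M *v e))"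
    by (simp add: inner_vec_def[of "a *v _"] matrix_vector_row mult.commute)
  finally show ?thesis .
qed

lemma tendsto_matrix_mult:
  fixes Y Z :: "'b \<Rightarrow> real^'n^'n"
  assumes "(Y \<longlongrightarrow> A) F" "(Z \<longlongrightarrow> B) F"
  shows "((\<lambda>k. Y k ** Z k) \<longlongrightarrow> A ** B) F"
  unfolding matrix_matrix_mult_def
  by (intro tendsto_vec_lambda tendsto_sum tendsto_mult tendsto_vec_nth assms)

section \<open>Degenerate elliptic coefficients\<close>

text \<open>Degenerate ellipticity with \<open>C\<^sup>1\<close> coefficients: \<open>a' i j q\<close> is the gradient of the entry \<open>i, j\<close>
  at \<open>q\<close>, and the trace condition excludes only total degeneracy.\<close>

definition elliptic_coeff :: "(real^'n \<Rightarrow> real^'n^'n) \<Rightarrow> bool" where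
  "elliptic_coeff a \<longleftrightarrow>
     (\<forall>q. psd (a q) \<and> 0 < a q \<bullet> mat 1) \<and>
     (\<exists>a'. \<forall>i j. continuous_on UNIV (a' i j) \<and>
        (\<forall>q. ((\<lambda>q. a q $ i $ j) has_derivative (\<lambda>h. a' i j q \<bullet> h)) (at q)))"

lemma elliptic_coeff_reflect:
  assumes "elliptic_coeff a"
  shows "elliptic_coeff (\<lambda>q. a (- q))"
proof -
  obtain a' where c: "\<And>i j. continuous_on UNIV (a' i j)"
    and d: "\<And>i j q. ((\<lambda>q. a q $ i $ j) has_derivative (\<lambda>h. a' i j q \<bullet> h)) (at q)"
    using assms unfolding elliptic_coeff_def by blast
  have "continuous_on UNIV (\<lambda>q. - a' i j (- q)) \<and>
        (\<forall>q. ((\<lambda>q. a (- q) $ i $ j) has_derivative (\<lambda>h. - a' i j (- q) \<bullet> h)) (at q))" for i j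
  proof (intro conjI allI)
    show "continuous_on UNIV (\<lambda>q. - a' i j (- q))"
      by (intro continuous_intros continuous_on_compose2[OF c[of i j]]) auto
    fix q
    have "((\<lambda>q. a (- q) $ i $ j) has_derivative (\<lambda>h. a' i j (- q) \<bullet> (- h))) (at q)"
      by (rule has_derivative_compose[where f=uminus and g="\<lambda>q. a q $ i $ j", OF _ d])
         (auto intro!: derivative_eq_intros)
    then show "((\<lambda>q. a (- q) $ i $ j) has_derivative (\<lambda>h. - a' i j (- q) \<bullet> h)) (at q)" by simp
  qed
  then show ?thesis using assms unfolding elliptic_coeff_def by (intro conjI exI[of _ "\<lambda>i j q. - a' i j (- q)"]) (auto simp del: inner_minus_left)
qed

text \<open>With \<open>\<epsilon> = 1 / k\<^sup>2\<close> and \<open>\<tau> = 1 / k\<^sup>3 = \<epsilon> / k\<close>, the perturbed expression differs from \<open>a q \<bullet> Y\<close> by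
  \<open>- \<epsilon> a \<bullet> Y\<^sup>2 - \<tau> (Da[x] \<bullet> Y + tr a)\<close> up to higher order.  The first term dominates and is strictly negative
  unless \<open>a \<bullet> Y\<^sup>2 = 0\<close>.  In that case \<open>Da[x] \<bullet> Y = 0\<close>: every \<open>v\<close> in the kernel of \<open>a q\<close> minimises
  \<open>s \<mapsto> v \<bullet> a (q + s x) v\<close> at \<open>s = 0\<close>, so the derivative of the form vanishes on the kernel, which contains the
  range of \<open>Y\<close>.  What is left is \<open>- \<tau> tr a < 0\<close>.  Compactness turns this into a uniform statement:
  a sequence of counterexamples would have a limit contradicting it.\<close>

lemma perturbed_trace_eventually:
  fixes a :: "real^'n \<Rightarrow> real^'n^'n"
  assumes a: "elliptic_coeff a" and K: "compact K"
    and sym: "\<And>q Y. (q, Y) \<in> K \<Longrightarrow> transpose Y = Y"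
  shows "\<forall>\<^sub>F k in sequentially. \<forall>q Y x. (q, Y) \<in> K \<longrightarrow> norm x \<le> R \<longrightarrow>
     a (q - (1 / real k ^ 3) *\<^sub>R x) \<bullet>
       (Y - (1 / real k ^ 2) *\<^sub>R (Y ** Y) + (1 / real k ^ 4) *\<^sub>R (Y ** Y ** Y) - (1 / real k ^ 3) *\<^sub>R mat 1)
     < a q \<bullet> Y - 1 / real k ^ 4"
proof (rule ccontr)
  obtain a' where c': "\<And>i j. continuous_on UNIV (a' i j)"
    and d': "\<And>i j q. ((\<lambda>q. a q $ i $ j) has_derivative (\<lambda>h. a' i j q \<bullet> h)) (at q)"
    using a unfolding elliptic_coeff_def by blast
  have psd: "psd (a q)" and tr: "0 < a q \<bullet> mat 1" for q using a unfolding elliptic_coeff_def by auto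
  have symq: "a q $ i $ j = a q $ j $ i" for q i j using psd[of q] symmetric_matrix_nth unfolding psd_def by blast
  define DA where "DA q x = (\<chi> i j. a' i j q \<bullet> x)" for q x
  have dform: "((\<lambda>q. a q \<bullet> Y) has_derivative (\<lambda>h. DA q h \<bullet> Y)) (at q)" for q Y
    unfolding matrix_inner_sum DA_def by (auto intro!: derivative_eq_intros d')
  have symDA: "transpose (DA q x) = DA q x" for q x
  proof -
    have "a' i j q \<bullet> x = a' j i q \<bullet> x" for i j
    proof -
      have "((\<lambda>q. a q $ i $ j) has_derivative (\<lambda>h. a' j i q \<bullet> h)) (at q)"
        using d'[of j i q] by (simp add: symq[of _ j i])
      from has_derivative_unique[OF d'[of i j q] this] show ?thesis by metis
    qed
    then show ?thesis by (simp add: vec_eq_iff transpose_def DA_def)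
  qed
  have line: "((\<lambda>s. a (q + s *\<^sub>R x) \<bullet> Y) has_real_derivative DA (q + s *\<^sub>R x) x \<bullet> Y) (at s)" for q x Y s
  proof -
    have "((\<lambda>s. a (q + s *\<^sub>R x) \<bullet> Y) has_derivative (\<lambda>t. DA (q + s *\<^sub>R x) (t *\<^sub>R x) \<bullet> Y)) (at s)"
      by (rule has_derivative_compose[where f="\<lambda>s. q + s *\<^sub>R x" and g="\<lambda>q. a q \<bullet> Y", OF _ dform])
         (auto intro!: derivative_eq_intros)
    moreover have "DA p (t *\<^sub>R x) = t *\<^sub>R DA p x" for p t by (simp add: DA_def vec_eq_iff)
    ultimately show ?thesis unfolding has_field_derivative_def by (simp add: mult_commute_abs)
  qed
  have conta: "continuous_on UNIV a"
  proof -
    have "continuous_on UNIV (\<lambda>q. \<chi> i j. a q $ i $ j)"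
      by (intro continuous_on_vec_lambda continuous_at_imp_continuous_on ballI has_derivative_continuous[OF d'])
    then show ?thesis by simp
  qed
  have nullDA: "v \<bullet> (DA q x *v v) = 0" if "v \<bullet> (a q *v v) = 0" for q x v
  proof -
    define P :: "real^'n^'n" where "P = (\<chi> i j. v $ i * v $ j)"
    have P: "M \<bullet> P = v \<bullet> (M *v v)" for M :: "real^'n^'n" by (simp add: P_def inner_commute[of M] outer_inner)
    have "DA (q + 0 *\<^sub>R x) x \<bullet> P = 0"
    proof (rule DERIV_local_min[OF line[of q x P 0], of 1])
      show "\<forall>y. \<bar>0 - y\<bar> < 1 \<longrightarrow> a (q + 0 *\<^sub>R x) \<bullet> P \<le> a (q + y *\<^sub>R x) \<bullet> P"
        using that psd by (simp add: P psd_def)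
    qed simp
    then show ?thesis by (simp add: P)
  qed
  assume "\<not> ?thesis"
  then obtain r :: "nat \<Rightarrow> nat" where r: "strict_mono r"
    and "\<And>n. \<not> (\<forall>q Y x. (q, Y) \<in> K \<longrightarrow> norm x \<le> R \<longrightarrow>
     a (q - (1 / real (r n) ^ 3) *\<^sub>R x) \<bullet>
       (Y - (1 / real (r n) ^ 2) *\<^sub>R (Y ** Y) + (1 / real (r n) ^ 4) *\<^sub>R (Y ** Y ** Y) - (1 / real (r n) ^ 3) *\<^sub>R mat 1)
     < a q \<bullet> Y - 1 / real (r n) ^ 4)"
    using not_eventually_sequentiallyD by fast
  then have "\<forall>n. \<exists>q Y x. (q, Y) \<in> K \<and> norm x \<le> R \<and>
     a q \<bullet> Y - 1 / real (r n) ^ 4 \<le> a (q - (1 / real (r n) ^ 3) *\<^sub>R x) \<bullet>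
       (Y - (1 / real (r n) ^ 2) *\<^sub>R (Y ** Y) + (1 / real (r n) ^ 4) *\<^sub>R (Y ** Y ** Y) - (1 / real (r n) ^ 3) *\<^sub>R mat 1)"
    by (meson not_less)
  then obtain qf Yf xf where KK: "\<And>n. (qf n, Yf n) \<in> K" and xR: "\<And>n. norm (xf n) \<le> R"
    and bad: "\<And>n. a (qf n) \<bullet> Yf n - 1 / real (r n) ^ 4 \<le> a (qf n - (1 / real (r n) ^ 3) *\<^sub>R xf n) \<bullet>
       (Yf n - (1 / real (r n) ^ 2) *\<^sub>R (Yf n ** Yf n) + (1 / real (r n) ^ 4) *\<^sub>R (Yf n ** Yf n ** Yf n)
         - (1 / real (r n) ^ 3) *\<^sub>R mat 1)"
    by metis
  have cpt: "compact (K \<times> (cball 0 R :: (real^'n) set))" by (intro compact_Times K compact_cball)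
  have mem: "\<forall>n. ((qf n, Yf n), xf n) \<in> K \<times> cball 0 R" using KK xR by simp
  obtain l \<sigma> where l: "l \<in> K \<times> cball 0 R" and \<sigma>: "strict_mono \<sigma>"
    and lim: "((\<lambda>n. ((qf n, Yf n), xf n)) \<circ> \<sigma>) \<longlonglongrightarrow> l"
    by (rule seq_compactE[OF compact_imp_seq_compact[OF cpt] mem])
  obtain q Y x where lq: "l = ((q, Y), x)" by (cases l) auto
  define \<rho> where "\<rho> n = real (r (\<sigma> n))" for n
  define qs where "qs n = qf (\<sigma> n)" for n
  define Ys where "Ys n = Yf (\<sigma> n)" for n
  define xs where "xs n = xf (\<sigma> n)" for n
  have L: "(\<lambda>n. ((qs n, Ys n), xs n)) \<longlonglongrightarrow> ((q, Y), x)"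
    using lim unfolding lq o_def qs_def Ys_def xs_def .
  have limits: "qs \<longlonglongrightarrow> q" "Ys \<longlonglongrightarrow> Y" "xs \<longlonglongrightarrow> x"
    using tendsto_fst[OF tendsto_fst[OF L]] tendsto_snd[OF tendsto_fst[OF L]] tendsto_snd[OF L] by simp_all
  have rtop: "filterlim \<rho> at_top sequentially"
    using filterlim_compose[OF filterlim_real_sequentially filterlim_subseq[OF strict_mono_o[OF r \<sigma>]]]
    by (simp add: \<rho>_def[abs_def] o_def)
  have inv: "(\<lambda>n. 1 / \<rho> n) \<longlonglongrightarrow> 0"
    using tendsto_inverse_0_at_top[OF rtop] by (simp add: inverse_eq_divide)
  have inv3: "(\<lambda>n. 1 / \<rho> n ^ 3) \<longlonglongrightarrow> 0" using tendsto_power[OF inv, of 3] by (simp add: power_one_over)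
  have inv1: "\<forall>\<^sub>F n in sequentially. \<rho> n \<ge> 1"
    using rtop by (simp add: filterlim_at_top)
  define qp where "qp n = qs n - (1 / \<rho> n ^ 3) *\<^sub>R xs n" for n
  have "\<exists>s. 0 < s \<and> s < 1 \<and> a (qp n) \<bullet> Ys n - a (qs n) \<bullet> Ys n
          = - (1 / \<rho> n ^ 3) * (DA (qs n - (s / \<rho> n ^ 3) *\<^sub>R xs n) (xs n) \<bullet> Ys n)" for n
  proof -
    define z where "z = - (1 / \<rho> n ^ 3) *\<^sub>R xs n"
    obtain s where s: "0 < s" "s < 1" "a (qs n + 1 *\<^sub>R z) \<bullet> Ys n - a (qs n + 0 *\<^sub>R z) \<bullet> Ys n
       = (1 - 0) * (DA (qs n + s *\<^sub>R z) z \<bullet> Ys n)"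
      using MVT2[of 0 1 "\<lambda>s. a (qs n + s *\<^sub>R z) \<bullet> Ys n" "\<lambda>s. DA (qs n + s *\<^sub>R z) z \<bullet> Ys n"] line
      by auto
    have "DA p z = - (1 / \<rho> n ^ 3) *\<^sub>R DA p (xs n)" for p by (simp add: DA_def vec_eq_iff z_def)
    with s show ?thesis by (intro exI[of _ s]) (simp add: qp_def z_def)
  qed
  then obtain sf where sf: "\<And>n. 0 < sf n" "\<And>n. sf n < 1" and mvt: "\<And>n. a (qp n) \<bullet> Ys n - a (qs n) \<bullet> Ys n
          = - (1 / \<rho> n ^ 3) * (DA (qs n - (sf n / \<rho> n ^ 3) *\<^sub>R xs n) (xs n) \<bullet> Ys n)"
    by metis
  define qm where "qm n = qs n - (sf n / \<rho> n ^ 3) *\<^sub>R xs n" for n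
  have "(\<lambda>n. (1 / \<rho> n ^ 3) *\<^sub>R xs n) \<longlonglongrightarrow> 0 *\<^sub>R x" by (intro tendsto_intros inv3 limits)
  then have step0: "(\<lambda>n. (1 / \<rho> n ^ 3) *\<^sub>R xs n) \<longlonglongrightarrow> 0" by simp
  have qp: "qp \<longlonglongrightarrow> q" unfolding qp_def using tendsto_diff[OF limits(1) step0] by simp
  have "(\<lambda>n. sf n *\<^sub>R ((1 / \<rho> n ^ 3) *\<^sub>R xs n)) \<longlonglongrightarrow> 0"
  proof (rule Lim_null_comparison[OF always_eventually tendsto_norm_zero[OF step0]])
    show "\<forall>n. norm (sf n *\<^sub>R ((1 / \<rho> n ^ 3) *\<^sub>R xs n)) \<le> norm ((1 / \<rho> n ^ 3) *\<^sub>R xs n)"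
      using sf by (metis abs_of_pos less_eq_real_def mult_left_le_one_le norm_ge_zero norm_scaleR)
  qed
  from tendsto_diff[OF limits(1) this] have qm: "qm \<longlonglongrightarrow> q" by (simp add: qm_def[abs_def])
  have taq: "(\<lambda>n. a (qp n)) \<longlonglongrightarrow> a q"
    using conta qp by (intro continuous_on_tendsto_compose[of UNIV a]) auto
  have tDA: "(\<lambda>n. DA (qm n) (xs n)) \<longlonglongrightarrow> DA q x"
    unfolding DA_def
    by (intro tendsto_vec_lambda tendsto_inner limits continuous_on_tendsto_compose[OF c' qm]) auto
  define A where "A n = DA (qm n) (xs n) \<bullet> Ys n" for n
  define B where "B n = a (qp n) \<bullet> (Ys n ** Ys n)" for n
  define C where "C n = a (qp n) \<bullet> (Ys n ** Ys n ** Ys n)" for n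
  define E where "E n = a (qp n) \<bullet> mat 1" for n
  have tA: "A \<longlonglongrightarrow> DA q x \<bullet> Y" and tB: "B \<longlonglongrightarrow> a q \<bullet> (Y ** Y)" and tC: "C \<longlonglongrightarrow> a q \<bullet> (Y ** Y ** Y)"
    and tE: "E \<longlonglongrightarrow> a q \<bullet> mat 1"
    unfolding A_def B_def C_def E_def
    by (intro tendsto_inner tDA taq limits tendsto_matrix_mult tendsto_const)+
  have Bpos: "B n \<ge> 0" for n
  proof -
    have "transpose (Ys n) = Ys n" using KK sym by (auto simp: Ys_def)
    from symmetric_square_inner[OF this] show ?thesis unfolding B_def
      using psd by (simp add: psd_def sum_nonneg)
  qed
  \<comment> \<open>The violated inequality divided by \<open>\<tau>\<close>: the quadratic term keeps a large factor, everything else converges.\<close>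
  have main: "\<rho> n * B n \<le> - A n + (1 / \<rho> n) * C n - E n + 1 / \<rho> n" if "\<rho> n \<ge> 1" for n
  proof -
    have rp: "\<rho> n > 0" using that by simp
    have "a (qs n) \<bullet> Ys n - 1 / \<rho> n ^ 4 \<le> a (qp n) \<bullet> Ys n - (1 / \<rho> n ^ 2) * B n + (1 / \<rho> n ^ 4) * C n - (1 / \<rho> n ^ 3) * E n"
      using bad[of "\<sigma> n"] unfolding B_def C_def E_def qp_def qs_def Ys_def xs_def \<rho>_def
      by (simp add: inner_add_right inner_diff_right)
    also have "a (qp n) \<bullet> Ys n = a (qs n) \<bullet> Ys n - (1 / \<rho> n ^ 3) * A n"
      using mvt[of n] unfolding A_def qm_def by simp
    finally have "(1 / \<rho> n ^ 2) * B n \<le> - ((1 / \<rho> n ^ 3) * A n) + (1 / \<rho> n ^ 4) * C n - (1 / \<rho> n ^ 3) * E n + 1 / \<rho> n ^ 4"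
      by simp
    then have "\<rho> n ^ 3 * ((1 / \<rho> n ^ 2) * B n) \<le> \<rho> n ^ 3 * (- ((1 / \<rho> n ^ 3) * A n) + (1 / \<rho> n ^ 4) * C n - (1 / \<rho> n ^ 3) * E n + 1 / \<rho> n ^ 4)"
      using rp by (intro mult_left_mono) auto
    moreover have "\<rho> n ^ 3 * ((1 / \<rho> n ^ 2) * B n) = \<rho> n * B n"
      using rp by (simp add: power2_eq_square power3_eq_cube)
    moreover have "\<rho> n ^ 3 * (1 / \<rho> n ^ 3) = 1" "\<rho> n ^ 3 * (1 / \<rho> n ^ 4) = 1 / \<rho> n"
      using rp by (simp_all add: power3_eq_cube power4_eq_xxxx)
    then have "\<rho> n ^ 3 * (- ((1 / \<rho> n ^ 3) * A n) + (1 / \<rho> n ^ 4) * C n - (1 / \<rho> n ^ 3) * E n + 1 / \<rho> n ^ 4)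
        = - A n + (1 / \<rho> n) * C n - E n + 1 / \<rho> n"
      by (simp only: distrib_left right_diff_distrib mult.assoc[symmetric] mult_minus_right mult_1_left)
    ultimately show ?thesis by simp
  qed
  have rhs: "(\<lambda>n. - A n + (1 / \<rho> n) * C n - E n + 1 / \<rho> n) \<longlonglongrightarrow> - (DA q x \<bullet> Y) + 0 * (a q \<bullet> (Y ** Y ** Y)) - a q \<bullet> mat 1 + 0"
    by (intro tendsto_intros tA tC tE inv)
  have "a q \<bullet> (Y ** Y) \<le> 0"
  proof -
    have "(\<lambda>n. (1 / \<rho> n) * (- A n + (1 / \<rho> n) * C n - E n + 1 / \<rho> n)) \<longlonglongrightarrow> 0"
      using tendsto_mult[OF inv rhs] by simp
    moreover have "\<forall>\<^sub>F n in sequentially. B n \<le> (1 / \<rho> n) * (- A n + (1 / \<rho> n) * C n - E n + 1 / \<rho> n)"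
      using inv1 
    proof eventually_elim
      case (elim n)
      then show ?case using main[of n] by (simp add: pos_le_divide_eq mult.commute)
    qed
    ultimately show ?thesis using tendsto_le[OF _ _ tB] by force
  qed
  have "0 \<le> - (DA q x \<bullet> Y) - a q \<bullet> mat 1"
  proof -
    have "\<forall>\<^sub>F n in sequentially. 0 \<le> - A n + (1 / \<rho> n) * C n - E n + 1 / \<rho> n"
      using inv1
    proof eventually_elim
      case (elim n)
      have "0 \<le> \<rho> n * B n" using elim Bpos[of n] by simp
      then show ?case using main[OF elim] by linarith
    qed
    from tendsto_lowerbound[OF rhs this] show ?thesis by simp
  qed
  moreover have "DA q x \<bullet> Y = 0"
  proof (rule psd_kernel_inner[OF psd[of q] _ symDA])
    show "transpose Y = Y" using l sym unfolding lq by auto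
    show "v \<bullet> (a q *v v) = 0 \<Longrightarrow> v \<bullet> (DA q x *v v) = 0" for v by (rule nullDA)
    show "a q \<bullet> (Y ** Y) \<le> 0" by fact
  qed
  ultimately show False using tr[of q] by linarith
qed

section \<open>The maximum principle\<close>

text \<open>The maximum principle in its weakest form.  Maximise \<open>f x t + \<kappa> t\<close> over space and time.  If the maximum
  is attained at a positive time and above the threshold \<open>\<theta>\<close>, then the time derivative from the left must be at
  least \<open>-\<kappa>\<close>, which contradicts \<open>\<kappa> < \<eta>\<close>.  A positive \<open>\<kappa>\<close> gives decay at a linear rate down to \<open>\<theta>\<close>;
  \<open>\<kappa> = 0\<close> preserves bounds, and a negative \<open>\<kappa>\<close> admits slow growth.\<close>

lemma time_decay_of_max:
  fixes f :: "'a::metric_space \<Rightarrow> real \<Rightarrow> real"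
  assumes X: "compact X" and cont: "continuous_on (X \<times> {0..}) (\<lambda>(x, t). f x t)"
    and der: "\<And>x t. x \<in> X \<Longrightarrow> 0 < t \<Longrightarrow> \<theta> < f x t \<Longrightarrow> (\<And>y. y \<in> X \<Longrightarrow> f y t \<le> f x t) \<Longrightarrow>
               \<exists>D\<le>-\<eta>. (f x has_real_derivative D) (at t within {0..})"
    and "\<kappa> < \<eta>" and init: "\<And>x. x \<in> X \<Longrightarrow> f x 0 \<le> m" and "x \<in> X" "0 \<le> T"
  shows "f x T + \<kappa> * T \<le> max m (\<theta> + max 0 (\<kappa> * T))"
proof -
  have "compact (X \<times> {0..T})" using X by (intro compact_Times) auto
  moreover have "continuous_on (X \<times> {0..T}) (\<lambda>(x, t). f x t + \<kappa> * t)"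
  proof -
    have "continuous_on (X \<times> {0..T}) (\<lambda>p. (case p of (x, t) \<Rightarrow> f x t) + \<kappa> * snd p)"
      by (intro continuous_intros continuous_on_subset[OF cont]) auto
    then show ?thesis by (simp add: case_prod_beta)
  qed
  moreover have "X \<times> {0..T} \<noteq> {}" using \<open>x \<in> X\<close> \<open>0 \<le> T\<close> by auto
  ultimately obtain z s where zs: "z \<in> X" "0 \<le> s" "s \<le> T"
    and mx: "\<And>y t. y \<in> X \<Longrightarrow> 0 \<le> t \<Longrightarrow> t \<le> T \<Longrightarrow> f y t + \<kappa> * t \<le> f z s + \<kappa> * s"
  proof -
    assume ne: "X \<times> {0..T} \<noteq> {}"
    assume "compact (X \<times> {0..T})" "continuous_on (X \<times> {0..T}) (\<lambda>(x, t). f x t + \<kappa> * t)"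
    from continuous_attains_sup[OF this(1) ne this(2)] obtain p where
      p: "p \<in> X \<times> {0..T}"
      and mp: "\<forall>q\<in>X \<times> {0..T}. (case q of (x, t) \<Rightarrow> f x t + \<kappa> * t) \<le> (case p of (x, t) \<Rightarrow> f x t + \<kappa> * t)"
      by blast
    obtain z s where ps: "p = (z, s)" by (cases p)
    have "f y t + \<kappa> * t \<le> f z s + \<kappa> * s" if "y \<in> X" "0 \<le> t" "t \<le> T" for y t
      using bspec[OF mp, of "(y, t)"] that by (simp add: ps)
    then show thesis using that[of z s] p by (simp add: ps)
  qed
  have le: "f x T + \<kappa> * T \<le> f z s + \<kappa> * s" using mx \<open>x \<in> X\<close> \<open>0 \<le> T\<close> by auto
  consider "s = 0" | "s > 0" "f z s \<le> \<theta>" | "s > 0" "f z s > \<theta>" using zs by linarith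
  then show ?thesis
  proof cases
    case 1 then show ?thesis using le init[OF zs(1)] by simp
  next
    case 2
    have "\<kappa> * s \<le> max 0 (\<kappa> * T)"
      using zs mult_left_mono[of s T \<kappa>] mult_nonpos_nonneg[of \<kappa> s] by (cases "\<kappa> \<ge> 0") auto
    then show ?thesis using le 2 by simp
  next
    case 3
    have "f y s \<le> f z s" if "y \<in> X" for y using mx[OF that zs(2,3)] by simp
    then obtain D where D: "D \<le> -\<eta>" "(f z has_real_derivative D) (at s within {0..})"
      using der[OF zs(1) 3] by blast
    have "((\<lambda>t. f z t + \<kappa> * t) has_real_derivative (D + \<kappa>)) (at s within {0..})"
      by (auto intro!: derivative_eq_intros D(2))
    moreover have "D + \<kappa> < 0" using D \<open>\<kappa> < \<eta>\<close> by simp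
    ultimately obtain d where d: "d > 0"
      "\<And>h. 0 < h \<Longrightarrow> s - h \<in> {0..} \<Longrightarrow> h < d \<Longrightarrow> f z s + \<kappa> * s < f z (s - h) + \<kappa> * (s - h)"
      using has_real_derivative_neg_dec_left by blast
    define h where "h = min d s / 2"
    have "0 < h" "h < d" "h \<le> s" using d(1) 3 by (auto simp: h_def)
    then have False using d(2)[of h] mx[OF zs(1), of "s - h"] zs by auto
    then show ?thesis ..
  qed
qed

lemma twice_diff_diff:
  assumes "twice_diff f f1 f2 S" "twice_diff g g1 g2 S"
  shows "twice_diff (\<lambda>x. f x - g x) (\<lambda>x. f1 x - g1 x) (\<lambda>x h. f2 x h - g2 x h) S"
  unfolding twice_diff_def
proof (intro ballI conjI)
  fix x assume x: "x \<in> S"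
  show "((\<lambda>x. f x - g x) has_derivative (\<lambda>h. (f1 x - g1 x) \<bullet> h)) (at x)"
    by (rule has_derivative_eq_rhs[OF has_derivative_diff[OF twice_diffD(1)[OF assms(1) x] twice_diffD(1)[OF assms(2) x]]])
       (simp add: inner_diff_left)
  show "((\<lambda>x. f1 x - g1 x) has_derivative (\<lambda>h. f2 x h - g2 x h)) (at x)"
    by (rule has_derivative_diff[OF twice_diffD(2)[OF assms(1) x] twice_diffD(2)[OF assms(2) x]])
qed

lemma twice_diff_matrix:
  fixes f :: "real^'n \<Rightarrow> real"
  assumes "twice_diff f f1 f2 S" "x \<in> S"
  shows "matrix (f2 x) *v v = f2 x v"
  by (rule matrix_works, unfold linear_matrix_vector_mul_eq)
     (rule has_derivative_linear[OF twice_diffD(2)[OF assms]])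

lemma twice_diff_matrix_symmetric:
  fixes f :: "real^'n \<Rightarrow> real"
  assumes "twice_diff f f1 f2 S" "open S" "x \<in> S"
  shows "transpose (matrix (f2 x)) = matrix (f2 x)"
proof -
  have "f2 x (axis j 1) $ i = f2 x (axis i 1) $ j" for i j
    using twice_diff_symmetric[OF assms, of "axis j 1" "axis i 1"] by (simp add: inner_axis)
  then show ?thesis by (simp add: vec_eq_iff transpose_def matrix_def)
qed

text \<open>The only way in which a comparison function enters: at a maximum of \<open>f - g\<close> the gradients agree, so both
  functions see the same coefficient matrix \<open>A\<close>.\<close>

lemma touching_hessian:
  fixes f g :: "real^'n \<Rightarrow> real"
  assumes f: "twice_diff f f1 f2 S" and g: "twice_diff g g1 g2 S" and S: "open S" "x \<in> S"
    and mx: "\<And>y. y \<in> S \<Longrightarrow> f y - g y \<le> f x - g x" and A: "psd A"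
  shows "f1 x = g1 x" "A \<bullet> matrix (f2 x) \<le> A \<bullet> matrix (g2 x)"
proof -
  note m = twice_diff_max[OF twice_diff_diff[OF f g] S mx]
  show "f1 x = g1 x" using m(1) by simp
  show "A \<bullet> matrix (f2 x) \<le> A \<bullet> matrix (g2 x)"
  proof (rule psd_inner_mono[OF A])
    fix v
    show "v \<bullet> (matrix (f2 x) *v v) \<le> v \<bullet> (matrix (g2 x) *v v)"
      using m(2)[of v] unfolding twice_diff_matrix[OF f S(2)] twice_diff_matrix[OF g S(2)]
      by (simp add: inner_diff_left inner_commute[of v])
  qed
qed

lemma compact_bdd_above:
  fixes f :: "'b::topological_space \<Rightarrow> real"
  assumes "compact X" "continuous_on X f"
  shows "\<exists>m. \<forall>x\<in>X. f x \<le> m"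
proof -
  have "bdd_above (f ` X)"
    by (rule bounded_imp_bdd_above[OF compact_imp_bounded[OF compact_continuous_image[OF assms(2,1)]]])
  then show ?thesis by (auto simp: bdd_above_def)
qed

section \<open>One-sided convergence for degenerate flows\<close>

text \<open>Only the features of the problem that the upper bound uses.  The barrier condition says that near a boundary
  point \<open>x0\<close> the function \<open>B |x - x0|\<^sup>2 + s \<rho>\<close>, with \<open>\<rho>\<close> vanishing at \<open>x0\<close> and nonnegative in the domain, is as strict a
  supersolution as desired once \<open>s\<close> is large.  The lower bound is the same statement for the reflected data
  \<open>-u\<close>, \<open>-w\<close>, \<open>-lam\<close> and \<open>q \<mapsto> a (- q)\<close>.\<close>

locale graph_flow =
  fixes \<Omega> :: "(real^'n) set" and a :: "real^'n \<Rightarrow> real^'n^'n" and lam :: real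
    and w :: "real^'n \<Rightarrow> real" and w1 :: "real^'n \<Rightarrow> real^'n" and w2 :: "real^'n \<Rightarrow> real^'n \<Rightarrow> real^'n"
    and u :: "real^'n \<Rightarrow> real \<Rightarrow> real" and u1 :: "real \<Rightarrow> real^'n \<Rightarrow> real^'n"
    and u2 :: "real \<Rightarrow> real^'n \<Rightarrow> real^'n \<Rightarrow> real^'n"
  assumes open_dom: "open \<Omega>" and bounded_dom: "bounded \<Omega>"
    and coeff: "elliptic_coeff a"
    and w_diff: "twice_diff w w1 w2 \<Omega>"
    and w_hess_cont: "\<And>v. continuous_on \<Omega> (\<lambda>x. w2 x v)"
    and w_cont: "continuous_on (closure \<Omega>) w"
    and w_eq: "\<And>x. x \<in> \<Omega> \<Longrightarrow> a (w1 x) \<bullet> matrix (w2 x) = lam"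
    and u_diff: "\<And>t. 0 < t \<Longrightarrow> twice_diff (\<lambda>x. u x t) (u1 t) (u2 t) \<Omega>"
    and u_cont: "continuous_on (closure \<Omega> \<times> {0..}) (\<lambda>(x, t). u x t)"
    and u_eq: "\<And>x t. x \<in> \<Omega> \<Longrightarrow> 0 < t \<Longrightarrow>
      (u x has_real_derivative a (u1 t x) \<bullet> matrix (u2 t x)) (at t within {0..})"
    and u_bdry: "\<And>x t. x \<in> frontier \<Omega> \<Longrightarrow> 0 \<le> t \<Longrightarrow> u x t = w x + lam * t"
    and barrier: "\<And>x0. x0 \<in> frontier \<Omega> \<Longrightarrow> \<exists>\<rho> \<rho>1 \<rho>2 r. 0 < r \<and> twice_diff \<rho> \<rho>1 \<rho>2 (ball x0 r) \<and>
      \<rho> x0 = 0 \<and> (\<forall>x \<in> \<Omega> \<inter> ball x0 r. 0 \<le> \<rho> x) \<and>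
      (\<forall>B \<Lambda>. \<exists>s\<ge>0. \<forall>x \<in> \<Omega> \<inter> ball x0 r.
         a ((2 * B) *\<^sub>R (x - x0) + s *\<^sub>R \<rho>1 x) \<bullet> matrix (\<lambda>h. (2 * B) *\<^sub>R h + s *\<^sub>R \<rho>2 x h) \<le> \<Lambda>)"
begin

lemma psd_coeff: "psd (a q)"
  using coeff by (simp add: elliptic_coeff_def)

lemma closure_cases: "x \<in> closure \<Omega> \<Longrightarrow> x \<notin> frontier \<Omega> \<Longrightarrow> x \<in> \<Omega>"
  using open_dom by (simp add: frontier_def interior_open)

lemma compact_closure_dom: "compact (closure \<Omega>)"
  using bounded_dom by simp

lemma u_slice_cont:
  assumes "0 \<le> t"
  shows "continuous_on (closure \<Omega>) (\<lambda>x. u x t)"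
proof -
  have "continuous_on (closure \<Omega>) (\<lambda>x. (x, t))"
    by (intro continuous_on_Pair continuous_on_id continuous_on_const)
  from continuous_on_compose2[OF u_cont this] show ?thesis using assms by force
qed

text \<open>At a spatial maximum of \<open>u - w\<close> both functions see the same coefficients, so \<open>u - lam t - w\<close> does not
  increase there.\<close>

lemma bounded_above: "\<exists>S. \<forall>x\<in>closure \<Omega>. \<forall>t\<ge>0. u x t - lam * t \<le> S"
proof -
  define f where "f x t = u x t - lam * t - w x" for x t
  have cont: "continuous_on (closure \<Omega> \<times> {0..}) (\<lambda>(x, t). f x t)"
  proof -
    have "continuous_on (closure \<Omega> \<times> {0..}) (\<lambda>p. u (fst p) (snd p))"
      using u_cont by (simp add: case_prod_beta)
    moreover have "continuous_on (closure \<Omega> \<times> {0..}) (\<lambda>p. w (fst p))"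
      by (rule continuous_on_compose2[OF w_cont continuous_on_fst[OF continuous_on_id]]) auto
    ultimately have "continuous_on (closure \<Omega> \<times> {0..}) (\<lambda>p. f (fst p) (snd p))"
      unfolding f_def by (intro continuous_on_diff continuous_on_mult continuous_on_const continuous_on_snd continuous_on_id)
    then show ?thesis by (simp add: case_prod_beta)
  qed
  obtain m where m: "\<And>x. x \<in> closure \<Omega> \<Longrightarrow> f x 0 \<le> m"
  proof -
    have "continuous_on (closure \<Omega>) (\<lambda>x. f x 0)"
      unfolding f_def by (intro continuous_on_diff u_slice_cont w_cont continuous_on_const order_refl)
    from compact_bdd_above[OF compact_closure_dom this] show ?thesis using that by blast
  qed
  obtain m' where m': "\<And>x. x \<in> closure \<Omega> \<Longrightarrow> w x \<le> m'"
    using compact_bdd_above[OF compact_closure_dom w_cont] by blast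
  have der: "\<exists>D\<le>-0. (f x has_real_derivative D) (at t within {0..})"
    if "x \<in> closure \<Omega>" "0 < t" "0 < f x t" and mx: "\<And>y. y \<in> closure \<Omega> \<Longrightarrow> f y t \<le> f x t" for x t
  proof -
    have x: "x \<in> \<Omega>" using closure_cases[OF that(1)] u_bdry[of x t] that by (auto simp: f_def)
    note tc = touching_hessian[OF u_diff[OF \<open>0 < t\<close>] w_diff open_dom x _ psd_coeff]
    have mm: "u y t - w y \<le> u x t - w x" if "y \<in> \<Omega>" for y
      using mx[of y] closure_subset that by (auto simp: f_def)
    have eq: "u1 t x = w1 x" using tc(1) mm by blast
    have "a (w1 x) \<bullet> matrix (u2 t x) \<le> lam" using tc(2)[of "w1 x"] mm w_eq[OF x] by simp
    moreover have "(f x has_real_derivative (a (w1 x) \<bullet> matrix (u2 t x) - lam)) (at t within {0..})"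
      unfolding f_def using u_eq[OF x \<open>0 < t\<close>] eq by (auto intro!: derivative_eq_intros)
    ultimately show ?thesis by (intro exI[of _ "a (w1 x) \<bullet> matrix (u2 t x) - lam"]) auto
  qed
  have "f x T \<le> max m 0" if x: "x \<in> closure \<Omega>" and T: "T \<ge> 0" for x T
  proof (rule field_le_epsilon)
    fix e :: real assume e: "e > 0"
    \<comment> \<open>The maximum need not decrease strictly, so an arbitrarily small rate of growth has to be allowed.\<close>
    define \<kappa> where "\<kappa> = - e / (T + 1)"
    have k: "\<kappa> < 0" using e T by (simp add: \<kappa>_def)
    have "f x T + \<kappa> * T \<le> max m (0 + max 0 (\<kappa> * T))"
      by (rule time_decay_of_max[OF compact_closure_dom cont der k m x T])
    moreover have "\<kappa> * T \<le> 0" using k T by (simp add: mult_nonpos_nonneg)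
    moreover have "- \<kappa> * T \<le> e"
    proof -
      have "e * T \<le> e * (T + 1)" using e by simp
      then show ?thesis using T by (simp add: \<kappa>_def pos_divide_le_eq)
    qed
    ultimately show "f x T \<le> max m 0 + e" by simp
  qed
  then have le: "f x t \<le> max m 0" if "x \<in> closure \<Omega>" "t \<ge> 0" for x t
    using that by blast
  have "u x t - lam * t \<le> max m 0 + m'" if "x \<in> closure \<Omega>" "t \<ge> 0" for x t
    using m'[OF that(1)] le[OF that] unfolding f_def by linarith
  then show ?thesis by blast
qed

text \<open>Near \<open>x0\<close> the function \<open>u - lam t\<close> stays below \<open>W = w x0 + e' + B |x - x0|\<^sup>2 + s \<rho>\<close>, uniformly in time: the
  quadratic term lifts \<open>W\<close> above the global bound \<open>S\<close> on the outer sphere, the constant \<open>e'\<close> absorbs the oscillation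
  of the initial and boundary values, and the large slope \<open>s\<close> makes \<open>W\<close> a strict supersolution.\<close>

lemma boundary_control:
  assumes x0: "x0 \<in> frontier \<Omega>" and e: "0 < e"
  shows "\<exists>d>0. \<forall>x\<in>\<Omega> \<inter> ball x0 d. \<forall>t\<ge>0. u x t - lam * t \<le> w x + e"
proof -
  obtain S where S: "\<And>x t. x \<in> closure \<Omega> \<Longrightarrow> t \<ge> 0 \<Longrightarrow> u x t - lam * t \<le> S"
    using bounded_above by blast
  obtain \<rho> \<rho>1 \<rho>2 r where r: "0 < r" and \<rho>: "twice_diff \<rho> \<rho>1 \<rho>2 (ball x0 r)" "\<rho> x0 = 0"
      "\<And>x. x \<in> \<Omega> \<inter> ball x0 r \<Longrightarrow> 0 \<le> \<rho> x"
    and bar: "\<And>B \<Lambda>. \<exists>s\<ge>0. \<forall>x \<in> \<Omega> \<inter> ball x0 r.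
         a ((2 * B) *\<^sub>R (x - x0) + s *\<^sub>R \<rho>1 x) \<bullet> matrix (\<lambda>h. (2 * B) *\<^sub>R h + s *\<^sub>R \<rho>2 x h) \<le> \<Lambda>"
    using barrier[OF x0] by blast
  define e' where "e' = e / 3"
  have e': "e' > 0" using e by (simp add: e'_def)
  have x0c: "x0 \<in> closure \<Omega>" using x0 by (simp add: frontier_def)
  obtain d1 where d1: "d1 > 0" "\<And>x. x \<in> closure \<Omega> \<Longrightarrow> dist x x0 < d1 \<Longrightarrow> \<bar>w x - w x0\<bar> < e'"
    using w_cont x0c e' unfolding continuous_on_iff dist_real_def by metis
  obtain d2 where d2: "d2 > 0" "\<And>x. x \<in> closure \<Omega> \<Longrightarrow> dist x x0 < d2 \<Longrightarrow> \<bar>u x 0 - u x0 0\<bar> < e'"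
    using u_slice_cont[of 0] x0c e' unfolding continuous_on_iff dist_real_def by (metis order_refl)
  define d where "d = min r (min d1 d2) / 2"
  have d: "0 < d" "d < r" "d < d1" "d < d2" using r d1 d2 by (auto simp: d_def)
  \<comment> \<open>So that \<open>W\<close> exceeds \<open>S\<close> on the sphere of radius \<open>d\<close>.\<close>
  define B where "B = \<bar>S - w x0\<bar> / d\<^sup>2"
  have B: "B \<ge> 0" "B * d\<^sup>2 \<ge> S - w x0" using d by (auto simp: B_def)
  obtain s where s: "s \<ge> 0" and sb: "\<And>x. x \<in> \<Omega> \<inter> ball x0 r \<Longrightarrow>
         a ((2 * B) *\<^sub>R (x - x0) + s *\<^sub>R \<rho>1 x) \<bullet> matrix (\<lambda>h. (2 * B) *\<^sub>R h + s *\<^sub>R \<rho>2 x h) \<le> lam - 1"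
    using bar[of B "lam - 1"] by blast
  define W where "W x = w x0 + e' + B * ((x - x0) \<bullet> (x - x0)) + s * \<rho> x" for x
  define X where "X = closure \<Omega> \<inter> cball x0 d"
  have X: "compact X" unfolding X_def using compact_closure_dom by (simp add: compact_Int_closed)
  have Xr: "X \<subseteq> ball x0 r" using d by (auto simp: X_def)
  have \<rho>c: "continuous_on (ball x0 r) \<rho>" using twice_diff_continuous_on(1)[OF \<rho>(1)] .
  have Wc: "continuous_on (ball x0 r) W"
    unfolding W_def by (intro continuous_intros \<rho>c)
  have Wd: "twice_diff W (\<lambda>x. (2 * B) *\<^sub>R (x - x0) + s *\<^sub>R \<rho>1 x) (\<lambda>x h. (2 * B) *\<^sub>R h + s *\<^sub>R \<rho>2 x h) (ball x0 r)"
    unfolding twice_diff_def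
  proof (intro ballI conjI)
    fix x assume x: "x \<in> ball x0 r"
    show "(W has_derivative (\<lambda>h. ((2 * B) *\<^sub>R (x - x0) + s *\<^sub>R \<rho>1 x) \<bullet> h)) (at x)"
      unfolding W_def
      by (rule derivative_eq_intros twice_diffD(1)[OF \<rho>(1) x] refl)+
         (simp add: inner_add_left inner_diff_left inner_diff_right inner_commute algebra_simps)
    show "((\<lambda>x. (2 * B) *\<^sub>R (x - x0) + s *\<^sub>R \<rho>1 x) has_derivative (\<lambda>h. (2 * B) *\<^sub>R h + s *\<^sub>R \<rho>2 x h)) (at x)"
      by (rule derivative_eq_intros twice_diffD(2)[OF \<rho>(1) x] refl)+ simp
  qed
  have \<rho>pos: "\<rho> x \<ge> 0" if "x \<in> X" for x
  proof (rule ccontr)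
    assume "\<not> 0 \<le> \<rho> x"
    then have "x \<in> (ball x0 r \<inter> \<rho> -` {..<0}) \<inter> closure \<Omega>" using that Xr by (auto simp: X_def)
    moreover have "open (ball x0 r \<inter> \<rho> -` {..<0})"
      by (rule continuous_open_preimage[OF \<rho>c]) auto
    ultimately have "(ball x0 r \<inter> \<rho> -` {..<0}) \<inter> \<Omega> \<noteq> {}"
      using open_Int_closure_eq_empty by blast
    then show False using \<rho>(3) by force
  qed
  define f where "f x t = u x t - lam * t - W x" for x t
  have cont: "continuous_on (X \<times> {0..}) (\<lambda>(x, t). f x t)"
  proof -
    have "X \<times> {0..} \<subseteq> closure \<Omega> \<times> {0::real..}" by (auto simp: X_def)
    from continuous_on_subset[OF u_cont this] have "continuous_on (X \<times> {0..}) (\<lambda>p. u (fst p) (snd p))"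
      by (simp add: case_prod_beta)
    moreover have "continuous_on (X \<times> {0..}) (\<lambda>p. W (fst p))"
      by (rule continuous_on_compose2[OF Wc continuous_on_fst[OF continuous_on_id]]) (use Xr in auto)
    ultimately have "continuous_on (X \<times> {0..}) (\<lambda>p. f (fst p) (snd p))"
      unfolding f_def by (intro continuous_on_diff continuous_on_mult continuous_on_const continuous_on_snd continuous_on_id)
    then show ?thesis by (simp add: case_prod_beta)
  qed
  have fr: "f x t \<le> 0" if x: "x \<in> X" and t: "t \<ge> 0" and c: "t = 0 \<or> x \<in> frontier \<Omega> \<or> dist x0 x = d" for x t
  proof -
    have xc: "x \<in> closure \<Omega>" "dist x x0 < d1" "dist x x0 < d2" using x d by (auto simp: X_def dist_commute)
    have sr: "s * \<rho> x \<ge> 0" using s \<rho>pos[OF x] by simp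
    have sq: "B * ((x - x0) \<bullet> (x - x0)) \<ge> 0" using B by simp
    show ?thesis
      using c
    proof (elim disjE)
      assume "t = 0"
      then show ?thesis using d2(2)[OF xc(1,3)] u_bdry[OF x0, of 0] sr sq by (simp add: f_def W_def)
    next
      assume "x \<in> frontier \<Omega>"
      then show ?thesis using d1(2)[OF xc(1,2)] u_bdry[of x t] t sr sq by (simp add: f_def W_def)
    next
      assume "dist x0 x = d"
      then have "(x - x0) \<bullet> (x - x0) = d\<^sup>2"
        by (simp add: dist_norm norm_minus_commute power2_norm_eq_inner[symmetric])
      then show ?thesis using S[OF xc(1) t] B(2) sr e' by (simp add: f_def W_def)
    qed
  qed
  have der: "\<exists>D\<le>-1. (f x has_real_derivative D) (at t within {0..})"
    if x: "x \<in> X" and t: "0 < t" and f0: "0 < f x t" and mx: "\<And>y. y \<in> X \<Longrightarrow> f y t \<le> f x t" for x t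
  proof -
    have "x \<notin> frontier \<Omega>" "dist x0 x \<noteq> d" using fr[OF x, of t] t f0 by auto
    then have xi: "x \<in> \<Omega> \<inter> ball x0 d" using x closure_cases by (auto simp: X_def)
    have sub: "\<Omega> \<inter> ball x0 d \<subseteq> X" using closure_subset by (auto simp: X_def)
    have op: "open (\<Omega> \<inter> ball x0 d)" using open_dom by auto
    have mm: "u y t - W y \<le> u x t - W x" if "y \<in> \<Omega> \<inter> ball x0 d" for y
      using mx[of y] sub that by (auto simp: f_def)
    note tc = touching_hessian[OF twice_diff_subset[OF u_diff[OF t], of "\<Omega> \<inter> ball x0 d"]
        twice_diff_subset[OF Wd, of "\<Omega> \<inter> ball x0 d"] op xi mm psd_coeff]
    have i1: "\<Omega> \<inter> ball x0 d \<subseteq> \<Omega>" "\<Omega> \<inter> ball x0 d \<subseteq> ball x0 r" using d by auto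
    have eq: "u1 t x = (2 * B) *\<^sub>R (x - x0) + s *\<^sub>R \<rho>1 x" using tc(1)[OF i1] .
    have "a (u1 t x) \<bullet> matrix (u2 t x) \<le> a (u1 t x) \<bullet> matrix (\<lambda>h. (2 * B) *\<^sub>R h + s *\<^sub>R \<rho>2 x h)"
      using tc(2)[OF i1] .
    also have "\<dots> \<le> lam - 1" unfolding eq using sb xi i1 by blast
    finally have "a (u1 t x) \<bullet> matrix (u2 t x) - lam \<le> -1" by simp
    moreover have "(f x has_real_derivative (a (u1 t x) \<bullet> matrix (u2 t x) - lam)) (at t within {0..})"
      unfolding f_def using u_eq[of x t] xi t by (auto intro!: derivative_eq_intros)
    ultimately show ?thesis by blast
  qed
  have le: "u x t - lam * t \<le> W x" if x: "x \<in> X" and t: "t \<ge> 0" for x t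
  proof -
    have "f x t + 0 * t \<le> max 0 (0 + max 0 (0 * t))"
      by (rule time_decay_of_max[OF X cont der _ _ x t]) (auto intro: fr)
    then show ?thesis by (simp add: f_def)
  qed
  have "isCont W x0" using Wc r by (simp add: continuous_on_eq_continuous_at)
  moreover have "W x0 = w x0 + e'" by (simp add: W_def \<rho>)
  ultimately obtain d3 where d3: "d3 > 0" "\<And>x. dist x x0 < d3 \<Longrightarrow> \<bar>W x - (w x0 + e')\<bar> < e'"
    using e' unfolding continuous_at_eps_delta dist_real_def by metis
  have "u x t - lam * t \<le> w x + e" if x: "x \<in> \<Omega> \<inter> ball x0 (min d d3)" and t: "t \<ge> 0" for x t
  proof -
    have xX: "x \<in> X" using x closure_subset by (auto simp: X_def)
    have "\<bar>w x - w x0\<bar> < e'" using d1(2)[of x] x xX d by (auto simp: X_def dist_commute)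
    moreover have "\<bar>W x - (w x0 + e')\<bar> < e'" using d3(2)[of x] x by (auto simp: dist_commute)
    moreover have "3 * e' = e" by (simp add: e'_def)
    ultimately show ?thesis using le[OF xX t] by linarith
  qed
  then show ?thesis using d d3 by (intro exI[of _ "min d d3"]) auto
qed

text \<open>\<open>K\<close> is what remains of the closure of the domain when the open neighbourhoods of all boundary points, in
  which the previous estimate holds, are removed.\<close>

lemma collar_control:
  assumes e: "0 < e"
  obtains K where "compact K" "K \<subseteq> \<Omega>"
    "\<And>x t. x \<in> closure \<Omega> - K \<Longrightarrow> 0 \<le> t \<Longrightarrow> u x t - lam * t \<le> w x + e"
proof -
  obtain d where d: "\<And>x. x \<in> frontier \<Omega> \<Longrightarrow> 0 < d x"
    "\<And>x0 x t. x0 \<in> frontier \<Omega> \<Longrightarrow> x \<in> \<Omega> \<inter> ball x0 (d x0) \<Longrightarrow> 0 \<le> t \<Longrightarrow> u x t - lam * t \<le> w x + e"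
    using boundary_control[OF _ e] by metis
  define O' where "O' = (\<Union>x\<in>frontier \<Omega>. ball x (d x))"
  define K where "K = closure \<Omega> - O'"
  have 1: "compact K" unfolding K_def O'_def by (intro compact_diff compact_closure_dom) auto
  have 2: "K \<subseteq> \<Omega>"
  proof
    fix x assume "x \<in> K"
    then have "x \<in> closure \<Omega>" "x \<notin> frontier \<Omega>" using d(1) by (force simp: K_def O'_def)+
    then show "x \<in> \<Omega>" by (rule closure_cases)
  qed
  have 3: "u x t - lam * t \<le> w x + e" if x: "x \<in> closure \<Omega> - K" and t: "0 \<le> t" for x t
  proof (cases "x \<in> frontier \<Omega>")
    case True
    then show ?thesis using u_bdry[of x t] t e by simp
  next
    case False
    then have "x \<in> \<Omega>" using x closure_cases by blast
    moreover obtain x0 where "x0 \<in> frontier \<Omega>" "x \<in> ball x0 (d x0)" using x by (auto simp: K_def O'_def)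
    ultimately show ?thesis using d(2) t by blast
  qed
  show ?thesis by (rule that[OF 1 2 3])
qed

end

context graph_flow
begin

text \<open>The Hessian inequality at a maximum of \<open>u(x', t) - w(y') - c/2 |x' - y'|\<^sup>2 + \<tau>/2 |x'|\<^sup>2\<close>.  Testing it with
  \<open>(v, v)\<close> would give \<open>D\<^sup>2u \<le> Y - \<tau>\<close>; testing with \<open>(v, v - z)\<close> for \<open>z = Y v / c\<close> gains the additional term
  \<open>- Y\<^sup>2 / c\<close>, as for inf-convolutions.  This gain is what replaces uniform ellipticity.\<close>

lemma hessian_doubling:
  assumes t: "0 < t" and x: "x \<in> \<Omega>" and y: "y \<in> \<Omega>" and c: "0 < c"
    and mx: "\<And>x' y'. x' \<in> \<Omega> \<Longrightarrow> y' \<in> \<Omega> \<Longrightarrow>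
       u x' t - w y' - c / 2 * ((x' - y') \<bullet> (x' - y')) + \<tau> / 2 * (x' \<bullet> x')
       \<le> u x t - w y - c / 2 * ((x - y) \<bullet> (x - y)) + \<tau> / 2 * (x \<bullet> x)"
  defines "Y \<equiv> matrix (w2 y)"
  shows "u1 t x = w1 y - \<tau> *\<^sub>R x"
    and "a (u1 t x) \<bullet> matrix (u2 t x)
         \<le> a (u1 t x) \<bullet> (Y - (1 / c) *\<^sub>R (Y ** Y) + (1 / c\<^sup>2) *\<^sub>R (Y ** Y ** Y) - \<tau> *\<^sub>R mat 1)"
proof -
  have w2Y: "w2 y h = Y *v h" for h unfolding Y_def using twice_diff_matrix[OF w_diff y] by simp
  have u2m: "u2 t x h = matrix (u2 t x) *v h" for h using twice_diff_matrix[OF u_diff[OF t] x] by simp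
  have sym: "transpose Y = Y"
    unfolding Y_def by (rule twice_diff_matrix_symmetric[OF w_diff open_dom y])
  define \<Phi> where "\<Phi> p = u (fst p) t - w (snd p) - c / 2 * ((fst p - snd p) \<bullet> (fst p - snd p)) + \<tau> / 2 * (fst p \<bullet> fst p)" for p
  define \<Phi>1 where "\<Phi>1 p = (u1 t (fst p) - c *\<^sub>R (fst p - snd p) + \<tau> *\<^sub>R fst p, - w1 (snd p) + c *\<^sub>R (fst p - snd p))" for p
  define \<Phi>2 where "\<Phi>2 p h = (u2 t (fst p) (fst h) - c *\<^sub>R (fst h - snd h) + \<tau> *\<^sub>R fst h, - w2 (snd p) (snd h) + c *\<^sub>R (fst h - snd h))" for p h
  have td: "twice_diff \<Phi> \<Phi>1 \<Phi>2 (\<Omega> \<times> \<Omega>)"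
    unfolding twice_diff_def
  proof (intro ballI conjI)
    fix p assume p: "p \<in> \<Omega> \<times> \<Omega>"
    have p1: "fst p \<in> \<Omega>" and p2: "snd p \<in> \<Omega>" using p by auto
    have U: "((\<lambda>p. u (fst p) t) has_derivative (\<lambda>h. u1 t (fst p) \<bullet> fst h)) (at p)"
      by (rule has_derivative_compose[where f=fst and g="\<lambda>x. u x t", OF _ twice_diffD(1)[OF u_diff[OF t] p1]])
         (auto intro!: derivative_eq_intros)
    have V: "((\<lambda>p. w (snd p)) has_derivative (\<lambda>h. w1 (snd p) \<bullet> snd h)) (at p)"
      by (rule has_derivative_compose[where f=snd and g=w, OF _ twice_diffD(1)[OF w_diff p2]])
         (auto intro!: derivative_eq_intros)
    have U1: "((\<lambda>p. u1 t (fst p)) has_derivative (\<lambda>h. u2 t (fst p) (fst h))) (at p)"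
      by (rule has_derivative_compose[where f=fst and g="u1 t", OF _ twice_diffD(2)[OF u_diff[OF t] p1]])
         (auto intro!: derivative_eq_intros)
    have V1: "((\<lambda>p. w1 (snd p)) has_derivative (\<lambda>h. w2 (snd p) (snd h))) (at p)"
      by (rule has_derivative_compose[where f=snd and g=w1, OF _ twice_diffD(2)[OF w_diff p2]])
         (auto intro!: derivative_eq_intros)
    show "(\<Phi> has_derivative (\<lambda>h. \<Phi>1 p \<bullet> h)) (at p)"
      unfolding \<Phi>_def \<Phi>1_def
      by (rule derivative_eq_intros U V refl)+
         (auto simp: inner_prod_def inner_add_left inner_diff_left inner_diff_right inner_commute algebra_simps)
    show "(\<Phi>1 has_derivative \<Phi>2 p) (at p)"
      unfolding \<Phi>1_def \<Phi>2_def
      by (rule derivative_eq_intros U1 V1 refl)+ (auto simp: fun_eq_iff)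
  qed
  have op: "open (\<Omega> \<times> \<Omega>)" using open_dom by (simp add: open_Times)
  have xy: "(x, y) \<in> \<Omega> \<times> \<Omega>" using x y by simp
  have mm: "\<Phi> p \<le> \<Phi> (x, y)" if "p \<in> \<Omega> \<times> \<Omega>" for p
    using mx[of "fst p" "snd p"] that by (auto simp: \<Phi>_def)
  have "\<Phi>1 (x, y) = 0" by (rule twice_diff_max(1)[OF td op xy mm])
  then have "u1 t x - c *\<^sub>R (x - y) + \<tau> *\<^sub>R x = 0" "- w1 y + c *\<^sub>R (x - y) = 0"
    by (auto simp: \<Phi>1_def zero_prod_def)
  then show eq: "u1 t x = w1 y - \<tau> *\<^sub>R x"
    by (metis (no_types, lifting) add_diff_cancel_right' add_eq_0_iff diff_add_cancel minus_diff_eq uminus_add_conv_diff)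
  show "a (u1 t x) \<bullet> matrix (u2 t x)
         \<le> a (u1 t x) \<bullet> (Y - (1 / c) *\<^sub>R (Y ** Y) + (1 / c\<^sup>2) *\<^sub>R (Y ** Y ** Y) - \<tau> *\<^sub>R mat 1)"
  proof (rule psd_inner_mono[OF psd_coeff])
    fix v
    define z where "z = (1 / c) *\<^sub>R (Y *v v)"
    have z: "Y *v v = c *\<^sub>R z" using c by (simp add: z_def)
    have s: "p \<bullet> (Y *v q) = q \<bullet> (Y *v p)" for p q by (rule symmetric_matrix_inner[OF sym])
    have vz: "v \<bullet> (Y *v z) = c * (z \<bullet> z)" by (subst s) (simp add: z)
    have "\<Phi>2 (x, y) (v, v - z) \<bullet> (v, v - z) \<le> 0" by (rule twice_diff_max(2)[OF td op xy mm])
    then have "v \<bullet> u2 t x v + \<tau> * (v \<bullet> v) \<le> (v - z) \<bullet> (Y *v (v - z)) + c * (z \<bullet> z)"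
      by (simp add: \<Phi>2_def w2Y inner_prod_def inner_add_left inner_diff_left inner_diff_right inner_commute algebra_simps)
    also have "\<dots> = v \<bullet> (Y *v v) - c * (z \<bullet> z) + z \<bullet> (Y *v z)"
      using vz by (simp add: matrix_vector_mult_diff_distrib inner_diff_left inner_diff_right z algebra_simps inner_commute)
    finally have le: "v \<bullet> u2 t x v \<le> v \<bullet> (Y *v v) - c * (z \<bullet> z) + z \<bullet> (Y *v z) - \<tau> * (v \<bullet> v)" by simp
    have Y2: "v \<bullet> ((Y ** Y) *v v) = c^2 * (z \<bullet> z)"
      by (simp add: matrix_vector_mul_assoc[symmetric] z matrix_vector_mult_scaleR vz power2_eq_square)
    have Y3: "v \<bullet> ((Y ** Y ** Y) *v v) = c^2 * (z \<bullet> (Y *v z))"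
      by (simp add: matrix_vector_mul_assoc[symmetric] z matrix_vector_mult_scaleR s[of v "Y *v z"] power2_eq_square inner_commute)
    show "v \<bullet> (matrix (u2 t x) *v v)
      \<le> v \<bullet> ((Y - (1 / c) *\<^sub>R (Y ** Y) + (1 / c\<^sup>2) *\<^sub>R (Y ** Y ** Y) - \<tau> *\<^sub>R mat 1) *v v)"
      using le c unfolding u2m[symmetric]
      by (simp add: matrix_vector_mult_diff_rdistrib matrix_vector_mult_add_rdistrib scaleR_matrix_vector_assoc[symmetric]
          inner_diff_right inner_add_right Y2 Y3 power2_eq_square)
  qed
qed

text \<open>The doubled function decreases at a fixed rate at any maximum above \<open>3 e\<close>.  Such a maximum has both points
  away from the boundary, by control in the collar, and there the perturbed trace inequality applies uniformly, the
  gradient and the Hessian of \<open>w\<close> ranging over a compact set \<open>J\<close>.  On the diagonal the penalty vanishes.\<close>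

lemma upper_bound_eventually:
  assumes e: "0 < e"
  shows "\<forall>\<^sub>F t in at_top. \<forall>x\<in>\<Omega>. u x t - lam * t - w x \<le> 3 * e"
proof -
  obtain S where S: "\<And>x t. x \<in> closure \<Omega> \<Longrightarrow> t \<ge> 0 \<Longrightarrow> u x t - lam * t \<le> S"
    using bounded_above by blast
  obtain S' where S': "\<And>x. x \<in> closure \<Omega> \<Longrightarrow> - w x \<le> S'"
    using compact_bdd_above[OF compact_closure_dom continuous_on_minus[OF w_cont]] by blast
  define C where "C = \<bar>S + S'\<bar> + e"
  have C: "C > 0" using e by (simp add: C_def)
  obtain R where R: "\<And>x. x \<in> closure \<Omega> \<Longrightarrow> norm x \<le> R" "R > 0"
    using compact_imp_bounded[OF compact_closure_dom] unfolding bounded_pos by blast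
  obtain K where K: "compact K" "K \<subseteq> \<Omega>"
    and col: "\<And>x t. x \<in> closure \<Omega> - K \<Longrightarrow> 0 \<le> t \<Longrightarrow> u x t - lam * t \<le> w x + e"
    by (rule collar_control[OF e]) (rule that; assumption)
  obtain d1 where d1: "d1 > 0" "(\<Union>x\<in>K. cball x d1) \<subseteq> \<Omega>"
    by (rule compact_subset_open_imp_cball_epsilon_subset[OF K(1) open_dom K(2)])
  \<comment> \<open>The point \<open>y\<close> is only known to be close to \<open>x\<close>, hence a slightly larger compact set.\<close>
  define K' where "K' = (\<Union>x\<in>K. cball x d1)"
  have K': "compact K'" "K' \<subseteq> \<Omega>"
    using compact_minkowski_sum_cball[OF K(1)] d1 by (auto simp: K'_def)
  obtain d2 where d2: "d2 > 0" "\<And>x y. x \<in> closure \<Omega> \<Longrightarrow> y \<in> closure \<Omega> \<Longrightarrow> dist x y < d2 \<Longrightarrow> \<bar>w x - w y\<bar> < e"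
    using compact_uniformly_continuous[OF w_cont compact_closure_dom] e
    unfolding uniformly_continuous_on_def dist_real_def by metis
  define d where "d = min d1 d2"
  have d: "d > 0" using d1 d2 by (simp add: d_def)
  define J where "J = (\<lambda>y. (w1 y, matrix (w2 y))) ` K'"
  have "compact J" unfolding J_def
  proof (rule compact_continuous_image[OF _ K'(1)])
    have "continuous_on \<Omega> (\<lambda>y. matrix (w2 y))"
      unfolding matrix_def by (intro continuous_on_vec_lambda continuous_on_component w_hess_cont)
    then show "continuous_on K' (\<lambda>y. (w1 y, matrix (w2 y)))"
      by (intro continuous_on_Pair continuous_on_subset[OF _ K'(2)] twice_diff_continuous_on(2)[OF w_diff])
  qed
  moreover have "transpose Y = Y" if qY: "(q, Y) \<in> J" for q Y
  proof -
    obtain y where y: "y \<in> \<Omega>" "Y = matrix (w2 y)" using qY K'(2) by (auto simp: J_def)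
    show ?thesis unfolding y(2) by (rule twice_diff_matrix_symmetric[OF w_diff open_dom y(1)])
  qed
  ultimately have ev1: "\<forall>\<^sub>F k in sequentially. \<forall>q Y x. (q, Y) \<in> J \<longrightarrow> norm x \<le> R \<longrightarrow>
     a (q - (1 / real k ^ 3) *\<^sub>R x) \<bullet>
       (Y - (1 / real k ^ 2) *\<^sub>R (Y ** Y) + (1 / real k ^ 4) *\<^sub>R (Y ** Y ** Y) - (1 / real k ^ 3) *\<^sub>R mat 1)
     < a q \<bullet> Y - 1 / real k ^ 4"
    by (rule perturbed_trace_eventually[OF coeff])
  have inv: "(\<lambda>k. 1 / real k) \<longlonglongrightarrow> 0" by (rule lim_1_over_n)
  have "(\<lambda>k. 2 * C * (1 / real k)^2) \<longlonglongrightarrow> 2 * C * 0^2" by (intro tendsto_intros inv)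
  then have ev2: "\<forall>\<^sub>F k in sequentially. 2 * C * (1 / real k)^2 < d^2"
    by (rule order_tendstoD(2)) (use d in simp)
  have "(\<lambda>k. R^2 / 2 * (1 / real k)^3) \<longlonglongrightarrow> R^2 / 2 * 0^3" by (intro tendsto_intros inv)
  then have ev3: "\<forall>\<^sub>F k in sequentially. R^2 / 2 * (1 / real k)^3 < e"
    by (rule order_tendstoD(2)) (use e in simp)
  obtain k where k1: "k \<ge> 1" and key: "\<And>q Y x. (q, Y) \<in> J \<Longrightarrow> norm x \<le> R \<Longrightarrow>
     a (q - (1 / real k ^ 3) *\<^sub>R x) \<bullet>
       (Y - (1 / real k ^ 2) *\<^sub>R (Y ** Y) + (1 / real k ^ 4) *\<^sub>R (Y ** Y ** Y) - (1 / real k ^ 3) *\<^sub>R mat 1)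
     < a q \<bullet> Y - 1 / real k ^ 4"
    and k2: "2 * C * (1 / real k)^2 < d^2" and k3: "R^2 / 2 * (1 / real k)^3 < e"
    using eventually_happens[OF eventually_conj[OF ev1 eventually_conj[OF ev2 eventually_conj[OF ev3 eventually_ge_at_top[of 1]]]]]
    by auto
  define c where "c = real k ^ 2"
  define \<tau> where "\<tau> = 1 / real k ^ 3"
  define \<eta> where "\<eta> = 1 / real k ^ 4"
  have pos: "c > 0" "\<tau> > 0" "\<eta> > 0" using k1 by (auto simp: c_def \<tau>_def \<eta>_def)
  define X where "X = closure \<Omega> \<times> closure \<Omega>"
  define f where "f p t = u (fst p) t - lam * t - w (snd p) - c / 2 * ((fst p - snd p) \<bullet> (fst p - snd p))
     + \<tau> / 2 * (fst p \<bullet> fst p)" for p t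
  have X: "compact X" unfolding X_def by (intro compact_Times compact_closure_dom)
  have cont: "continuous_on (X \<times> {0..}) (\<lambda>(p, t). f p t)"
  proof -
    have "continuous_on (X \<times> {0..}) (\<lambda>z. (case (fst (fst z), snd z) of (x, t) \<Rightarrow> u x t))"
      by (rule continuous_on_compose2[OF u_cont]) (auto simp: X_def intro!: continuous_intros)
    then have "continuous_on (X \<times> {0..}) (\<lambda>z. u (fst (fst z)) (snd z))" by simp
    moreover have "continuous_on (X \<times> {0..}) (\<lambda>z. w (snd (fst z)))"
      by (rule continuous_on_compose2[OF w_cont]) (auto simp: X_def intro!: continuous_intros)
    ultimately have "continuous_on (X \<times> {0..}) (\<lambda>z. f (fst z) (snd z))"
      unfolding f_def by (intro continuous_intros)
    then show ?thesis by (simp add: case_prod_beta)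
  qed
  have der: "\<exists>D\<le>-\<eta>. (f p has_real_derivative D) (at t within {0..})"
    if pX: "p \<in> X" and t: "0 < t" and big: "3 * e < f p t" and mx: "\<And>p'. p' \<in> X \<Longrightarrow> f p' t \<le> f p t" for p t
  proof -
    obtain x y where p: "p = (x, y)" by (cases p)
    have xc: "x \<in> closure \<Omega>" and yc: "y \<in> closure \<Omega>" using pX by (auto simp: p X_def)
    have "x \<bullet> x \<le> R^2" using R(1)[OF xc] by (simp add: power2_norm_eq_inner[symmetric] power_mono)
    then have "\<tau> / 2 * (x \<bullet> x) \<le> \<tau> / 2 * R^2" using pos by (intro mult_left_mono) auto
    also have "\<dots> < e" using k3 by (simp add: \<tau>_def power_one_over mult.commute)
    finally have tx: "\<tau> / 2 * (x \<bullet> x) < e" .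
    have big': "3 * e < u x t - lam * t - w y - c / 2 * ((x - y) \<bullet> (x - y)) + \<tau> / 2 * (x \<bullet> x)"
      using big unfolding f_def p by simp
    have "u x t - lam * t \<le> S" "- w y \<le> S'" using S[OF xc, of t] S'[OF yc] t by auto
    then have "c / 2 * ((x - y) \<bullet> (x - y)) < C"
      using big' tx e unfolding C_def by linarith
    then have "(x - y) \<bullet> (x - y) < 2 * C * (1 / real k)^2"
      using k1 by (simp add: c_def field_simps)
    then have "(norm (x - y))^2 < d^2" using k2 by (simp add: power2_norm_eq_inner)
    then have nd: "dist x y < d" using d by (simp add: dist_norm power_less_imp_less_base)
    have "c / 2 * ((x - y) \<bullet> (x - y)) \<ge> 0" using pos by simp
    then have "u x t - lam * t - w y + e > 3 * e" using big' tx by linarith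
    moreover have "\<bar>w x - w y\<bar> < e" using d2(2)[OF xc yc] nd by (simp add: d_def)
    ultimately have "\<not> u x t - lam * t \<le> w x + e" by linarith
    then have xK: "x \<in> K" using col[of x t] xc t by auto
    have yK: "y \<in> K'" using xK nd unfolding K'_def d_def by (intro UN_I[of x]) auto
    have x: "x \<in> \<Omega>" and y: "y \<in> \<Omega>" using xK yK K K' by auto
    define Y where "Y = matrix (w2 y)"
    have mx': "u x' t - w y' - c / 2 * ((x' - y') \<bullet> (x' - y')) + \<tau> / 2 * (x' \<bullet> x')
       \<le> u x t - w y - c / 2 * ((x - y) \<bullet> (x - y)) + \<tau> / 2 * (x \<bullet> x)" if "x' \<in> \<Omega>" "y' \<in> \<Omega>" for x' y'
    proof -
      have "x' \<in> closure \<Omega>" "y' \<in> closure \<Omega>" using that closure_subset by blast+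
      then show ?thesis using mx[of "(x', y')"] by (simp add: f_def p X_def)
    qed
    have hd2: "u1 t x = w1 y - \<tau> *\<^sub>R x"
      by (rule hessian_doubling(1)[OF t x y pos(1)]) (rule mx')
    have hd3: "a (u1 t x) \<bullet> matrix (u2 t x)
         \<le> a (u1 t x) \<bullet> (Y - (1 / c) *\<^sub>R (Y ** Y) + (1 / c\<^sup>2) *\<^sub>R (Y ** Y ** Y) - \<tau> *\<^sub>R mat 1)"
      unfolding Y_def by (rule hessian_doubling(2)[OF t x y pos(1)]) (rule mx')
    have "a (u1 t x) \<bullet> matrix (u2 t x)
         \<le> a (w1 y - \<tau> *\<^sub>R x) \<bullet> (Y - (1 / c) *\<^sub>R (Y ** Y) + (1 / c\<^sup>2) *\<^sub>R (Y ** Y ** Y) - \<tau> *\<^sub>R mat 1)"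
      using hd3 unfolding hd2 .
    also have "c^2 = real k ^ 4" by (simp add: c_def flip: power_mult)
    also have "a (w1 y - \<tau> *\<^sub>R x) \<bullet> (Y - (1 / c) *\<^sub>R (Y ** Y) + (1 / real k ^ 4) *\<^sub>R (Y ** Y ** Y) - \<tau> *\<^sub>R mat 1)
       < a (w1 y) \<bullet> Y - \<eta>"
      unfolding c_def \<tau>_def \<eta>_def using yK by (intro key R(1) xc) (auto simp: J_def Y_def)
    also have "a (w1 y) \<bullet> Y = lam" unfolding Y_def by (rule w_eq[OF y])
    finally have "a (u1 t x) \<bullet> matrix (u2 t x) - lam \<le> - \<eta>" by simp
    moreover have "(f p has_real_derivative (a (u1 t x) \<bullet> matrix (u2 t x) - lam)) (at t within {0..})"
      unfolding f_def p using u_eq[OF x t] by (auto intro!: derivative_eq_intros)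
    ultimately show ?thesis by blast
  qed
  have "continuous_on X (\<lambda>p. f p 0)"
    by (rule continuous_on_compose2[OF cont, of _ "\<lambda>p. (p, 0)", simplified]) (auto intro!: continuous_intros)
  then obtain m where m: "\<And>p. p \<in> X \<Longrightarrow> f p 0 \<le> m" using compact_bdd_above[OF X] by blast
  \<comment> \<open>Any positive rate below \<open>\<eta>\<close> will do.\<close>
  define \<kappa> where "\<kappa> = \<eta> / 2"
  have \<kappa>: "0 < \<kappa>" "\<kappa> < \<eta>" using pos by (auto simp: \<kappa>_def)
  have "u x T - lam * T - w x \<le> 3 * e" if x: "x \<in> \<Omega>" and T: "T \<ge> max 0 ((m - 3 * e) / \<kappa>)" for x T
  proof -
    have xX: "(x, x) \<in> X" using x closure_subset by (auto simp: X_def)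
    have T0: "0 \<le> T" using T by simp
    have mT: "m - 3 * e \<le> \<kappa> * T" using T \<kappa> by (simp add: pos_divide_le_eq mult.commute)
    have "0 \<le> \<kappa> * T" using \<kappa> T0 by simp
    moreover have "f (x, x) T + \<kappa> * T \<le> max m (3 * e + max 0 (\<kappa> * T))"
      by (rule time_decay_of_max[OF X cont der \<kappa>(2) m xX T0])
    ultimately have "f (x, x) T \<le> 3 * e" using mT by simp
    moreover have "\<tau> / 2 * (x \<bullet> x) \<ge> 0" using pos by simp
    ultimately show ?thesis by (simp add: f_def)
  qed
  then show ?thesis
    unfolding eventually_at_top_linorder by blast
qed

end

section \<open>Homogeneous functions and their Hessians\<close>

lemma twice_diff_mult:
  assumes "twice_diff f f1 f2 S" "twice_diff g g1 g2 S"
  shows "twice_diff (\<lambda>x. f x * g x) (\<lambda>x. f x *\<^sub>R g1 x + g x *\<^sub>R f1 x)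
     (\<lambda>x h. f x *\<^sub>R g2 x h + (f1 x \<bullet> h) *\<^sub>R g1 x + (g x *\<^sub>R f2 x h + (g1 x \<bullet> h) *\<^sub>R f1 x)) S"
  unfolding twice_diff_def
proof (intro ballI conjI)
  fix x assume x: "x \<in> S"
  show "((\<lambda>x. f x * g x) has_derivative (\<lambda>h. (f x *\<^sub>R g1 x + g x *\<^sub>R f1 x) \<bullet> h)) (at x)"
    by (rule has_derivative_eq_rhs[OF has_derivative_mult[OF twice_diffD(1)[OF assms(1) x] twice_diffD(1)[OF assms(2) x]]])
       (simp add: inner_add_left mult.commute)
  show "((\<lambda>x. f x *\<^sub>R g1 x + g x *\<^sub>R f1 x) has_derivative
     (\<lambda>h. f x *\<^sub>R g2 x h + (f1 x \<bullet> h) *\<^sub>R g1 x + (g x *\<^sub>R f2 x h + (g1 x \<bullet> h) *\<^sub>R f1 x))) (at x)"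
    by (rule has_derivative_add[OF
          has_derivative_scaleR[OF twice_diffD(1)[OF assms(1) x] twice_diffD(2)[OF assms(2) x]]
          has_derivative_scaleR[OF twice_diffD(1)[OF assms(2) x] twice_diffD(2)[OF assms(1) x]]])
qed

lemma has_derivative_inverse_norm:
  fixes x :: "'a::real_inner"
  assumes "x \<noteq> 0"
  shows "((\<lambda>x. inverse (norm x)) has_derivative (\<lambda>h. (- (inverse (norm x) ^ 3) *\<^sub>R x) \<bullet> h)) (at x)"
proof -
  have nx: "norm x \<noteq> 0" using assms by simp
  have "((\<lambda>x. inverse (norm x)) has_derivative (\<lambda>h. - (inverse (norm x) * (h \<bullet> sgn x) * inverse (norm x)))) (at x)"
    by (rule Deriv.has_derivative_inverse[OF nx has_derivative_norm[OF assms]])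
  then show ?thesis
    by (rule has_derivative_eq_rhs) (simp add: sgn_div_norm power3_eq_cube divide_inverse fun_eq_iff inner_commute)
qed

lemma twice_diff_inverse_norm:
  "twice_diff (\<lambda>x::'a::real_inner. inverse (norm x)) (\<lambda>x. - (inverse (norm x) ^ 3) *\<^sub>R x)
     (\<lambda>x h. - (inverse (norm x) ^ 3) *\<^sub>R h + (3 * inverse (norm x) ^ 5 * (x \<bullet> h)) *\<^sub>R x) (- {0})"
  unfolding twice_diff_def
proof (intro ballI conjI)
  fix x :: 'a assume "x \<in> - {0}"
  then have x: "x \<noteq> 0" by simp
  show "((\<lambda>x. inverse (norm x)) has_derivative (\<lambda>h. (- (inverse (norm x) ^ 3) *\<^sub>R x) \<bullet> h)) (at x)"
    by (rule has_derivative_inverse_norm[OF x])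
  have 1: "((\<lambda>x. - (inverse (norm x) ^ 3)) has_derivative
      (\<lambda>h. - (of_nat 3 * ((- (inverse (norm x) ^ 3) *\<^sub>R x) \<bullet> h) * inverse (norm x) ^ (3 - 1)))) (at x)"
    by (rule has_derivative_minus[OF has_derivative_power[OF has_derivative_inverse_norm[OF x]]])
  show "((\<lambda>x. - (inverse (norm x) ^ 3) *\<^sub>R x) has_derivative
      (\<lambda>h. - (inverse (norm x) ^ 3) *\<^sub>R h + (3 * inverse (norm x) ^ 5 * (x \<bullet> h)) *\<^sub>R x)) (at x)"
    by (rule has_derivative_eq_rhs[OF has_derivative_scaleR[OF 1 has_derivative_ident]])
       (simp add: fun_eq_iff power3_eq_cube power2_eq_square eval_nat_numeral)
qed

text \<open>For opposite increments the second difference is \<open>2 f x - f (x + s h) - f (x - s h) \<le> 0\<close>.\<close>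

lemma convex_hessian_nonneg:
  assumes td: "twice_diff f f1 f2 S" "open S" "x \<in> S" and cv: "convex_on UNIV f"
  shows "0 \<le> f2 x h \<bullet> h"
proof -
  have "f2 x h \<bullet> (- h) \<le> 0"
  proof (rule tendsto_upperbound[OF second_difference_limit[OF td, of h "- h"]])
    have "(f (x + s *\<^sub>R h + s *\<^sub>R - h) - f (x + s *\<^sub>R h) - f (x + s *\<^sub>R - h) + f x) / s\<^sup>2 \<le> 0" for s
    proof -
      have "f ((1 - 1/2) *\<^sub>R (x + s *\<^sub>R h) + (1/2) *\<^sub>R (x - s *\<^sub>R h)) \<le> (1 - 1/2) * f (x + s *\<^sub>R h) + (1/2) * f (x - s *\<^sub>R h)"
        by (rule convex_onD[OF cv]) auto
      moreover have "(1 - 1/2) *\<^sub>R (x + s *\<^sub>R h) + (1/2) *\<^sub>R (x - s *\<^sub>R h) = (1/2) *\<^sub>R x + (1/2) *\<^sub>R x"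
        by (simp add: scaleR_add_right scaleR_diff_right)
      moreover have "(1/2) *\<^sub>R x + (1/2) *\<^sub>R x = x" by (simp flip: scaleR_add_left)
      ultimately show ?thesis by (intro divide_nonpos_nonneg) auto
    qed
    then show "\<forall>\<^sub>F s in at_right 0. (f (x + s *\<^sub>R h + s *\<^sub>R - h) - f (x + s *\<^sub>R h) - f (x + s *\<^sub>R - h) + f x) / s\<^sup>2 \<le> 0"
      by (intro always_eventually allI)
  qed simp
  then show ?thesis by simp
qed

lemma Ck_on_1_gradient:
  fixes f :: "'a::euclidean_space \<Rightarrow> real"
  assumes "Ck_on 1 f S"
  shows "\<exists>f1. (\<forall>x\<in>S. (f has_derivative (\<lambda>h. f1 x \<bullet> h)) (at x)) \<and> continuous_on S f1"
proof (intro exI conjI ballI)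
  show "(f has_derivative (\<lambda>h. (\<Sum>b\<in>Basis. dir_deriv b f x *\<^sub>R b) \<bullet> h)) (at x)" if "x \<in> S" for x
    using assms that by (intro differentiable_imp_has_gradient) auto
  show "continuous_on S (\<lambda>x. \<Sum>b\<in>Basis. dir_deriv b f x *\<^sub>R b)"
    using assms by (intro continuous_on_sum continuous_on_scaleR continuous_on_const) auto
qed

lemma frobenius_eq_norm: "frobenius A = norm A"
proof -
  have "trace (transpose A ** A) = A \<bullet> A"
    by (simp add: trace_def transpose_def matrix_matrix_mult_def matrix_inner_sum) (rule sum.swap)
  then show ?thesis by (simp add: frobenius_def norm_eq_sqrt_inner)
qed

text \<open>Cauchy-Schwarz for the matrix inner product with \<open>v v\<^sup>T\<close>, which has norm \<open>1\<close>.\<close>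

lemma quadratic_form_le_frobenius:
  assumes "norm v = 1"
  shows "\<bar>v \<bullet> (A *v v)\<bar> \<le> frobenius A"
proof -
  define P where "P = (\<chi> i j. v $ i * v $ j)"
  have vv: "v \<bullet> v = 1" using assms by (simp add: norm_eq_1)
  have "P *v v = (v \<bullet> v) *\<^sub>R v"
    by (simp add: vec_eq_iff P_def matrix_vector_mult_def inner_vec_def sum_distrib_left sum_distrib_right mult_ac)
  then have "P \<bullet> P = 1" unfolding P_def[symmetric] using outer_inner[of v v P] vv by (simp add: P_def)
  then have "norm P = 1" by (simp add: norm_eq_1)
  moreover have "P \<bullet> A = v \<bullet> (A *v v)" unfolding P_def by (rule outer_inner)
  ultimately show ?thesis using Cauchy_Schwarz_ineq2[of P A] by (simp add: frobenius_eq_norm)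
qed

text \<open>Euler's relations: the gradient of a function of degree one has degree zero, so the Hessian has degree
  \<open>-1\<close> and annihilates the radial direction.\<close>

context
  fixes F :: "'a::real_inner \<Rightarrow> real" and F1 F2
  assumes td: "twice_diff F F1 F2 (- {0})" and hom: "\<And>c p. 0 < c \<Longrightarrow> F (c *\<^sub>R p) = c * F p"
begin

lemma homogeneous_gradient:
  assumes "p \<noteq> 0" "0 < c"
  shows "F1 (c *\<^sub>R p) = F1 p"
proof -
  have 1: "((\<lambda>p. F (c *\<^sub>R p)) has_derivative (\<lambda>h. F1 (c *\<^sub>R p) \<bullet> (c *\<^sub>R h))) (at p)"
    by (rule has_derivative_compose[where g=F and f="\<lambda>p. c *\<^sub>R p"])
       (use assms td in \<open>auto simp: twice_diff_def intro!: has_derivative_scaleR_right has_derivative_ident\<close>)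
  have 2: "((\<lambda>p. F (c *\<^sub>R p)) has_derivative (\<lambda>h. c * (F1 p \<bullet> h))) (at p)"
    unfolding hom[OF assms(2)] using assms td
    by (intro has_derivative_mult_right) (auto simp: twice_diff_def)
  have "F1 (c *\<^sub>R p) \<bullet> h = F1 p \<bullet> h" for h
    using has_derivative_unique[OF 1 2] assms by (auto simp: fun_eq_iff)
  then show ?thesis by (metis vector_eq_ldot inner_commute)
qed

lemma homogeneous_hessian:
  assumes "p \<noteq> 0" "0 < c"
  shows "F2 (c *\<^sub>R p) h = (1 / c) *\<^sub>R F2 p h"
proof -
  have cp: "c *\<^sub>R p \<noteq> 0" using assms by simp
  have d: "(F1 has_derivative F2 q) (at q)" if "q \<noteq> 0" for q using td that by (simp add: twice_diff_def)
  have 1: "((\<lambda>p. F1 (c *\<^sub>R p)) has_derivative (\<lambda>h. F2 (c *\<^sub>R p) (c *\<^sub>R h))) (at p)"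
    by (rule has_derivative_compose[where g=F1 and f="\<lambda>p. c *\<^sub>R p", OF has_derivative_scaleR_right[OF has_derivative_ident] d[OF cp]])
  have "((\<lambda>p. F1 (c *\<^sub>R p)) has_derivative F2 p) (at p)"
    by (rule has_derivative_transform_within_open[OF d[OF assms(1)], of "- {0}"])
       (use assms homogeneous_gradient in auto)
  from has_derivative_unique[OF 1 this] have "F2 (c *\<^sub>R p) (c *\<^sub>R h) = F2 p h" by metis
  moreover have "F2 (c *\<^sub>R p) (c *\<^sub>R h) = c *\<^sub>R F2 (c *\<^sub>R p) h"
    using has_derivative_linear[OF d[OF cp]] by (simp add: linear_scale)
  ultimately have "F2 p h = c *\<^sub>R F2 (c *\<^sub>R p) h" by simp
  then show ?thesis using assms by simp
qed

lemma homogeneous_hessian_radial: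
  assumes "p \<noteq> 0"
  shows "F2 p p = 0"
proof -
  have d: "(F1 has_derivative F2 p) (at p)" using td assms by (simp add: twice_diff_def)
  have "((\<lambda>s. F1 (s *\<^sub>R p)) has_derivative (\<lambda>t. F2 p (t *\<^sub>R p))) (at (1::real))"
    by (rule has_derivative_compose[where g=F1 and f="\<lambda>s. s *\<^sub>R p", OF has_derivative_scaleR_left[OF has_derivative_ident]])
       (use d in simp)
  moreover have "((\<lambda>s. F1 (s *\<^sub>R p)) has_derivative (\<lambda>t. 0)) (at (1::real))"
    by (rule has_derivative_transform_within_open[OF has_derivative_const[of "F1 p"], where s="{0<..}"])
       (use assms homogeneous_gradient in auto)
  ultimately have "(\<lambda>t. F2 p (t *\<^sub>R p)) = (\<lambda>t::real. 0)" by (rule has_derivative_unique)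
  from fun_cong[OF this, of 1] show ?thesis by simp
qed

end

lemma twice_diff_cong:
  assumes "twice_diff f f1 f2 S" "open S" "\<And>x. x \<in> S \<Longrightarrow> g x = f x"
  shows "twice_diff g f1 f2 S"
  unfolding twice_diff_def
proof (intro ballI conjI)
  fix x assume x: "x \<in> S"
  show "(g has_derivative (\<lambda>h. f1 x \<bullet> h)) (at x)"
    by (rule has_derivative_transform_within_open[OF twice_diffD(1)[OF assms(1) x] assms(2) x])
       (simp add: assms(3))
  show "(f1 has_derivative f2 x) (at x)" by (rule twice_diffD(2)[OF assms(1) x])
qed

lemma hess_p_row:
  fixes f :: "(real^'n) \<times> real \<Rightarrow> real"
  assumes "twice_diff f f1 f2 S" "open S" "p \<in> S"
  shows "hess_p f p $ i = fst (f2 p (axis i 1, 0))"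
  by (simp add: vec_eq_iff hess_p_def twice_diff_dir_deriv2[OF assms] inner_prod_def inner_axis)

lemma hess_p_form:
  fixes f :: "(real^'n) \<times> real \<Rightarrow> real"
  assumes td: "twice_diff f f1 f2 S" "open S" "p \<in> S"
  shows "v \<bullet> (hess_p f p *v v') = f2 p (v, 0) \<bullet> (v', 0)"
proof -
  have lin: "linear (f2 p)" by (rule has_derivative_linear[OF twice_diffD(2)[OF td(1,3)]])
  have "(\<Sum>i\<in>UNIV. v $ i *\<^sub>R axis i 1) = v"
    using basis_expansion[of v] by (simp only: scalar_mult_eq_scaleR)
  then have "(v, 0) = (\<Sum>i\<in>UNIV. v $ i *\<^sub>R (axis i 1 :: real^'n, 0 :: real))"
    by (simp add: prod_eq_iff fst_sum snd_sum)
  then have "f2 p (v, 0) = f2 p (\<Sum>i\<in>UNIV. v $ i *\<^sub>R (axis i 1 :: real^'n, 0 :: real))"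
    by (rule arg_cong)
  also have "\<dots> = (\<Sum>i\<in>UNIV. v $ i *\<^sub>R f2 p (axis i 1, 0))"
    by (simp only: linear_sum[OF lin] linear_scale[OF lin])
  finally have exp: "f2 p (v, 0) = (\<Sum>i\<in>UNIV. v $ i *\<^sub>R f2 p (axis i 1, 0))" .
  have "f2 p (v, 0) \<bullet> (v', 0) = (\<Sum>i\<in>UNIV. v $ i * (fst (f2 p (axis i 1, 0)) \<bullet> v'))"
    by (simp add: exp inner_sum_left inner_prod_def fst_sum)
  also have "\<dots> = v \<bullet> (hess_p f p *v v')"
    by (simp add: inner_vec_def[of v] matrix_vector_row hess_p_row[OF td])
  finally show ?thesis by simp
qed

lemma hess_p_symmetric:
  fixes f :: "(real^'n) \<times> real \<Rightarrow> real"
  assumes td: "twice_diff f f1 f2 S" "open S" "p \<in> S"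
  shows "transpose (hess_p f p) = hess_p f p"
proof -
  have "hess_p f p $ i $ j = f2 p (axis i 1, 0) \<bullet> (axis j 1, 0)" for i j
    by (simp add: hess_p_def twice_diff_dir_deriv2[OF td])
  then show ?thesis
    using twice_diff_symmetric[OF td] by (simp add: vec_eq_iff transpose_def)
qed

section \<open>The coefficient matrix of an anisotropic flow\<close>

lemma open_punctured: "open (- {0 :: 'a::real_normed_vector})"
  by (simp add: open_Compl)

text \<open>The coefficient matrix as a function on all of \<open>\<real>\<^sup>n \<times> \<real>\<close>, of which the flow uses only the slice
  \<open>(q, -1)\<close>.  It is homogeneous of degree zero, so its values at \<open>(q, 0)\<close> are the limits for steep gradients.\<close>

definition flow_coeff ::
  "((real^'n) \<times> real \<Rightarrow> real) \<Rightarrow> ((real^'n) \<times> real \<Rightarrow> real) \<Rightarrow> (real^'n) \<times> real \<Rightarrow> real^'n^'n" where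
  "flow_coeff F G p = G p *\<^sub>R hess_p F p"

lemma aniso_op_flow_coeff:
  "aniso_op F G w x = flow_coeff F G (grad w x, -1) \<bullet> (\<chi> i j. pd i (pd j w) x)"
  by (simp add: aniso_op_def flow_coeff_def matrix_inner_sum sum_distrib_left mult.assoc)

text \<open>The parameters \<open>F1\<close> and \<open>F2\<close> only name the gradient and the Hessian of \<open>F\<close>.\<close>

locale surface_energy =
  fixes F G :: "(real^'n) \<times> real \<Rightarrow> real" and g0 G0 m0 M0 m2 :: real
    and F1 :: "(real^'n) \<times> real \<Rightarrow> (real^'n) \<times> real"
    and F2 :: "(real^'n) \<times> real \<Rightarrow> (real^'n) \<times> real \<Rightarrow> (real^'n) \<times> real"
  assumes dim: "2 \<le> CARD('n)"
    and F_aniso: "anisotropic F" and G_aniso: "anisotropic G" and F_convex: "convex_on UNIV F"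
    and g0_pos: "0 < g0" and m2_less: "m2 < m0"
    and G_bounds: "\<And>p. p \<noteq> 0 \<Longrightarrow> g0 \<le> radial_ext G p \<and> radial_ext G p \<le> G0"
    and F_bounds: "\<And>p. p \<noteq> 0 \<Longrightarrow> m0 \<le> radial_ext F p \<and> radial_ext F p \<le> M0"
    and F_hess_bound: "\<And>p. p \<noteq> 0 \<Longrightarrow> frobenius (hess_p (radial_ext F) p) < m2 / (norm p)\<^sup>2"
    and F_diff: "twice_diff F F1 F2 (- {0})"
    and F_hess_cont: "\<And>v. continuous_on (- {0}) (\<lambda>p. F2 p v)"
begin

abbreviation coeff :: "(real^'n) \<times> real \<Rightarrow> real^'n^'n" where
  "coeff \<equiv> flow_coeff F G"

lemma F_hom: "0 < c \<Longrightarrow> F (c *\<^sub>R p) = c * F p" and G_hom: "0 < c \<Longrightarrow> G (c *\<^sub>R p) = c * G p"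
  using F_aniso G_aniso unfolding anisotropic_def by blast+

lemma hess_form: "p \<noteq> 0 \<Longrightarrow> v \<bullet> (hess_p F p *v v') = F2 p (v, 0) \<bullet> (v', 0)"
  by (rule hess_p_form[OF F_diff open_punctured]) simp

lemma radial_ext_eq: "p \<noteq> 0 \<Longrightarrow> radial_ext F p = F p * inverse (norm p)"
  "p \<noteq> 0 \<Longrightarrow> radial_ext G p = G p * inverse (norm p)"
  by (simp_all add: radial_ext_def F_hom G_hom divide_inverse mult.commute)

lemma G_pos: "p \<noteq> 0 \<Longrightarrow> 0 < G p"
  using G_bounds[of p] g0_pos by (simp add: radial_ext_eq zero_less_mult_iff)
    (smt (verit) inverse_nonpositive_iff_nonpositive mult_nonpos_nonneg norm_le_zero_iff)

lemma coeff_psd: 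
  assumes "p \<noteq> 0"
  shows "psd (coeff p)"
proof -
  have p: "p \<in> - {0}" using assms by simp
  have "transpose (coeff p) = coeff p"
    using hess_p_symmetric[OF F_diff open_punctured p] by (simp add: flow_coeff_def transpose_def vec_eq_iff)
  moreover have "0 \<le> v \<bullet> (coeff p *v v)" for v
    using convex_hessian_nonneg[OF F_diff open_punctured p F_convex, of "(v, 0)"] hess_form[OF assms, of v v] G_pos[OF assms]
    by (simp add: flow_coeff_def scaleR_matrix_vector_assoc[symmetric])
  ultimately show ?thesis by (simp add: psd_def)
qed

text \<open>Write \<open>F = |p| f\<close> with \<open>f\<close> homogeneous of degree zero.  In a direction \<open>v\<close> orthogonal to \<open>p\<close> the derivative of
  \<open>|p|\<close> vanishes and its second derivative is \<open>1 / |p|\<close>, so the mixed terms drop out and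
  \<open>|p| D\<^sup>2F(v, v) = f + |p|\<^sup>2 D\<^sup>2f(v, v)\<close>, where the last term is smaller than \<open>m2\<close> in absolute value.\<close>

lemma tangential_hessian_bounds:
  assumes p: "p \<noteq> 0" and v: "norm v = 1" "v \<bullet> fst p = 0"
  shows "m0 - m2 \<le> norm p * (v \<bullet> (hess_p F p *v v))" "norm p * (v \<bullet> (hess_p F p *v v)) \<le> M0 + m2"
proof -
  define i where "i = inverse (norm p)"
  have np: "norm p > 0" and i: "i > 0" "norm p * i = 1" using p by (auto simp: i_def)
  have "p \<in> - {0}" using p by simp
  note td = twice_diff_cong[OF twice_diff_mult[OF F_diff twice_diff_inverse_norm] open_punctured, of "radial_ext F"]
  have pv: "p \<bullet> (v, 0) = 0" "(v, 0) \<bullet> p = 0" using v by (auto simp: inner_prod_def inner_commute)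
  have "v \<bullet> (hess_p (radial_ext F) p *v v) = - (F p * i ^ 3) + i * (F2 p (v, 0) \<bullet> (v, 0))"
    by (subst hess_p_form[OF td open_punctured \<open>p \<in> - {0}\<close>])
       (simp_all add: radial_ext_eq inner_add_left inner_diff_left pv v(1)[unfolded norm_eq_1] i_def[symmetric])
  then have eq: "v \<bullet> (hess_p (radial_ext F) p *v v) = i * (v \<bullet> (hess_p F p *v v)) - F p * i ^ 3"
    by (simp add: hess_form[OF p])
  have "\<bar>v \<bullet> (hess_p (radial_ext F) p *v v)\<bar> < m2 / (norm p)\<^sup>2"
    using quadratic_form_le_frobenius[OF v(1), of "hess_p (radial_ext F) p"] F_hess_bound[OF p] by linarith
  then have "\<bar>v \<bullet> (hess_p (radial_ext F) p *v v)\<bar> * (norm p)\<^sup>2 < m2"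
    using np by (simp add: pos_less_divide_eq)
  moreover have "\<bar>v \<bullet> (hess_p (radial_ext F) p *v v)\<bar> * (norm p)\<^sup>2
      = \<bar>(i * (v \<bullet> (hess_p F p *v v)) - F p * i ^ 3) * (norm p)\<^sup>2\<bar>"
    by (simp add: eq abs_mult)
  moreover have "(i * (v \<bullet> (hess_p F p *v v)) - F p * i ^ 3) * (norm p)\<^sup>2
      = norm p * (v \<bullet> (hess_p F p *v v)) * (norm p * i) - F p * i * (norm p * i)^2"
    by (simp add: algebra_simps power2_eq_square power3_eq_cube)
  ultimately have "\<bar>norm p * (v \<bullet> (hess_p F p *v v)) - F p * i\<bar> < m2" by (simp add: i(2))
  moreover have "m0 \<le> F p * i" "F p * i \<le> M0" using F_bounds[OF p] by (simp_all add: radial_ext_eq[OF p] i_def)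
  ultimately show "m0 - m2 \<le> norm p * (v \<bullet> (hess_p F p *v v))" "norm p * (v \<bullet> (hess_p F p *v v)) \<le> M0 + m2"
    by linarith+
qed

lemma tangential_coeff_bounds:
  assumes p: "p \<noteq> 0" and v: "norm v = 1" "v \<bullet> fst p = 0"
  shows "g0 * (m0 - m2) \<le> v \<bullet> (coeff p *v v)" "v \<bullet> (coeff p *v v) \<le> G0 * (M0 + m2)"
proof -
  have "G p = radial_ext G p * norm p" using p by (simp add: radial_ext_eq)
  then have eq: "v \<bullet> (coeff p *v v) = radial_ext G p * (norm p * (v \<bullet> (hess_p F p *v v)))"
    by (simp add: flow_coeff_def scaleR_matrix_vector_assoc[symmetric])
  note b = tangential_hessian_bounds[OF p v]
  note G = G_bounds[OF p]
  show "g0 * (m0 - m2) \<le> v \<bullet> (coeff p *v v)"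
    unfolding eq using b G g0_pos m2_less by (intro mult_mono) auto
  show "v \<bullet> (coeff p *v v) \<le> G0 * (M0 + m2)"
    unfolding eq using b G g0_pos m2_less by (intro mult_mono) auto
qed

lemma coeff_scale:
  assumes "p \<noteq> 0" "0 < c"
  shows "coeff (c *\<^sub>R p) = coeff p"
proof -
  have "hess_p F (c *\<^sub>R p) $ i = (1 / c) *\<^sub>R hess_p F p $ i" for i
    using assms homogeneous_hessian[OF F_diff F_hom assms]
    by (simp add: hess_p_row[OF F_diff open_punctured])
  then show ?thesis using assms by (simp add: flow_coeff_def vec_eq_iff G_hom)
qed

lemma coeff_radial_null:
  assumes "q \<noteq> 0"
  shows "coeff (q, 0) *v q = 0"
proof -
  have p: "(q, 0::real) \<noteq> 0" using assms by (simp add: zero_prod_def)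
  have "v \<bullet> (hess_p F (q, 0) *v q) = 0" for v
    using hess_form[OF p, of v q] twice_diff_symmetric[OF F_diff open_punctured, of "(q, 0)" "(v, 0)" "(q, 0)"]
      homogeneous_hessian_radial[OF F_diff F_hom p] p by simp
  then have "hess_p F (q, 0) *v q = 0" by (metis inner_eq_zero_iff)
  then show ?thesis by (simp add: flow_coeff_def scaleR_matrix_vector_assoc[symmetric])
qed

text \<open>As \<open>n \<ge> 2\<close>, there is a unit vector orthogonal to the first component of \<open>p\<close>; in its direction the coefficient is
  bounded below, and the trace of a positive semidefinite matrix is at least its form at any unit vector.\<close>

lemma coeff_trace_pos:
  assumes p: "p \<noteq> 0"
  shows "0 < coeff p \<bullet> mat 1"
proof -
  have "2 \<le> DIM(real^'n)" using dim by simp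
  then obtain y where y: "y \<noteq> 0" "orthogonal (fst p) y" by (rule orthogonal_to_vector_exists)
  define v where "v = (1 / norm y) *\<^sub>R y"
  have v: "norm v = 1" "v \<bullet> fst p = 0"
    using y by (auto simp: v_def orthogonal_def inner_commute)
  define P where "P = (\<chi> i j. v $ i * v $ j)"
  have Pv: "P *v x = (v \<bullet> x) *\<^sub>R v" for x
    by (simp add: vec_eq_iff P_def matrix_vector_mult_def inner_vec_def sum_distrib_left sum_distrib_right mult_ac)
  have "coeff p \<bullet> P \<le> coeff p \<bullet> mat 1"
  proof (rule psd_inner_mono[OF coeff_psd[OF p]])
    fix x
    have "\<bar>v \<bullet> x\<bar> \<le> norm x" using Cauchy_Schwarz_ineq2[of v x] v by simp
    then have "(v \<bullet> x)^2 \<le> (norm x)^2" using power_mono[of "\<bar>v \<bullet> x\<bar>" "norm x" 2] by simp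
    moreover have "x \<bullet> (P *v x) = (v \<bullet> x)^2" by (simp add: Pv inner_commute[of x v] power2_eq_square)
    moreover have "x \<bullet> (mat 1 *v x) = (norm x)^2" by (simp add: power2_norm_eq_inner)
    ultimately show "x \<bullet> (P *v x) \<le> x \<bullet> (mat 1 *v x)" by simp
  qed
  moreover have "coeff p \<bullet> P = v \<bullet> (coeff p *v v)" unfolding P_def by (subst inner_commute) (rule outer_inner)
  moreover have "0 < g0 * (m0 - m2)" using g0_pos m2_less by simp
  ultimately show ?thesis using tangential_coeff_bounds(1)[OF p v] by linarith
qed

lemma coeff_continuous: "continuous_on (- {0}) coeff"
proof -
  have "Ck_on 0 G (- {0})" using G_aniso unfolding anisotropic_def by blast
  then have G: "continuous_on (- {0}) G" by simp
  have c: "continuous_on (- {0}) (\<lambda>p. G p *\<^sub>R (\<chi> i j. fst (F2 p (axis i 1, 0)) $ j))"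
    by (intro continuous_on_scaleR G continuous_on_vec_lambda continuous_on_component continuous_on_fst F_hess_cont)
  have "G p *\<^sub>R (\<chi> i j. fst (F2 p (axis i 1, 0)) $ j) = coeff p" if "p \<in> - {0}" for p
    unfolding flow_coeff_def using hess_p_row[OF F_diff open_punctured that] by (simp add: vec_eq_iff)
  with c show ?thesis by (rule continuous_on_eq)
qed

text \<open>The entries on the slice are products of \<open>G\<close> and second derivatives of \<open>F\<close>, composed with \<open>q \<mapsto> (q, -1)\<close>,
  which avoids the origin.\<close>

lemma coeff_elliptic: "elliptic_coeff (\<lambda>q. coeff (q, -1))"
proof -
  have nz: "(q, -1::real) \<noteq> 0" for q :: "real^'n" by (simp add: zero_prod_def)
  have "Ck_on 1 G (- {0})" using G_aniso unfolding anisotropic_def by blast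
  then obtain H where H: "\<And>p. p \<in> - {0} \<Longrightarrow> (G has_derivative (\<lambda>h. H p \<bullet> h)) (at p)" "continuous_on (- {0}) H"
    using Ck_on_1_gradient by blast
  have basis: "(axis i 1 :: real^'n, 0 :: real) \<in> Basis" for i
    by (simp add: Basis_prod_def axis_in_Basis_iff)
  have "Ck_on 3 F (- {0})" using F_aniso unfolding anisotropic_def by blast
  then have "Ck_on 1 (dp i (dp j F)) (- {0})" for i j
    using basis by (simp add: eval_nat_numeral)
  then have "\<forall>i j. \<exists>K. (\<forall>p\<in>- {0}. (dp i (dp j F) has_derivative (\<lambda>h. K p \<bullet> h)) (at p)) \<and> continuous_on (- {0}) K"
    using Ck_on_1_gradient by blast
  then obtain K where K: "\<And>i j p. p \<in> - {0} \<Longrightarrow> (dp i (dp j F) has_derivative (\<lambda>h. K i j p \<bullet> h)) (at p)"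
      "\<And>i j. continuous_on (- {0}) (K i j)"
    by metis
  define a' where "a' i j q = G (q, -1) *\<^sub>R fst (K i j (q, -1)) + dp i (dp j F) (q, -1) *\<^sub>R fst (H (q, -1))" for i j q
  have sec: "continuous_on UNIV (\<lambda>q. f (q, -1))" if "continuous_on (- {0}) f" for f :: "(real^'n) \<times> real \<Rightarrow> 'c::topological_space"
    by (rule continuous_on_compose2[OF that, where f="\<lambda>q. (q, -1)"])
       (use nz in \<open>auto intro: continuous_on_Pair continuous_on_id continuous_on_const\<close>)
  have pc: "continuous_on (- {0}) f" if "\<And>p. p \<in> - {0} \<Longrightarrow> (f has_derivative D p) (at p)" for f :: "(real^'n) \<times> real \<Rightarrow> real" and D
    by (rule continuous_at_imp_continuous_on) (use that has_derivative_continuous in blast)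
  have cont: "continuous_on UNIV (a' i j)" for i j
    unfolding a'_def
    by (intro continuous_on_add continuous_on_scaleR continuous_on_fst sec K(2) H(2) pc[OF H(1)] pc[OF K(1)])
  have der: "((\<lambda>q. coeff (q, -1) $ i $ j) has_derivative (\<lambda>h. a' i j q \<bullet> h)) (at q)" for i j q
  proof -
    have q: "(q, -1 :: real) \<in> - {0}" using nz by simp
    have sl: "((\<lambda>q. (q, -1)) has_derivative (\<lambda>h. (h, 0))) (at q)"
      by (rule has_derivative_Pair[OF has_derivative_ident has_derivative_const])
    show ?thesis
      unfolding flow_coeff_def hess_p_def
      by (simp, rule has_derivative_eq_rhs[OF has_derivative_mult[OF
            has_derivative_compose[OF sl H(1)[OF q]] has_derivative_compose[OF sl K(1)[OF q]]]])
         (simp add: a'_def inner_add_left inner_prod_def fun_eq_iff)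
  qed
  show ?thesis
    unfolding elliptic_coeff_def
    by (intro conjI allI exI[of _ a'] coeff_psd[OF nz] coeff_trace_pos[OF nz] cont der)
qed

end

section \<open>Defining functions and tangent vectors\<close>

text \<open>The data behind an inward normal, with the derivatives of the defining function made explicit.\<close>

definition defining_fun ::
  "(real^'n) set \<Rightarrow> real^'n \<Rightarrow> real \<Rightarrow> (real^'n \<Rightarrow> real) \<Rightarrow> (real^'n \<Rightarrow> real^'n) \<Rightarrow>
   (real^'n \<Rightarrow> real^'n \<Rightarrow> real^'n) \<Rightarrow> bool" where
  "defining_fun \<Omega> x r \<rho> \<rho>1 \<rho>2 \<longleftrightarrow>
     0 < r \<and> twice_diff \<rho> \<rho>1 \<rho>2 (ball x r) \<and> (\<forall>h. continuous_on (ball x r) (\<lambda>y. \<rho>2 y h)) \<and>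
     \<Omega> \<inter> ball x r = {y \<in> ball x r. 0 < \<rho> y} \<and> \<rho> x = 0 \<and> \<rho>1 x \<noteq> 0"

lemma inward_normal_defining_fun:
  assumes "inward_normal \<Omega> x v"
  shows "\<exists>r \<rho> \<rho>1 \<rho>2. defining_fun \<Omega> x r \<rho> \<rho>1 \<rho>2 \<and> v = (1 / norm (\<rho>1 x)) *\<^sub>R \<rho>1 x"
proof -
  obtain \<rho> r where r: "0 < r" "Ck_on 2 \<rho> (ball x r)" "\<Omega> \<inter> ball x r = {y \<in> ball x r. 0 < \<rho> y}"
    "\<rho> x = 0" "grad \<rho> x \<noteq> 0" "v = (1 / norm (grad \<rho> x)) *\<^sub>R grad \<rho> x"
    using assms unfolding inward_normal_def by blast
  obtain \<rho>1 \<rho>2 where td: "twice_diff \<rho> \<rho>1 \<rho>2 (ball x r)" "\<And>h. continuous_on (ball x r) (\<lambda>y. \<rho>2 y h)"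
    by (rule Ck_on_2_twice_diff[OF r(2)]) (rule that; assumption)
  have g: "grad \<rho> x = \<rho>1 x"
    using r(1) by (simp add: grad_def vec_eq_iff twice_diff_dir_deriv[OF td(1)] inner_axis)
  have "defining_fun \<Omega> x r \<rho> \<rho>1 \<rho>2"
    unfolding defining_fun_def g[symmetric] using r(1,3-5) td by (intro conjI allI)
  then show ?thesis using r(6) unfolding g by (intro exI conjI)
qed

lemma increases_along:
  fixes f :: "'a::real_inner \<Rightarrow> real"
  assumes "(f has_derivative (\<lambda>h. g \<bullet> h)) (at y)" "0 < g \<bullet> v"
  shows "\<exists>d>0. \<forall>t. 0 < t \<and> t < d \<longrightarrow> f y < f (y + t *\<^sub>R v)"
proof -
  have f: "(f has_derivative (\<lambda>h. g \<bullet> h)) (at (y + 0 *\<^sub>R v))" using assms(1) by simp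
  have l: "((\<lambda>t. y + t *\<^sub>R v) has_derivative (\<lambda>t. t *\<^sub>R v)) (at (0::real))"
    by (auto intro!: derivative_eq_intros)
  have "((\<lambda>t. f (y + t *\<^sub>R v)) has_real_derivative (g \<bullet> v)) (at 0)"
    unfolding has_field_derivative_def
    by (rule has_derivative_eq_rhs[OF has_derivative_compose[OF l f]]) (simp add: fun_eq_iff)
  from DERIV_pos_inc_right[OF this assms(2)] show ?thesis by auto
qed

text \<open>If \<open>g \<bullet> v > 0\<close>, then \<open>f\<close> and hence \<open>f'\<close> is positive slightly ahead in direction \<open>v\<close>, so \<open>g' \<bullet> v \<ge> 0\<close>.
  The open half space of \<open>g\<close> therefore lies in the closed half space of \<open>g'\<close>, and both have the same normal.\<close>

lemma same_sign_gradients: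
  fixes f f' :: "'a::real_inner \<Rightarrow> real"
  assumes S: "open S" "y \<in> S" and sign: "\<And>z. z \<in> S \<Longrightarrow> 0 < f z \<longleftrightarrow> 0 < f' z"
    and f: "f y = 0" "(f has_derivative (\<lambda>h. g \<bullet> h)) (at y)" "g \<noteq> 0"
    and f': "f' y = 0" "(f' has_derivative (\<lambda>h. g' \<bullet> h)) (at y)" "g' \<noteq> 0"
  shows "(1 / norm g) *\<^sub>R g = (1 / norm g') *\<^sub>R g'"
proof -
  have key: "0 \<le> g' \<bullet> v" if v: "0 < g \<bullet> v" for v
  proof (rule ccontr)
    assume "\<not> 0 \<le> g' \<bullet> v"
    then have neg: "0 < (- g') \<bullet> v" by simp
    obtain d1 where d1: "d1 > 0" "\<And>t. 0 < t \<Longrightarrow> t < d1 \<Longrightarrow> f y < f (y + t *\<^sub>R v)"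
      using increases_along[OF f(2) v] by blast
    have "((\<lambda>z. - f' z) has_derivative (\<lambda>h. (- g') \<bullet> h)) (at y)"
      using has_derivative_minus[OF f'(2)] by simp
    then obtain d2 where d2: "d2 > 0" "\<And>t. 0 < t \<Longrightarrow> t < d2 \<Longrightarrow> - f' y < - f' (y + t *\<^sub>R v)"
      using increases_along[OF _ neg] by blast
    obtain e where e: "e > 0" "ball y e \<subseteq> S" using S open_contains_ball by blast
    define m where "m = min (min d1 d2) (e / (norm v + 1))"
    define t where "t = m / 2"
    have nv: "norm v + 1 > 0" by (simp add: add_nonneg_pos)
    have "0 < m" "m \<le> d1" "m \<le> d2" "m \<le> e / (norm v + 1)"
      using d1(1) d2(1) e(1) nv by (auto simp: m_def)
    then have t: "0 < t" "t < d1" "t < d2" "t < e / (norm v + 1)"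
      unfolding t_def by linarith+
    have "t * norm v \<le> t * (norm v + 1)" using t by (simp add: mult_left_mono)
    also have "\<dots> < e" using t(4) nv by (simp add: pos_less_divide_eq)
    finally have "y + t *\<^sub>R v \<in> S" using t(1) e(2) by (auto simp: dist_norm)
    then show False using sign[of "y + t *\<^sub>R v"] d1(2)[OF t(1,2)] d2(2)[OF t(1,3)] f(1) f'(1) by simp
  qed
  \<comment> \<open>The component of \<open>g'\<close> orthogonal to \<open>g\<close>; testing the implication with \<open>\<eta> g - w\<close> forces it to vanish.\<close>
  define w where "w = g' - ((g' \<bullet> g) / (g \<bullet> g)) *\<^sub>R g"
  have gg: "g \<bullet> g > 0" using f(3) by simp
  have wg: "g \<bullet> w = 0" using gg by (simp add: w_def inner_diff_right inner_commute)
  have wg': "g' \<bullet> w = w \<bullet> w" using wg by (simp add: w_def inner_diff_left inner_diff_right inner_commute)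
  have bound: "w \<bullet> w \<le> \<eta> * (g' \<bullet> g)" if "\<eta> > 0" for \<eta>
    using key[of "\<eta> *\<^sub>R g - w"] that gg wg wg' by (simp add: inner_diff_right)
  have nn: "g' \<bullet> g \<ge> 0" using key[OF gg] .
  have "w \<bullet> w \<le> 0"
  proof (rule field_le_epsilon)
    fix e :: real assume e: "e > 0"
    have "w \<bullet> w \<le> e / (g' \<bullet> g + 1) * (g' \<bullet> g)" using e nn by (intro bound) auto
    also have "\<dots> \<le> e" using e nn by (simp add: field_simps)
    finally show "w \<bullet> w \<le> 0 + e" by simp
  qed
  then have "w \<bullet> w = 0" using inner_ge_zero[of w] by (rule antisym)
  then have "w = 0" by simp
  then obtain c where c: "g' = c *\<^sub>R g" by (auto simp: w_def)
  have "c > 0" using nn f'(3) gg by (auto simp: c zero_le_mult_iff less_le)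
  then show ?thesis using c by simp
qed

lemma frontier_zero:
  assumes D: "defining_fun \<Omega> x r \<rho> \<rho>1 \<rho>2" and "open \<Omega>" and y: "y \<in> frontier \<Omega>" "y \<in> ball x r"
  shows "\<rho> y = 0"
proof -
  have td: "twice_diff \<rho> \<rho>1 \<rho>2 (ball x r)" and eq: "\<Omega> \<inter> ball x r = {y \<in> ball x r. 0 < \<rho> y}"
    using D by (auto simp: defining_fun_def)
  have "y \<notin> \<Omega>" using y \<open>open \<Omega>\<close> by (simp add: frontier_def interior_open)
  then have "\<not> 0 < \<rho> y" using eq y by blast
  moreover have "\<not> \<rho> y < 0"
  proof
    assume "\<rho> y < 0"
    have op: "open (ball x r \<inter> \<rho> -` {..<0})"
      by (rule continuous_open_preimage[OF twice_diff_continuous_on(1)[OF td]]) auto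
    have "y \<in> (ball x r \<inter> \<rho> -` {..<0}) \<inter> closure \<Omega>"
      using y \<open>\<rho> y < 0\<close> by (simp add: frontier_def)
    then have "(ball x r \<inter> \<rho> -` {..<0}) \<inter> \<Omega> \<noteq> {}"
      using open_Int_closure_eq_empty[OF op, of \<Omega>] by blast
    then obtain z where "z \<in> ball x r" "\<rho> z < 0" "z \<in> \<Omega>" by blast
    then have "0 < \<rho> z" using eq by blast
    then show False using \<open>\<rho> z < 0\<close> by simp
  qed
  ultimately show ?thesis by simp
qed

text \<open>A zero with nonvanishing gradient is a limit of points where \<open>\<rho>\<close> is positive.\<close>

lemma zero_frontier:
  assumes D: "defining_fun \<Omega> x r \<rho> \<rho>1 \<rho>2" and "open \<Omega>" and y: "y \<in> ball x r" "\<rho> y = 0" "\<rho>1 y \<noteq> 0"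
  shows "y \<in> frontier \<Omega>"
proof -
  have td: "twice_diff \<rho> \<rho>1 \<rho>2 (ball x r)" and eq: "\<Omega> \<inter> ball x r = {y \<in> ball x r. 0 < \<rho> y}"
    using D by (auto simp: defining_fun_def)
  have "y \<notin> \<Omega>"
  proof
    assume "y \<in> \<Omega>"
    then have "y \<in> {y \<in> ball x r. 0 < \<rho> y}" using eq y(1) by blast
    then show False using y(2) by simp
  qed
  moreover have "y \<in> closure \<Omega>"
    unfolding closure_approachable
  proof (intro allI impI)
    fix e :: real assume e: "e > 0"
    have "0 < \<rho>1 y \<bullet> \<rho>1 y" using y by simp
    then obtain d where d: "d > 0" "\<And>t. 0 < t \<Longrightarrow> t < d \<Longrightarrow> \<rho> y < \<rho> (y + t *\<^sub>R \<rho>1 y)"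
      using increases_along[OF twice_diffD(1)[OF td y(1)]] by blast
    obtain e' where e': "e' > 0" "ball y e' \<subseteq> ball x r" using y(1) open_contains_ball open_ball by blast
    define m where "m = min e e'"
    define m' where "m' = min d (m / norm (\<rho>1 y))"
    define t where "t = m' / 2"
    have m: "m > 0" using e e' by (simp add: m_def)
    have n: "norm (\<rho>1 y) > 0" using y by simp
    have "0 < m'" "m' \<le> d" "m' \<le> m / norm (\<rho>1 y)" using d(1) m n by (auto simp: m'_def)
    then have t: "0 < t" "t < d" "t < m / norm (\<rho>1 y)" unfolding t_def by linarith+
    have "t * norm (\<rho>1 y) < m" using t(3) n by (simp add: pos_less_divide_eq)
    then have dm: "dist (y + t *\<^sub>R \<rho>1 y) y < m" using t(1) by (simp add: dist_norm)
    then have "y + t *\<^sub>R \<rho>1 y \<in> ball x r" using e'(2) by (auto simp: m_def dist_commute)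
    moreover have "0 < \<rho> (y + t *\<^sub>R \<rho>1 y)" using d(2)[OF t(1,2)] y(2) by simp
    ultimately have "y + t *\<^sub>R \<rho>1 y \<in> \<Omega>" using eq by blast
    then show "\<exists>z\<in>\<Omega>. dist z y < e" using dm by (auto simp: m_def)
  qed
  ultimately show ?thesis using \<open>open \<Omega>\<close> by (simp add: frontier_def interior_open)
qed

lemma gradient_nonzero_near:
  assumes D: "defining_fun \<Omega> x r \<rho> \<rho>1 \<rho>2"
  shows "\<exists>d>0. d \<le> r \<and> (\<forall>y\<in>ball x d. \<rho>1 y \<noteq> 0)"
proof -
  have r: "r > 0" and td: "twice_diff \<rho> \<rho>1 \<rho>2 (ball x r)" and nz: "\<rho>1 x \<noteq> 0"
    using D by (auto simp: defining_fun_def)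
  have "x \<in> ball x r" using r by simp
  then have "isCont \<rho>1 x" using has_derivative_continuous[OF twice_diffD(2)[OF td]] by blast
  then have "\<exists>d>0. \<forall>y. dist x y < d \<longrightarrow> \<rho>1 y \<noteq> 0" using continuous_at_avoid[of x \<rho>1 0] nz by blast
  then obtain d where "d > 0" "\<And>y. dist x y < d \<Longrightarrow> \<rho>1 y \<noteq> 0" by blast
  then show ?thesis using r by (intro exI[of _ "min d r"]) auto
qed

text \<open>Every direction orthogonal to the gradient is tangent to the boundary.  At the points
  \<open>x + t v \<plusminus> c t \<nabla>\<rho>(x)\<close> the linear term \<open>\<plusminus> c t |\<nabla>\<rho>(x)|\<^sup>2\<close> dominates the error when \<open>t\<close> is small, so \<open>\<rho>\<close> takes both
  signs and has a zero in between.\<close>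

lemma tangent_points:
  assumes D: "defining_fun \<Omega> x r \<rho> \<rho>1 \<rho>2" and "open \<Omega>" and v: "\<rho>1 x \<bullet> v = 0" and \<eta>: "0 < \<eta>"
  shows "\<exists>\<delta>>0. \<forall>t. 0 < t \<and> t < \<delta> \<longrightarrow> (\<exists>y\<in>frontier \<Omega>. norm (y - (x + t *\<^sub>R v)) \<le> \<eta> * t)"
proof -
  have r: "r > 0" and td: "twice_diff \<rho> \<rho>1 \<rho>2 (ball x r)" and zero: "\<rho> x = 0" and nz: "\<rho>1 x \<noteq> 0"
    using D by (auto simp: defining_fun_def)
  obtain d1 where d1: "d1 > 0" "d1 \<le> r" "\<And>y. y \<in> ball x d1 \<Longrightarrow> \<rho>1 y \<noteq> 0"
    using gradient_nonzero_near[OF D] by blast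
  define n where "n = \<rho>1 x"
  have n: "norm n > 0" "n \<bullet> n > 0" using nz by (auto simp: n_def)
  define c where "c = \<eta> / norm n"
  have c: "c > 0" "c * norm n = \<eta>" using \<eta> n by (auto simp: c_def)
  define L where "L = norm v + \<eta> + 1"
  have L: "L > 0" using \<eta> by (simp add: L_def add_nonneg_pos)
  \<comment> \<open>\<open>L t\<close> bounds the length of all displacements considered, so that the error is at most half of the linear term.\<close>
  define e where "e = c * (n \<bullet> n) / (2 * L)"
  have e: "e > 0" "e * L = c * (n \<bullet> n) / 2" using c n L by (auto simp: e_def)
  have "(\<rho> has_derivative (\<lambda>h. n \<bullet> h)) (at x)" unfolding n_def using twice_diffD(1)[OF td] r by simp
  then obtain d2 where d2: "d2 > 0" "\<And>y. norm (y - x) < d2 \<Longrightarrow> norm (\<rho> y - \<rho> x - n \<bullet> (y - x)) \<le> e * norm (y - x)"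
    using e(1) unfolding has_derivative_at_alt by blast
  define \<delta> where "\<delta> = min d1 d2 / L"
  have "\<exists>y\<in>frontier \<Omega>. norm (y - (x + t *\<^sub>R v)) \<le> \<eta> * t" if t: "0 < t" "t < \<delta>" for t
  proof -
    have tL: "t * L < min d1 d2" using t(2) L by (simp add: \<delta>_def pos_less_divide_eq)
    define p where "p \<tau> = x + t *\<^sub>R v + \<tau> *\<^sub>R n" for \<tau>
    have near: "norm (p \<tau> - x) < t * L" if "\<bar>\<tau>\<bar> \<le> c * t" for \<tau>
    proof -
      have "norm (p \<tau> - x) \<le> t * norm v + \<bar>\<tau>\<bar> * norm n"
        using norm_triangle_ineq[of "t *\<^sub>R v" "\<tau> *\<^sub>R n"] t(1) by (simp add: p_def)
      also have "\<bar>\<tau>\<bar> * norm n \<le> (c * t) * norm n" using that by (intro mult_right_mono) auto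
      also have "t * norm v + (c * t) * norm n = t * (norm v + \<eta>)"
        using c(2) by (simp add: algebra_simps)
      also have "\<dots> < t * L" using t(1) by (simp add: L_def)
      finally show ?thesis by simp
    qed
    have est: "\<bar>\<rho> (p \<tau>) - \<tau> * (n \<bullet> n)\<bar> < c * (n \<bullet> n) / 2 * t" if "\<bar>\<tau>\<bar> \<le> c * t" for \<tau>
    proof -
      have "norm (\<rho> (p \<tau>) - \<rho> x - n \<bullet> (p \<tau> - x)) \<le> e * norm (p \<tau> - x)"
        using d2(2) near[OF that] tL by simp
      moreover have "n \<bullet> (p \<tau> - x) = \<tau> * (n \<bullet> n)"
        using v by (simp add: p_def n_def inner_add_right)
      moreover have "e * norm (p \<tau> - x) < e * (t * L)" using near[OF that] e(1) by simp
      moreover have "e * (t * L) = c * (n \<bullet> n) / 2 * t" using e(2) by (simp add: algebra_simps)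
      ultimately show ?thesis using zero by simp
    qed
    have ct: "c * t > 0" using c t by simp
    have cn: "c * t * (n \<bullet> n) > 0" using ct n by simp
    have "\<bar>\<rho> (p (c * t)) - c * t * (n \<bullet> n)\<bar> < c * t * (n \<bullet> n) / 2"
      using est[of "c * t"] ct by (simp add: mult_ac)
    then have "\<rho> (p (c * t)) > 0" using cn by linarith
    moreover have "\<bar>\<rho> (p (- (c * t))) + c * t * (n \<bullet> n)\<bar> < c * t * (n \<bullet> n) / 2"
      using est[of "- (c * t)"] ct by (simp add: mult_ac)
    then have "\<rho> (p (- (c * t))) < 0" using cn by linarith
    moreover have "continuous_on {- (c * t)..c * t} (\<lambda>\<tau>. \<rho> (p \<tau>))"
    proof (rule continuous_on_compose2[OF twice_diff_continuous_on(1)[OF td]])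
      show "continuous_on {- (c * t)..c * t} p" unfolding p_def by (intro continuous_intros)
      show "p ` {- (c * t)..c * t} \<subseteq> ball x r"
      proof
        fix z assume "z \<in> p ` {- (c * t)..c * t}"
        then obtain \<tau> where "z = p \<tau>" "\<bar>\<tau>\<bar> \<le> c * t" by (auto simp: abs_le_iff)
        then show "z \<in> ball x r" using near[of \<tau>] tL d1(2) by (simp add: dist_norm norm_minus_commute)
      qed
    qed
    ultimately obtain \<tau> where \<tau>: "- (c * t) \<le> \<tau>" "\<tau> \<le> c * t" "\<rho> (p \<tau>) = 0"
      using IVT'[of "\<lambda>\<tau>. \<rho> (p \<tau>)" "- (c * t)" 0 "c * t"] ct by auto
    have at: "\<bar>\<tau>\<bar> \<le> c * t" using \<tau> by simp
    have "p \<tau> \<in> ball x d1" using near[OF at] tL by (simp add: dist_norm norm_minus_commute)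
    then have "p \<tau> \<in> frontier \<Omega>"
      using zero_frontier[OF D \<open>open \<Omega>\<close> _ \<tau>(3)] d1 by auto
    moreover have "norm (p \<tau> - (x + t *\<^sub>R v)) \<le> \<eta> * t"
    proof -
      have "norm (p \<tau> - (x + t *\<^sub>R v)) = \<bar>\<tau>\<bar> * norm n" by (simp add: p_def)
      also have "\<dots> \<le> (c * t) * norm n" using at by (intro mult_right_mono) auto
      also have "\<dots> = \<eta> * t" using c(2) by (simp add: algebra_simps)
      finally show ?thesis .
    qed
    ultimately show ?thesis by blast
  qed
  moreover have "\<delta> > 0" using d1 d2 L by (simp add: \<delta>_def)
  ultimately show ?thesis by blast
qed

text \<open>A derivative within \<open>S\<close> is determined only on directions in which \<open>S\<close> is approached to first order.\<close>

lemma tangent_derivative_unique: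
  fixes f :: "'a::real_normed_vector \<Rightarrow> real"
  assumes L1: "(f has_derivative L1) (at x within S)" and L2: "(f has_derivative L2) (at x within S)"
    and tan: "\<And>\<eta>. 0 < \<eta> \<Longrightarrow> \<exists>\<delta>>0. \<forall>t. 0 < t \<and> t < \<delta> \<longrightarrow> (\<exists>y\<in>S. norm (y - (x + t *\<^sub>R v)) \<le> \<eta> * t)"
  shows "L1 v = L2 v"
proof (rule ccontr)
  assume ne: "L1 v \<noteq> L2 v"
  define L where "L h = L1 h - L2 h" for h
  have bl: "bounded_linear L" unfolding L_def
    by (intro bounded_linear_sub has_derivative_bounded_linear[OF L1] has_derivative_bounded_linear[OF L2])
  then obtain K where K: "K \<ge> 0" "\<And>h. norm (L h) \<le> norm h * K"
    using bounded_linear.nonneg_bounded by blast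
  have lin: "linear L" using bl by (rule bounded_linear.linear)
  \<comment> \<open>The difference of the derivatives at \<open>v\<close> is at most \<open>e A\<close>, whatever the accuracy \<open>e \<le> 1\<close>.\<close>
  define A where "A = 2 * (norm v + 1) + K"
  have A: "A > 0" unfolding A_def by (intro add_pos_nonneg K(1) mult_pos_pos add_nonneg_pos) simp_all
  define e where "e = min 1 (\<bar>L v\<bar> / (2 * A))"
  have Lv: "\<bar>L v\<bar> > 0" using ne by (simp add: L_def)
  have e: "e > 0" "e \<le> 1" "e * A < \<bar>L v\<bar>"
  proof -
    show "e > 0" "e \<le> 1" using A Lv by (auto simp: e_def)
    have "e * A \<le> \<bar>L v\<bar> / (2 * A) * A" using A by (intro mult_right_mono) (auto simp: e_def)
    also have "\<dots> < \<bar>L v\<bar>" using A Lv by simp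
    finally show "e * A < \<bar>L v\<bar>" .
  qed
  obtain d1 where d1: "d1 > 0" "\<And>y. y \<in> S \<Longrightarrow> norm (y - x) < d1 \<Longrightarrow> norm (f y - f x - L1 (y - x)) \<le> e * norm (y - x)"
    using L1 e(1) unfolding has_derivative_within_alt by blast
  obtain d2 where d2: "d2 > 0" "\<And>y. y \<in> S \<Longrightarrow> norm (y - x) < d2 \<Longrightarrow> norm (f y - f x - L2 (y - x)) \<le> e * norm (y - x)"
    using L2 e(1) unfolding has_derivative_within_alt by blast
  obtain \<delta> where \<delta>: "\<delta> > 0" "\<And>t. 0 < t \<Longrightarrow> t < \<delta> \<Longrightarrow> \<exists>y\<in>S. norm (y - (x + t *\<^sub>R v)) \<le> e * t"
    using tan[OF e(1)] by blast
  have nv: "norm v + 1 > 0" by (simp add: add_nonneg_pos)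
  define m where "m = min \<delta> (min d1 d2 / (norm v + 1))"
  define t where "t = m / 2"
  have "0 < m" "m \<le> \<delta>" "m \<le> min d1 d2 / (norm v + 1)"
    using \<delta>(1) d1(1) d2(1) nv by (auto simp: m_def)
  then have t: "0 < t" "t < \<delta>" "t < min d1 d2 / (norm v + 1)"
    unfolding t_def by linarith+
  obtain y where y: "y \<in> S" "norm (y - (x + t *\<^sub>R v)) \<le> e * t" using \<delta>(2)[OF t(1,2)] by blast
  define z where "z = y - (x + t *\<^sub>R v)"
  have yx: "y - x = t *\<^sub>R v + z" by (simp add: z_def)
  have z: "norm z \<le> e * t" using y by (simp add: z_def)
  have et: "e * t \<le> 1 * t" using e t by (intro mult_right_mono) auto
  have "norm (y - x) \<le> t * norm v + norm z"
    using norm_triangle_ineq[of "t *\<^sub>R v" z] t(1) unfolding yx by simp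
  then have nyx: "norm (y - x) \<le> t * (norm v + 1)"
    unfolding distrib_left mult_1_right using z et by linarith
  also have "\<dots> < min d1 d2" using t(3) nv by (simp add: pos_less_divide_eq)
  finally have ny: "norm (y - x) < d1" "norm (y - x) < d2" by auto
  have "norm (L (y - x)) \<le> 2 * (e * norm (y - x))"
    using d1(2)[OF y(1) ny(1)] d2(2)[OF y(1) ny(2)] by (simp add: L_def)
  also have "\<dots> \<le> 2 * (e * (t * (norm v + 1)))" using nyx e(1) by simp
  finally have a1: "\<bar>L (y - x)\<bar> \<le> 2 * (e * (t * (norm v + 1)))" by simp
  have a2: "\<bar>L z\<bar> \<le> e * t * K" using K(2)[of z] mult_right_mono[OF z K(1)] by simp
  have "t * L v = L (y - x) - L z" unfolding yx by (simp add: linear_add[OF lin] linear_scale[OF lin])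
  then have "\<bar>t * L v\<bar> \<le> \<bar>L (y - x)\<bar> + \<bar>L z\<bar>" by simp
  then have "t * \<bar>L v\<bar> \<le> \<bar>L (y - x)\<bar> + \<bar>L z\<bar>" using t(1) by (simp add: abs_mult)
  also have "\<dots> \<le> t * (e * A)" using a1 a2 by (simp add: A_def algebra_simps)
  finally have "\<bar>L v\<bar> \<le> e * A" using t(1) by simp
  then show False using e(3) by simp
qed

section \<open>Barriers from the curvature condition\<close>

text \<open>Along the boundary \<open>\<nabla>\<rho> = |\<nabla>\<rho>| N\<close>.  Taking the component along \<open>T\<^sub>j\<close> and differentiating in the tangent direction
  \<open>T\<^sub>i\<close>, the derivative of \<open>|\<nabla>\<rho>|\<close> is multiplied by \<open>T\<^sub>j \<bullet> N = 0\<close>, and what remains is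
  \<open>|\<nabla>\<rho>| T\<^sub>j \<bullet> D\<^bsub>T\<^sub>i\<^esub> N = - |\<nabla>\<rho>| \<kappa>\<^sub>i \<delta>\<^sub>i\<^sub>j\<close>.\<close>

lemma defining_hessian_frame:
  fixes \<Omega> :: "(real^'n) set"
  assumes op: "open \<Omega>" and x: "x \<in> frontier \<Omega>"
    and normal: "\<And>y. y \<in> frontier \<Omega> \<Longrightarrow> inward_normal \<Omega> y (N y)"
    and frame: "principal_frame \<Omega> N \<kappa> T x"
    and D: "defining_fun \<Omega> x r \<rho> \<rho>1 \<rho>2"
    and i: "i \<in> {1..<CARD('n)}" and j: "j \<in> {1..<CARD('n)}"
  shows "\<rho>1 x = norm (\<rho>1 x) *\<^sub>R N x"
    and "T j x \<bullet> \<rho>2 x (T i x) = (if i = j then - norm (\<rho>1 x) * \<kappa> i else 0)"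
proof -
  have r: "r > 0" and td: "twice_diff \<rho> \<rho>1 \<rho>2 (ball x r)" and nz: "\<rho>1 x \<noteq> 0"
    and eq: "\<Omega> \<inter> ball x r = {y \<in> ball x r. 0 < \<rho> y}"
    using D by (auto simp: defining_fun_def)
  have xr: "x \<in> ball x r" using r by simp
  obtain d where d: "d > 0" "d \<le> r" "\<And>y. y \<in> ball x d \<Longrightarrow> \<rho>1 y \<noteq> 0"
    using gradient_nonzero_near[OF D] by blast
  have grad_eq: "\<rho>1 y = norm (\<rho>1 y) *\<^sub>R N y" if y: "y \<in> frontier \<Omega>" "y \<in> ball x d" for y
  proof -
    have yr: "y \<in> ball x r" using y(2) d(2) by auto
    obtain s \<sigma> \<sigma>1 \<sigma>2 where E: "defining_fun \<Omega> y s \<sigma> \<sigma>1 \<sigma>2" and Ny: "N y = (1 / norm (\<sigma>1 y)) *\<^sub>R \<sigma>1 y"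
      using inward_normal_defining_fun[OF normal[OF y(1)]] by blast
    have s: "s > 0" and td': "twice_diff \<sigma> \<sigma>1 \<sigma>2 (ball y s)" and nz': "\<sigma>1 y \<noteq> 0" and z': "\<sigma> y = 0"
      and eq': "\<Omega> \<inter> ball y s = {z \<in> ball y s. 0 < \<sigma> z}"
      using E by (auto simp: defining_fun_def)
    have ys: "y \<in> ball y s" using s by simp
    have "(1 / norm (\<rho>1 y)) *\<^sub>R \<rho>1 y = (1 / norm (\<sigma>1 y)) *\<^sub>R \<sigma>1 y"
    proof (rule same_sign_gradients[of "ball x r \<inter> ball y s"])
      show "0 < \<rho> z \<longleftrightarrow> 0 < \<sigma> z" if "z \<in> ball x r \<inter> ball y s" for z
      proof -
        have "0 < \<rho> z \<longleftrightarrow> z \<in> \<Omega>" using eq that by blast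
        moreover have "0 < \<sigma> z \<longleftrightarrow> z \<in> \<Omega>" using eq' that by blast
        ultimately show ?thesis by simp
      qed
    qed (use yr ys y d twice_diffD(1)[OF td yr] twice_diffD(1)[OF td' ys] nz' z' frontier_zero[OF D op y(1) yr] in auto)
    then show ?thesis using d(3)[OF y(2)] by (simp add: Ny[symmetric])
      (metis (no_types, lifting) divide_inverse mult_1 norm_eq_zero right_inverse scaleR_one scaleR_scaleR)
  qed
  show gx: "\<rho>1 x = norm (\<rho>1 x) *\<^sub>R N x" using grad_eq[OF x] d(1) by simp
  obtain r' where r': "r' > 0" "\<And>y i. y \<in> frontier \<Omega> \<inter> ball x r' \<Longrightarrow> i \<in> {1..<CARD('n)} \<Longrightarrow> N y \<bullet> T i y = 0"
    and Nd: "N differentiable (at x within frontier \<Omega>)"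
    and DN: "bdry_deriv \<Omega> (T i x) N x = - \<kappa> i *\<^sub>R T i x"
    and orth: "T i x \<bullet> T j x = (if i = j then 1 else 0)"
    using frame i j x unfolding principal_frame_def by (metis (no_types, lifting) IntI centre_in_ball)
  have TN: "T l x \<bullet> N x = 0" if "l \<in> {1..<CARD('n)}" for l
    using r'(2)[of x l] r'(1) x that by (simp add: inner_commute)
  define DN' where "DN' = frechet_derivative N (at x within frontier \<Omega>)"
  have Nder: "(N has_derivative DN') (at x within frontier \<Omega>)"
    using Nd unfolding DN'_def frechet_derivative_works .
  have DNi: "DN' (T i x) = - \<kappa> i *\<^sub>R T i x" using DN by (simp add: bdry_deriv_def DN'_def)
  have g1: "(\<rho>1 has_derivative \<rho>2 x) (at x within frontier \<Omega>)"
    using has_derivative_at_withinI[OF twice_diffD(2)[OF td xr]] .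
  have A: "((\<lambda>y. T j x \<bullet> \<rho>1 y) has_derivative (\<lambda>h. T j x \<bullet> \<rho>2 x h)) (at x within frontier \<Omega>)"
    by (rule has_derivative_inner_right[OF g1])
  have nd: "((\<lambda>y. norm (\<rho>1 y)) has_derivative (\<lambda>h. \<rho>2 x h \<bullet> sgn (\<rho>1 x))) (at x within frontier \<Omega>)"
    by (rule has_derivative_compose[OF g1 has_derivative_norm[OF nz]])
  have B: "((\<lambda>y. norm (\<rho>1 y) * (T j x \<bullet> N y)) has_derivative
      (\<lambda>h. norm (\<rho>1 x) * (T j x \<bullet> DN' h) + (\<rho>2 x h \<bullet> sgn (\<rho>1 x)) * (T j x \<bullet> N x))) (at x within frontier \<Omega>)"
    by (rule has_derivative_mult[OF nd has_derivative_inner_right[OF Nder]])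
  have B': "((\<lambda>y. T j x \<bullet> \<rho>1 y) has_derivative
      (\<lambda>h. norm (\<rho>1 x) * (T j x \<bullet> DN' h) + (\<rho>2 x h \<bullet> sgn (\<rho>1 x)) * (T j x \<bullet> N x))) (at x within frontier \<Omega>)"
  proof (rule has_derivative_transform_within[OF B d(1) x])
    fix y assume "y \<in> frontier \<Omega>" "dist y x < d"
    then show "norm (\<rho>1 y) * (T j x \<bullet> N y) = T j x \<bullet> \<rho>1 y"
      using grad_eq[of y] by (metis dist_commute inner_scaleR_right mem_ball)
  qed
  have tan0: "\<rho>1 x \<bullet> T i x = 0" using TN[OF i] by (subst gx) (simp add: inner_commute)
  have "T j x \<bullet> \<rho>2 x (T i x) = norm (\<rho>1 x) * (T j x \<bullet> DN' (T i x)) + (\<rho>2 x (T i x) \<bullet> sgn (\<rho>1 x)) * (T j x \<bullet> N x)"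
    by (rule tangent_derivative_unique[OF A B']) (rule tangent_points[OF D op tan0])
  then show "T j x \<bullet> \<rho>2 x (T i x) = (if i = j then - norm (\<rho>1 x) * \<kappa> i else 0)"
    using orth TN[OF j] by (auto simp: DNi inner_commute)
qed

lemma orthonormal_expansion:
  fixes E :: "(real^'n) set"
  assumes "finite E" "pairwise orthogonal E" "\<And>e. e \<in> E \<Longrightarrow> norm e = 1" "CARD('n) \<le> card E"
  shows "(\<Sum>e\<in>E. (x \<bullet> e) *\<^sub>R e) = x"
proof (rule orthonormal_basis_expand[OF assms(2,3) _ assms(1)])
  have "0 \<notin> E" using assms(3) by force
  then have ind: "independent E" by (rule pairwise_orthogonal_independent[OF assms(2)])
  have "dim (UNIV :: (real^'n) set) \<le> card E" using assms(4) by simp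
  then have "UNIV \<subseteq> span E" using card_ge_dim_independent[OF _ ind, of UNIV] by simp
  then show "x \<in> span E" by blast
qed

context surface_energy
begin

text \<open>At a horizontal vector \<open>(q, 0)\<close> the coefficient matrix annihilates \<open>q\<close> by homogeneity, so in an orthonormal basis
  consisting of \<open>n\<close> and the \<open>T\<^sub>i\<close> only the tangential entries of \<open>H\<close> contribute, and these are diagonal.\<close>

lemma coeff_hessian_frame:
  fixes n :: "real^'n" and T :: "nat \<Rightarrow> real^'n"
  assumes q: "q \<noteq> 0" "q = c *\<^sub>R n" and n: "norm n = 1"
    and Tn: "\<And>i. i \<in> {1..<CARD('n)} \<Longrightarrow> n \<bullet> T i = 0"
    and TT: "\<And>i j. i \<in> {1..<CARD('n)} \<Longrightarrow> j \<in> {1..<CARD('n)} \<Longrightarrow> T i \<bullet> T j = (if i = j then 1 else 0)"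
    and H: "\<And>i j. i \<in> {1..<CARD('n)} \<Longrightarrow> j \<in> {1..<CARD('n)} \<Longrightarrow>
              T j \<bullet> (H *v T i) = (if i = j then h i else 0)"
  shows "coeff (q, 0) \<bullet> H = (\<Sum>i\<in>{1..<CARD('n)}. h i * (T i \<bullet> (coeff (q, 0) *v T i)))"
proof -
  define I where "I = {1..<CARD('n)}"
  define A where "A = coeff (q, 0)"
  have p: "(q, 0::real) \<noteq> 0" using q by (simp add: zero_prod_def)
  have sym: "transpose A = A" using coeff_psd[OF p] by (simp add: psd_def A_def)
  have "c \<noteq> 0" using q by auto
  have "c *\<^sub>R (A *v n) = 0" using coeff_radial_null[OF q(1)] by (simp add: A_def q(2) matrix_vector_mult_scaleR)
  then have An: "A *v n = 0" using \<open>c \<noteq> 0\<close> by simp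
  have inj: "inj_on T I" unfolding inj_on_def I_def by (metis TT zero_neq_one)
  have nT: "n \<notin> T ` I" using Tn n by (auto simp: I_def norm_eq_1)
  define E where "E = insert n (T ` I)"
  have finI: "finite I" by (simp add: I_def)
  then have fin: "finite E" by (simp add: E_def)
  have card: "card E = CARD('n)" using nT inj dim by (simp add: E_def card_image I_def)
  have orth: "pairwise orthogonal E"
    unfolding pairwise_def orthogonal_def E_def
    using Tn TT inj by (auto simp: I_def inner_commute)
  have unit: "norm e = 1" if "e \<in> E" for e using that n TT by (auto simp: E_def I_def norm_eq_1)
  have expand: "(\<Sum>e\<in>E. (x \<bullet> e) *\<^sub>R e) = x" for x
    by (rule orthonormal_expansion[OF fin orth unit]) (simp_all add: card)
  have "A \<bullet> H = (\<Sum>e\<in>E. (A *v e) \<bullet> (H *v e))" by (rule matrix_inner_orthonormal[OF expand])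
  also have "\<dots> = (\<Sum>i\<in>I. (A *v T i) \<bullet> (H *v T i))"
    using nT An finI by (simp add: E_def sum.reindex[OF inj])
  also have "\<dots> = (\<Sum>i\<in>I. h i * (T i \<bullet> (A *v T i)))"
  proof (rule sum.cong[OF refl])
    fix i assume i: "i \<in> I"
    have "(A *v T i) \<bullet> (H *v T i) = (\<Sum>e\<in>E. ((A *v T i) \<bullet> e) *\<^sub>R e) \<bullet> (H *v T i)"
      by (simp only: expand)
    also have "\<dots> = (\<Sum>e\<in>E. ((A *v T i) \<bullet> e) * (e \<bullet> (H *v T i)))"
      by (simp only: inner_sum_left inner_scaleR_left)
    also have "\<dots> = (\<Sum>j\<in>I. ((A *v T i) \<bullet> T j) * (T j \<bullet> (H *v T i)))"
    proof -
      have "(A *v T i) \<bullet> n = 0" using symmetric_matrix_inner[OF sym, of n "T i"] An by (simp add: inner_commute)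
      then show ?thesis using nT finI by (simp add: E_def sum.reindex[OF inj])
    qed
    also have "\<dots> = (\<Sum>j\<in>I. if j = i then ((A *v T i) \<bullet> T i) * h i else 0)"
      using H i by (intro sum.cong refl) (auto simp: I_def)
    also have "\<dots> = h i * (T i \<bullet> (A *v T i))" using i by (simp add: I_def inner_commute)
    finally show "(A *v T i) \<bullet> (H *v T i) = h i * (T i \<bullet> (A *v T i))" .
  qed
  finally show ?thesis by (simp add: A_def I_def)
qed

text \<open>Nonnegative curvatures are weighted at least by \<open>\<gamma>1\<close>, negative ones at most by \<open>\<gamma>2\<close>.\<close>

lemma weighted_curvature_pos:
  fixes T :: "nat \<Rightarrow> real^'n" and k :: "nat \<Rightarrow> real"
  assumes q: "q \<noteq> 0" and Tq: "\<And>i. i \<in> {1..<CARD('n)} \<Longrightarrow> norm (T i) = 1 \<and> T i \<bullet> q = 0"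
    and \<alpha>: "1 \<le> \<alpha>" "\<alpha> \<le> CARD('n) - 1"
    and kpos: "\<And>i. i \<in> {1..\<alpha>} \<Longrightarrow> 0 \<le> k i" and kneg: "\<And>i. i \<in> {\<alpha> + 1..CARD('n) - 1} \<Longrightarrow> k i < 0"
    and \<gamma>: "\<gamma>1 \<le> g0 * (m0 - m2)" "G0 * (M0 + m2) \<le> \<gamma>2"
    and pos: "0 < \<gamma>1 * (\<Sum>i = 1..\<alpha>. k i) + \<gamma>2 * (\<Sum>i = \<alpha> + 1..CARD('n) - 1. k i)"
  shows "0 < (\<Sum>i\<in>{1..<CARD('n)}. k i * (T i \<bullet> (coeff (q, 0) *v T i)))"
proof -
  have p: "(q, 0::real) \<noteq> 0" using q by (simp add: zero_prod_def)
  define b where "b i = T i \<bullet> (coeff (q, 0) *v T i)" for i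
  have lo: "\<gamma>1 \<le> b i" and hi: "b i \<le> \<gamma>2" if "i \<in> {1..<CARD('n)}" for i
    using tangential_coeff_bounds[OF p, of "T i"] Tq[OF that] \<gamma> unfolding b_def by force+
  have split: "{1..<CARD('n)} = {1..\<alpha>} \<union> {\<alpha> + 1..CARD('n) - 1}" using \<alpha> dim by auto
  have "\<gamma>1 * (\<Sum>i = 1..\<alpha>. k i) + \<gamma>2 * (\<Sum>i = \<alpha> + 1..CARD('n) - 1. k i)
      = (\<Sum>i = 1..\<alpha>. k i * \<gamma>1) + (\<Sum>i = \<alpha> + 1..CARD('n) - 1. k i * \<gamma>2)"
    by (simp add: sum_distrib_left mult.commute)
  also have "\<dots> \<le> (\<Sum>i = 1..\<alpha>. k i * b i) + (\<Sum>i = \<alpha> + 1..CARD('n) - 1. k i * b i)"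
  proof (intro add_mono sum_mono)
    fix i assume i: "i \<in> {1..\<alpha>}"
    then have "i \<in> {1..<CARD('n)}" unfolding split by blast
    from lo[OF this] kpos[OF i] show "k i * \<gamma>1 \<le> k i * b i" by (rule mult_left_mono)
  next
    fix i assume i: "i \<in> {\<alpha> + 1..CARD('n) - 1}"
    then have "i \<in> {1..<CARD('n)}" unfolding split by blast
    from hi[OF this] show "k i * \<gamma>2 \<le> k i * b i"
      using kneg[OF i] by (intro mult_left_mono_neg) auto
  qed
  also have "\<dots> = (\<Sum>i\<in>{1..<CARD('n)}. k i * b i)"
    unfolding split by (rule sum.union_disjoint[symmetric]) auto
  finally show ?thesis using pos unfolding b_def by linarith
qed

text \<open>Dividing the argument of the coefficient by \<open>s\<close> does not change its value and brings it close to
  \<open>(\<sigma> \<nabla>\<rho>(x), 0)\<close>.  There the contribution of \<open>s D\<^sup>2\<rho>\<close> is below \<open>- s c\<close>, while that of the quadratic term stays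
  bounded.  The radius does not depend on \<open>B\<close>, which is chosen later depending on it.  The sign \<open>\<sigma>\<close> distinguishes
  barriers from above and from below.\<close>

lemma steep_barrier:
  assumes D: "defining_fun \<Omega> x r \<rho> \<rho>1 \<rho>2" and \<sigma>: "\<bar>\<sigma>\<bar> = (1::real)"
    and neg: "coeff (\<sigma> *\<^sub>R \<rho>1 x, 0) \<bullet> matrix (\<rho>2 x) < 0"
  shows "\<exists>r'. 0 < r' \<and> r' \<le> r \<and> (\<forall>B \<Lambda>. \<exists>s\<ge>0. \<forall>y\<in>ball x r'.
      coeff (\<sigma> *\<^sub>R ((2 * B) *\<^sub>R (y - x) + s *\<^sub>R \<rho>1 y), -1)
        \<bullet> matrix (\<lambda>h. (2 * B) *\<^sub>R h + s *\<^sub>R \<rho>2 y h) \<le> \<Lambda>)"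
proof -
  have r: "r > 0" and td: "twice_diff \<rho> \<rho>1 \<rho>2 (ball x r)" and nz: "\<rho>1 x \<noteq> 0"
    and hc: "\<And>h. continuous_on (ball x r) (\<lambda>y. \<rho>2 y h)"
    using D by (auto simp: defining_fun_def)
  define p0 where "p0 = (\<sigma> *\<^sub>R \<rho>1 x, 0::real)"
  have p0: "p0 \<noteq> 0" using nz \<sigma> by (auto simp: p0_def zero_prod_def)
  define U where "U = (- {0 :: (real^'n) \<times> real}) \<times> ball x r"
  have U: "open U" "(p0, x) \<in> U" unfolding U_def using p0 r by (auto intro: open_Times open_punctured)
  define \<Phi> where "\<Phi> z = coeff (fst z) \<bullet> matrix (\<rho>2 (snd z))" for z
  define \<Psi> where "\<Psi> z = coeff (fst z) \<bullet> mat 1" for z :: "((real^'n) \<times> real) \<times> (real^'n)"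
  have cc: "continuous_on U (\<lambda>z. coeff (fst z))"
    by (rule continuous_on_compose2[OF coeff_continuous continuous_on_fst[OF continuous_on_id]]) (auto simp: U_def)
  have hc': "continuous_on (ball x r) (\<lambda>y. matrix (\<rho>2 y))"
    unfolding matrix_def by (intro continuous_on_vec_lambda continuous_on_component hc)
  have ch: "continuous_on U (\<lambda>z. matrix (\<rho>2 (snd z)))"
    by (rule continuous_on_compose2[OF hc' continuous_on_snd[OF continuous_on_id]]) (auto simp: U_def)
  have c\<Phi>: "continuous_on U \<Phi>" unfolding \<Phi>_def by (rule continuous_on_inner[OF cc ch])
  have c\<Psi>: "continuous_on U \<Psi>" unfolding \<Psi>_def by (rule continuous_on_inner[OF cc continuous_on_const])
  define c where "c = - \<Phi> (p0, x) / 2"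
  have c: "c > 0" "\<Phi> (p0, x) < - c" using neg by (auto simp: c_def \<Phi>_def p0_def)
  define C where "C = \<Psi> (p0, x) + 1"
  have C: "C > 0" using coeff_trace_pos[OF p0] by (simp add: C_def \<Psi>_def)
  define V where "V = (U \<inter> \<Phi> -` {..<- c}) \<inter> (U \<inter> \<Psi> -` {..<C})"
  have "open V" unfolding V_def
    by (intro open_Int continuous_open_preimage[OF c\<Phi> U(1)] continuous_open_preimage[OF c\<Psi> U(1)] open_lessThan)
  moreover have "(p0, x) \<in> V" using U(2) c by (simp add: V_def C_def)
  ultimately obtain d where d: "d > 0" "ball (p0, x) d \<subseteq> V" using open_contains_ball by blast
  have "isCont \<rho>1 x" using has_derivative_continuous[OF twice_diffD(2)[OF td]] r by simp
  moreover have "d / 4 > 0" using d by simp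
  ultimately obtain d1 where d1: "d1 > 0" "\<And>y. dist y x < d1 \<Longrightarrow> dist (\<rho>1 y) (\<rho>1 x) < d / 4"
    unfolding continuous_at_eps_delta by blast
  define r' where "r' = min r (min d1 (d / 2))"
  have r': "0 < r'" "r' \<le> r" "r' \<le> d1" "r' \<le> d / 2" using r d d1 by (auto simp: r'_def)
  have "\<exists>s\<ge>0. \<forall>y\<in>ball x r'.
      coeff (\<sigma> *\<^sub>R ((2 * B) *\<^sub>R (y - x) + s *\<^sub>R \<rho>1 y), -1)
        \<bullet> matrix (\<lambda>h. (2 * B) *\<^sub>R h + s *\<^sub>R \<rho>2 y h) \<le> \<Lambda>" for B \<Lambda>
  proof -
    define K where "K = 2 * \<bar>B\<bar> * r' + 1"
    have K: "K > 0" using r' by (simp add: K_def add_nonneg_pos)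
    \<comment> \<open>The first summand brings the argument within distance \<open>d / 2\<close>, the second one makes the pairing at most \<open>\<Lambda>\<close>.\<close>
    define s where "s = 4 * K / d + (2 * \<bar>B\<bar> * C + \<bar>\<Lambda>\<bar>) / c"
    have sd: "4 * K / d > 0" using K d by simp
    have sc: "(2 * \<bar>B\<bar> * C + \<bar>\<Lambda>\<bar>) / c \<ge> 0" using C c by simp
    have s: "s > 0" using sd sc by (simp add: s_def)
    have "4 * K / d \<le> s" using sc by (simp add: s_def)
    then have sK: "K / s \<le> d / 4" using s d by (simp add: field_simps)
    have "(2 * \<bar>B\<bar> * C + \<bar>\<Lambda>\<bar>) / c \<le> s" using sd by (simp add: s_def)
    then have sL: "2 * \<bar>B\<bar> * C + \<bar>\<Lambda>\<bar> \<le> s * c" using c by (simp add: pos_divide_le_eq)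
    have "coeff (\<sigma> *\<^sub>R ((2 * B) *\<^sub>R (y - x) + s *\<^sub>R \<rho>1 y), -1)
        \<bullet> matrix (\<lambda>h. (2 * B) *\<^sub>R h + s *\<^sub>R \<rho>2 y h) \<le> \<Lambda>" if y: "y \<in> ball x r'" for y
    proof -
      define Q where "Q = (\<sigma> *\<^sub>R ((2 * B) *\<^sub>R (y - x) + s *\<^sub>R \<rho>1 y), -1::real)"
      define p where "p = (1 / s) *\<^sub>R Q"
      have Q0: "Q \<noteq> 0" by (simp add: Q_def zero_prod_def)
      have cp: "coeff Q = coeff p" unfolding p_def using coeff_scale[OF Q0, of "1 / s"] s by simp
      have ny: "norm (y - x) < r'" using y by (simp add: dist_norm norm_minus_commute)
      have pd: "p - p0 = (\<sigma> *\<^sub>R ((2 * B / s) *\<^sub>R (y - x) + (\<rho>1 y - \<rho>1 x)), - 1 / s)"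
        using s by (simp add: p_def p0_def Q_def algebra_simps)
      have "norm (p - p0) \<le> norm (\<sigma> *\<^sub>R ((2 * B / s) *\<^sub>R (y - x) + (\<rho>1 y - \<rho>1 x))) + norm (- 1 / s)"
        unfolding pd by (rule norm_Pair_le)
      also have "norm (\<sigma> *\<^sub>R ((2 * B / s) *\<^sub>R (y - x) + (\<rho>1 y - \<rho>1 x)))
          \<le> norm ((2 * B / s) *\<^sub>R (y - x)) + norm (\<rho>1 y - \<rho>1 x)"
        by (subst norm_scaleR) (simp only: \<sigma> mult_1_left norm_triangle_ineq)
      also have "norm ((2 * B / s) *\<^sub>R (y - x)) = 2 * \<bar>B\<bar> / s * norm (y - x)"
        using s by (simp add: abs_mult)
      also have "2 * \<bar>B\<bar> / s * norm (y - x) \<le> 2 * \<bar>B\<bar> / s * r'"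
        using ny s by (intro mult_left_mono) auto
      also have "norm (\<rho>1 y - \<rho>1 x) < d / 4"
        using d1(2)[of y] ny r'(3) by (simp add: dist_norm)
      also have "2 * \<bar>B\<bar> / s * r' + d / 4 + norm (- 1 / s) = K / s + d / 4"
        using s by (simp add: K_def add_divide_distrib)
      also have "\<dots> \<le> d / 2" using sK by linarith
      finally have np: "norm (p - p0) < d / 2" by simp
      have "dist (p, y) (p0, x) \<le> norm (p - p0) + norm (y - x)"
        unfolding dist_norm by (simp add: norm_Pair_le)
      then have "dist (p0, x) (p, y) < d" using np ny r'(4) by (simp add: dist_commute)
      then have "(p, y) \<in> V" using d(2) by auto
      then have \<Phi>: "coeff p \<bullet> matrix (\<rho>2 y) < - c" and \<Psi>: "coeff p \<bullet> mat 1 < C" and pnz: "p \<noteq> 0"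
        by (auto simp: V_def \<Phi>_def \<Psi>_def U_def)
      have "matrix (\<lambda>h. (2 * B) *\<^sub>R h + s *\<^sub>R \<rho>2 y h) = (2 * B) *\<^sub>R mat 1 + s *\<^sub>R matrix (\<rho>2 y)"
        by (simp add: vec_eq_iff matrix_def mat_def axis_def)
      then have "coeff Q \<bullet> matrix (\<lambda>h. (2 * B) *\<^sub>R h + s *\<^sub>R \<rho>2 y h)
          = 2 * B * (coeff p \<bullet> mat 1) + s * (coeff p \<bullet> matrix (\<rho>2 y))"
        by (simp add: cp inner_add_right)
      also have "2 * B * (coeff p \<bullet> mat 1) \<le> 2 * \<bar>B\<bar> * C"
        by (rule mult_mono) (use coeff_trace_pos[OF pnz] \<Psi> in auto)
      also have "s * (coeff p \<bullet> matrix (\<rho>2 y)) \<le> s * (- c)"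
        using \<Phi> s by (intro mult_left_mono) auto
      finally have "coeff Q \<bullet> matrix (\<lambda>h. (2 * B) *\<^sub>R h + s *\<^sub>R \<rho>2 y h) \<le> 2 * \<bar>B\<bar> * C + s * (- c)" by simp
      then show ?thesis using sL unfolding Q_def by simp
    qed
    then show ?thesis using s by (intro exI[of _ s]) auto
  qed
  then show ?thesis using r' by blast
qed

end

lemma matrix_uminus: "matrix (\<lambda>h. - f h) = - matrix f"
  by (simp add: vec_eq_iff matrix_def)

text \<open>The two definitions index the Hessian in opposite orders, which the symmetry of the coefficient matrix absorbs.\<close>

lemma (in surface_energy) aniso_op_twice_diff:
  assumes "twice_diff f f1 f2 S" "open S" "x \<in> S"
  shows "aniso_op F G f x = coeff (f1 x, -1) \<bullet> matrix (f2 x)"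
proof -
  have nz: "(f1 x, -1::real) \<noteq> 0" by (simp add: zero_prod_def)
  have sym: "transpose (coeff (f1 x, -1)) = coeff (f1 x, -1)" using coeff_psd[OF nz] by (simp add: psd_def)
  have "grad f x = f1 x"
    by (simp add: grad_def vec_eq_iff twice_diff_dir_deriv[OF assms(1,3)] inner_axis)
  moreover have "(\<chi> i j. pd i (pd j f) x) = transpose (matrix (f2 x))"
    by (simp add: vec_eq_iff transpose_def matrix_def twice_diff_dir_deriv2[OF assms] inner_axis)
  ultimately have "aniso_op F G f x = transpose (coeff (f1 x, -1)) \<bullet> transpose (matrix (f2 x))"
    by (simp add: aniso_op_flow_coeff sym)
  then show ?thesis by (simp only: inner_transpose)
qed

text \<open>Since the coefficient at a horizontal vector pairs with the Hessian of \<open>\<rho>\<close> to minus a weighted sum of principal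
  curvatures, the curvature condition is what makes this pairing negative.\<close>

lemma (in surface_energy) boundary_barrier:
  fixes \<Omega> :: "(real^'n) set"
  assumes op: "open \<Omega>" and x: "x \<in> frontier \<Omega>"
    and normal: "\<And>y. y \<in> frontier \<Omega> \<Longrightarrow> inward_normal \<Omega> y (N y)"
    and frame: "principal_frame \<Omega> N k T x"
    and \<alpha>: "1 \<le> \<alpha>" "\<alpha> \<le> CARD('n) - 1"
    and kpos: "\<And>i. i \<in> {1..\<alpha>} \<Longrightarrow> 0 \<le> k i" and kneg: "\<And>i. i \<in> {\<alpha> + 1..CARD('n) - 1} \<Longrightarrow> k i < 0"
    and \<gamma>: "\<gamma>1 \<le> g0 * (m0 - m2)" "G0 * (M0 + m2) \<le> \<gamma>2"
    and pos: "0 < \<gamma>1 * (\<Sum>i = 1..\<alpha>. k i) + \<gamma>2 * (\<Sum>i = \<alpha> + 1..CARD('n) - 1. k i)"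
    and \<sigma>: "\<bar>\<sigma>\<bar> = (1::real)"
  shows "\<exists>\<rho> \<rho>1 \<rho>2 r. 0 < r \<and> twice_diff \<rho> \<rho>1 \<rho>2 (ball x r) \<and>
      \<rho> x = 0 \<and> (\<forall>y \<in> \<Omega> \<inter> ball x r. 0 \<le> \<rho> y) \<and>
      (\<forall>B \<Lambda>. \<exists>s\<ge>0. \<forall>y \<in> \<Omega> \<inter> ball x r.
         coeff (\<sigma> *\<^sub>R ((2 * B) *\<^sub>R (y - x) + s *\<^sub>R \<rho>1 y), -1)
           \<bullet> matrix (\<lambda>h. (2 * B) *\<^sub>R h + s *\<^sub>R \<rho>2 y h) \<le> \<Lambda>)"
proof -
  obtain r \<rho> \<rho>1 \<rho>2 where D: "defining_fun \<Omega> x r \<rho> \<rho>1 \<rho>2"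
    using inward_normal_defining_fun[OF normal[OF x]] by blast
  have r: "r > 0" and td: "twice_diff \<rho> \<rho>1 \<rho>2 (ball x r)" and nz: "\<rho>1 x \<noteq> 0" and zero: "\<rho> x = 0"
    and eq: "\<Omega> \<inter> ball x r = {y \<in> ball x r. 0 < \<rho> y}"
    using D by (auto simp: defining_fun_def)
  define I where "I = {1..<CARD('n)}"
  have "1 \<in> I" using dim by (simp add: I_def)
  note fr = defining_hessian_frame[OF op x normal frame D, folded I_def]
  have gx: "\<rho>1 x = norm (\<rho>1 x) *\<^sub>R N x" by (rule fr(1)[OF _ \<open>1 \<in> I\<close> \<open>1 \<in> I\<close>])
  have "norm (\<rho>1 x) * norm (N x) = norm (\<rho>1 x)" using arg_cong[OF gx, of norm] by simp
  then have nN: "norm (N x) = 1" using nz by simp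
  obtain e where e: "e > 0" and ort: "\<forall>y \<in> frontier \<Omega> \<inter> ball x e. \<forall>i\<in>I. N y \<bullet> T i y = 0 \<and>
        (\<forall>j\<in>I. T i y \<bullet> T j y = (if i = j then 1 else 0))"
    using frame unfolding principal_frame_def I_def by blast
  have xe: "x \<in> frontier \<Omega> \<inter> ball x e" using x e by simp
  have NT: "N x \<bullet> T i x = 0" if "i \<in> I" for i using ort xe that by blast
  have TT: "T i x \<bullet> T j x = (if i = j then 1 else 0)" if "i \<in> I" "j \<in> I" for i j using ort xe that by blast
  define q where "q = \<sigma> *\<^sub>R \<rho>1 x"
  have q: "q \<noteq> 0" "q = (\<sigma> * norm (\<rho>1 x)) *\<^sub>R N x"
    using nz \<sigma> arg_cong[OF gx, of "\<lambda>v. \<sigma> *\<^sub>R v"] by (auto simp: q_def)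
  have xr: "x \<in> ball x r" using r by simp
  have "coeff (q, 0) \<bullet> matrix (\<rho>2 x)
      = (\<Sum>i\<in>I. (- norm (\<rho>1 x) * k i) * (T i x \<bullet> (coeff (q, 0) *v T i x)))"
    unfolding I_def
  proof (rule coeff_hessian_frame[OF q nN])
    fix i j assume ij: "i \<in> {1..<CARD('n)}" "j \<in> {1..<CARD('n)}"
    show "T j x \<bullet> (matrix (\<rho>2 x) *v T i x) = (if i = j then - norm (\<rho>1 x) * k i else 0)"
      unfolding twice_diff_matrix[OF td xr] using ij by (intro fr(2)) (auto simp: I_def)
  qed (use NT TT in \<open>auto simp: I_def\<close>)
  also have "\<dots> = - norm (\<rho>1 x) * (\<Sum>i\<in>I. k i * (T i x \<bullet> (coeff (q, 0) *v T i x)))"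
    by (simp add: sum_distrib_left sum_negf mult.assoc)
  also have "\<dots> < 0"
  proof -
    have "0 < (\<Sum>i\<in>I. k i * (T i x \<bullet> (coeff (q, 0) *v T i x)))"
      unfolding I_def
    proof (rule weighted_curvature_pos[OF q(1) _ \<alpha> kpos kneg \<gamma> pos])
      fix i assume "i \<in> {1..<CARD('n)}"
      then have i: "i \<in> I" by (simp add: I_def)
      show "norm (T i x) = 1 \<and> T i x \<bullet> q = 0"
        using TT[OF i i] NT[OF i] by (simp add: q(2) norm_eq_1 inner_commute)
    qed
    then show ?thesis using nz by (simp add: mult_pos_pos)
  qed
  finally have neg: "coeff (\<sigma> *\<^sub>R \<rho>1 x, 0) \<bullet> matrix (\<rho>2 x) < 0" unfolding q_def .
  obtain r' where r': "0 < r'" "r' \<le> r" and bar: "\<forall>B \<Lambda>. \<exists>s\<ge>0. \<forall>y\<in>ball x r'.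
      coeff (\<sigma> *\<^sub>R ((2 * B) *\<^sub>R (y - x) + s *\<^sub>R \<rho>1 y), -1)
        \<bullet> matrix (\<lambda>h. (2 * B) *\<^sub>R h + s *\<^sub>R \<rho>2 y h) \<le> \<Lambda>"
    using steep_barrier[OF D \<sigma> neg] by blast
  have sub: "ball x r' \<subseteq> ball x r" using r' by auto
  have td': "twice_diff \<rho> \<rho>1 \<rho>2 (ball x r')" by (rule twice_diff_subset[OF td sub])
  have nonneg: "\<forall>y \<in> \<Omega> \<inter> ball x r'. 0 \<le> \<rho> y"
  proof
    fix y assume "y \<in> \<Omega> \<inter> ball x r'"
    then have "y \<in> {y \<in> ball x r. 0 < \<rho> y}" using sub eq by blast
    then show "0 \<le> \<rho> y" by simp
  qed
  have bar': "\<forall>B \<Lambda>. \<exists>s\<ge>0. \<forall>y\<in>\<Omega> \<inter> ball x r'.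
      coeff (\<sigma> *\<^sub>R ((2 * B) *\<^sub>R (y - x) + s *\<^sub>R \<rho>1 y), -1)
        \<bullet> matrix (\<lambda>h. (2 * B) *\<^sub>R h + s *\<^sub>R \<rho>2 y h) \<le> \<Lambda>"
    using bar by (meson IntD2)
  show ?thesis using r'(1) td' zero nonneg bar' by (intro exI conjI)
qed

section \<open>Convergence to the translating solution\<close>

theorem theorem4p3:
  fixes \<Omega> :: "(real^'n) set"
    and F G :: "(real^'n) \<times> real \<Rightarrow> real"
    and g0 G0 m0 M0 m1 m2 M lam \<gamma>1 \<gamma>2 :: real
    and g w u0 :: "real^'n \<Rightarrow> real"
    and u :: "real^'n \<Rightarrow> real \<Rightarrow> real"
    and N :: "real^'n \<Rightarrow> real^'n"
    and T :: "real^'n \<Rightarrow> nat \<Rightarrow> real^'n \<Rightarrow> real^'n"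
    and k :: "real^'n \<Rightarrow> nat \<Rightarrow> real"
    and \<alpha> :: "real^'n \<Rightarrow> nat"
  assumes "CARD('n) \<ge> 2"
    and "open \<Omega>" "connected \<Omega>" "\<Omega> \<noteq> {}" "bounded \<Omega>"
    and "\<And>x. x \<in> frontier \<Omega> \<Longrightarrow> inward_normal \<Omega> x (N x)"
    and "\<And>x. x \<in> frontier \<Omega> \<Longrightarrow> principal_frame \<Omega> N (k x) (T x) x"
    and "anisotropic F" "anisotropic G" "convex_on UNIV F"
    and "0 < g0" "0 < G0" "0 < m0" "0 < M0" "0 < m1" "0 < m2"
    and "\<And>p. p \<noteq> 0 \<Longrightarrow> g0 \<le> radial_ext G p \<and> radial_ext G p \<le> G0"
    and "\<And>p. p \<noteq> 0 \<Longrightarrow> m0 \<le> radial_ext F p \<and> radial_ext F p \<le> M0"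
    and "\<And>p i. p \<noteq> 0 \<Longrightarrow> \<bar>dp i (radial_ext F) p\<bar> < m1 / norm p"
    and "\<And>p. p \<noteq> 0 \<Longrightarrow> frobenius (hess_p (radial_ext F) p) < m2 / (norm p)\<^sup>2"
    and "Ck_bdry 3 \<Omega> g"
    and "\<And>x i. x \<in> frontier \<Omega> \<Longrightarrow> i \<in> {1..CARD('n) - 1} \<Longrightarrow>
           \<bar>bdry_deriv \<Omega> (T x i x) g x\<bar> \<le> M"
    and "\<And>x i j. x \<in> frontier \<Omega> \<Longrightarrow> i \<in> {1..CARD('n) - 1} \<Longrightarrow> j \<in> {1..CARD('n) - 1} \<Longrightarrow>
           \<bar>bdry_deriv \<Omega> (T x i x) (\<lambda>y. bdry_deriv \<Omega> (T x j y) g y) x\<bar> \<le> M"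
    and "\<And>x. x \<in> frontier \<Omega> \<Longrightarrow> 1 \<le> \<alpha> x \<and> \<alpha> x \<le> CARD('n) - 1"
    and "\<And>x i j. x \<in> frontier \<Omega> \<Longrightarrow> 1 \<le> i \<Longrightarrow> i \<le> j \<Longrightarrow> j \<le> CARD('n) - 1 \<Longrightarrow> k x j \<le> k x i"
    and "\<And>x i. x \<in> frontier \<Omega> \<Longrightarrow> i \<in> {1..\<alpha> x} \<Longrightarrow> 0 \<le> k x i"
    and "\<And>x i. x \<in> frontier \<Omega> \<Longrightarrow> i \<in> {\<alpha> x + 1..CARD('n) - 1} \<Longrightarrow> k x i < 0"
    and "\<exists>K. \<forall>x\<in>frontier \<Omega>. \<forall>i\<in>{1..CARD('n) - 1}. \<bar>k x i\<bar> \<le> K"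
    and "\<gamma>1 = g0 * (2 / (2 + M\<^sup>2) * m0 - sqrt 2 * M * m1 - m2)"
    and "\<gamma>2 = G0 * (M0 + sqrt 2 * M * m1 + m2)"
    and "0 < \<gamma>1"
    and "\<And>x. x \<in> frontier \<Omega> \<Longrightarrow>
           0 < \<gamma>1 * (\<Sum>i = 1..\<alpha> x. k x i) + \<gamma>2 * (\<Sum>i = \<alpha> x + 1..CARD('n) - 1. k x i)"
    and "elliptic_solution F G \<Omega> g lam w"
    and "parabolic_solution F G \<Omega> g lam u0 u"
  shows "\<exists>C. uniform_limit \<Omega> (\<lambda>t x. u x t - w x - lam * t - C) (\<lambda>x. 0) at_top"
proof -
  note dim = assms(1) and op = assms(2) and ne = assms(4) and bd = assms(5) and normal = assms(6) and frame = assms(7)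
    and anisoF = assms(8) and anisoG = assms(9) and cvx = assms(10)
    and G_range = assms(17) and F_range = assms(18) and F_hess = assms(20) and g_deriv = assms(22) and alpha_range = assms(24)
    and k_nonneg = assms(26) and k_neg = assms(27) and curvature = assms(32) and elliptic = assms(33) and parabolic = assms(34)
  have "Ck_on 2 F (- {0})" using anisoF unfolding anisotropic_def by blast
  then obtain F1 F2 where F12: "twice_diff F F1 F2 (- {0})" "\<And>v. continuous_on (- {0}) (\<lambda>p. F2 p v)"
    by (rule Ck_on_2_twice_diff) (rule that; assumption)
  \<comment> \<open>A boundary point with its frame shows \<open>M \<ge> 0\<close>, and then the tangential bounds of the coefficient are at least
    as good as the weights \<open>\<gamma>1\<close> and \<open>\<gamma>2\<close>.\<close>
  have "\<Omega> \<noteq> UNIV" using bd not_bounded_UNIV by blast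
  then obtain b where b: "b \<in> frontier \<Omega>" using frontier_not_empty[OF ne] by blast
  have "1 \<in> {1..CARD('n) - 1}" using dim by simp
  from g_deriv[OF b this] have M: "0 \<le> M" by linarith
  have "2 / (2 + M\<^sup>2) \<le> 1" by (simp add: divide_le_eq_1 add_pos_nonneg)
  then have "2 / (2 + M\<^sup>2) * m0 \<le> 1 * m0" using \<open>0 < m0\<close> by (intro mult_right_mono) auto
  moreover have Mm: "0 \<le> sqrt 2 * M * m1" using M \<open>0 < m1\<close> by simp
  ultimately have le: "2 / (2 + M\<^sup>2) * m0 - sqrt 2 * M * m1 - m2 \<le> m0 - m2" by linarith
  then have g1: "\<gamma>1 \<le> g0 * (m0 - m2)"
    unfolding \<open>\<gamma>1 = _\<close> using \<open>0 < g0\<close> by (intro mult_left_mono) auto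
  then have "0 < g0 * (m0 - m2)" using \<open>0 < \<gamma>1\<close> by linarith
  then have m: "m2 < m0" using \<open>0 < g0\<close> by (simp add: zero_less_mult_iff)
  have g2: "G0 * (M0 + m2) \<le> \<gamma>2"
    unfolding \<open>\<gamma>2 = _\<close> using \<open>0 < G0\<close> Mm by (intro mult_left_mono) auto
  interpret surface_energy F G g0 G0 m0 M0 m2 F1 F2
    by (rule surface_energy.intro[OF dim anisoF anisoG cvx \<open>0 < g0\<close> m G_range F_range F_hess F12])
  have barrier: "\<exists>\<rho> \<rho>1 \<rho>2 r. 0 < r \<and> twice_diff \<rho> \<rho>1 \<rho>2 (ball x r) \<and>
      \<rho> x = 0 \<and> (\<forall>y \<in> \<Omega> \<inter> ball x r. 0 \<le> \<rho> y) \<and>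
      (\<forall>B \<Lambda>. \<exists>s\<ge>0. \<forall>y \<in> \<Omega> \<inter> ball x r.
         coeff (\<sigma> *\<^sub>R ((2 * B) *\<^sub>R (y - x) + s *\<^sub>R \<rho>1 y), -1)
           \<bullet> matrix (\<lambda>h. (2 * B) *\<^sub>R h + s *\<^sub>R \<rho>2 y h) \<le> \<Lambda>)"
    if x: "x \<in> frontier \<Omega>" and \<sigma>: "\<bar>\<sigma>\<bar> = 1" for x and \<sigma> :: real
    using alpha_range[OF x]
    by (intro boundary_barrier[OF op x normal frame[OF x] _ _ k_nonneg[OF x] k_neg[OF x] g1 g2 curvature[OF x] \<sigma>]) auto
  have w: "Ck_on 2 w \<Omega>" "continuous_on (closure \<Omega>) w" "\<And>x. x \<in> \<Omega> \<Longrightarrow> lam = aniso_op F G w x"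
    "\<And>x. x \<in> frontier \<Omega> \<Longrightarrow> w x = g x"
    using elliptic unfolding elliptic_solution_def by blast+
  obtain w1 w2 where w12: "twice_diff w w1 w2 \<Omega>" "\<And>v. continuous_on \<Omega> (\<lambda>x. w2 x v)"
    by (rule Ck_on_2_twice_diff[OF w(1)]) (rule that; assumption)
  have u: "classical_class \<Omega> u" "\<And>x t. x \<in> \<Omega> \<Longrightarrow> 0 \<le> t \<Longrightarrow> dt u x t = aniso_op F G (\<lambda>y. u y t) x"
    "\<And>x t. x \<in> frontier \<Omega> \<Longrightarrow> 0 \<le> t \<Longrightarrow> u x t = g x + lam * t"
    using parabolic unfolding parabolic_solution_def by blast+
  have u_cont: "continuous_on (closure \<Omega> \<times> {0..}) (\<lambda>(x, t). u x t)"
    and u_C2: "\<And>t. 0 \<le> t \<Longrightarrow> Ck_on 2 (\<lambda>x. u x t) \<Omega>"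
    and u_dt: "\<And>x t. x \<in> \<Omega> \<Longrightarrow> 0 \<le> t \<Longrightarrow> u x differentiable (at t within {0..})"
    using u(1) unfolding classical_class_def by blast+
  have "\<exists>f1 f2. twice_diff (\<lambda>x. u x t) f1 f2 \<Omega>" if "0 < t" for t
    by (rule Ck_on_2_twice_diff[OF u_C2[of t]]) (use that in auto)
  then obtain u1 u2 where u12: "\<And>t. 0 < t \<Longrightarrow> twice_diff (\<lambda>x. u x t) (u1 t) (u2 t) \<Omega>" by metis
  have u_eq: "(u x has_real_derivative coeff (u1 t x, -1) \<bullet> matrix (u2 t x)) (at t within {0..})"
    if x: "x \<in> \<Omega>" and t: "0 < t" for x t
  proof -
    have "(u x has_vector_derivative dt u x t) (at t within {0..})"
      using u_dt[OF x, of t] t unfolding dt_def by (simp add: vector_derivative_works)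
    then show ?thesis
      using u(2)[OF x, of t] t aniso_op_twice_diff[OF u12[OF t] op x]
      by (simp add: has_real_derivative_iff_has_vector_derivative)
  qed
  have u_bdry: "u x t = w x + lam * t" if "x \<in> frontier \<Omega>" "0 \<le> t" for x t
    using u(3)[OF that] w(4)[OF that(1)] by simp
  have w_eq: "coeff (w1 x, -1) \<bullet> matrix (w2 x) = lam" if "x \<in> \<Omega>" for x
    using w(3)[OF that] aniso_op_twice_diff[OF w12(1) op that] by simp
  have above: "graph_flow \<Omega> (\<lambda>q. coeff (q, -1)) lam w w1 w2 u u1 u2"
  proof (rule graph_flow.intro[OF op bd coeff_elliptic w12 w(2) w_eq u12 u_cont u_eq u_bdry])
    fix x assume "x \<in> frontier \<Omega>"
    from barrier[OF this, of 1] show "\<exists>\<rho> \<rho>1 \<rho>2 r. 0 < r \<and> twice_diff \<rho> \<rho>1 \<rho>2 (ball x r) \<and>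
      \<rho> x = 0 \<and> (\<forall>y \<in> \<Omega> \<inter> ball x r. 0 \<le> \<rho> y) \<and>
      (\<forall>B \<Lambda>. \<exists>s\<ge>0. \<forall>y \<in> \<Omega> \<inter> ball x r.
         coeff ((2 * B) *\<^sub>R (y - x) + s *\<^sub>R \<rho>1 y, -1)
           \<bullet> matrix (\<lambda>h. (2 * B) *\<^sub>R h + s *\<^sub>R \<rho>2 y h) \<le> \<Lambda>)"
      by simp
  qed
  have below: "graph_flow \<Omega> (\<lambda>q. coeff (- q, -1)) (- lam) (\<lambda>x. - w x) (\<lambda>x. - w1 x) (\<lambda>x h. - w2 x h)
      (\<lambda>x t. - u x t) (\<lambda>t x. - u1 t x) (\<lambda>t x h. - u2 t x h)"
  proof (rule graph_flow.intro[OF op bd elliptic_coeff_reflect[OF coeff_elliptic] twice_diff_minus[OF w12(1)]])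
    show "continuous_on \<Omega> (\<lambda>x. - w2 x v)" for v by (rule continuous_on_minus[OF w12(2)])
    show "continuous_on (closure \<Omega>) (\<lambda>x. - w x)" by (rule continuous_on_minus[OF w(2)])
    show "coeff (- (- w1 x), -1) \<bullet> matrix (\<lambda>h. - w2 x h) = - lam" if "x \<in> \<Omega>" for x
      using w_eq[OF that] by (simp add: matrix_uminus)
    show "twice_diff (\<lambda>x. - u x t) (\<lambda>x. - u1 t x) (\<lambda>x h. - u2 t x h) \<Omega>" if "0 < t" for t
      by (rule twice_diff_minus[OF u12[OF that]])
    show "continuous_on (closure \<Omega> \<times> {0..}) (\<lambda>(x, t). - u x t)"
      using continuous_on_minus[OF u_cont] by (simp add: case_prod_beta)
    show "((\<lambda>t. - u x t) has_real_derivative coeff (- (- u1 t x), -1) \<bullet> matrix (\<lambda>h. - u2 t x h)) (at t within {0..})"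
      if "x \<in> \<Omega>" "0 < t" for x t
      using DERIV_minus[OF u_eq[OF that]] by (simp add: matrix_uminus)
    show "- u x t = - w x + - lam * t" if "x \<in> frontier \<Omega>" "0 \<le> t" for x t
      using u_bdry[OF that] by simp
    fix x assume "x \<in> frontier \<Omega>"
    from barrier[OF this, of "-1"] show "\<exists>\<rho> \<rho>1 \<rho>2 r. 0 < r \<and> twice_diff \<rho> \<rho>1 \<rho>2 (ball x r) \<and>
      \<rho> x = 0 \<and> (\<forall>y \<in> \<Omega> \<inter> ball x r. 0 \<le> \<rho> y) \<and>
      (\<forall>B \<Lambda>. \<exists>s\<ge>0. \<forall>y \<in> \<Omega> \<inter> ball x r.
         coeff (- ((2 * B) *\<^sub>R (y - x) + s *\<^sub>R \<rho>1 y), -1)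
           \<bullet> matrix (\<lambda>h. (2 * B) *\<^sub>R h + s *\<^sub>R \<rho>2 y h) \<le> \<Lambda>)"
      by simp
  qed
  have "uniform_limit \<Omega> (\<lambda>t x. u x t - w x - lam * t - 0) (\<lambda>x. 0) at_top"
    unfolding uniform_limit_iff
  proof (intro allI impI)
    fix e :: real assume e: "0 < e"
    then have e4: "0 < e / 4" by simp
    show "\<forall>\<^sub>F t in at_top. \<forall>x\<in>\<Omega>. dist (u x t - w x - lam * t - 0) 0 < e"
      using graph_flow.upper_bound_eventually[OF above e4] graph_flow.upper_bound_eventually[OF below e4]
    proof eventually_elim
      case (elim t)
      show ?case
      proof
        fix x assume x: "x \<in> \<Omega>"
        have "u x t - lam * t - w x \<le> 3 * (e / 4)" "- u x t - - lam * t - - w x \<le> 3 * (e / 4)"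
          using elim x by auto
        then show "dist (u x t - w x - lam * t - 0) 0 < e"
          using e unfolding dist_real_def by (simp add: abs_less_iff)
      qed
    qed
  qed
  then show ?thesis by blast
qed

end
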